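(* Let $f_0\in L^2$ have coefficients $\theta_{0,lk}=\langle f_0,\psi_{lk}\rangle$ and let $\Pi=\bigotimes_{l,k}\pi_{lk}$ be a product prior on the coefficients $\theta_{lk}=\langle f,\psi_{lk}\rangle$, where $\pi_{lk}$ has Lebesgue density $\varphi_{lk}(\cdot)=\sigma_l^{-1}\varphi(\cdot/\sigma_l)$ for a fixed probability density $\varphi$ on $\mathbb R$ and $\sigma_l>0$ with $\sum_{l,k}\sigma_l^2<\infty$. Suppose: (P1) for a finite constant $M>0$, $\sup_{l\in\mathcal L,k\in\mathcal Z_l}|\theta_{0,lk}|/\sigma_l\le M$; (P2) for some $\tau>M$ and $0<c_\varphi\le C_\varphi<\infty$: $\varphi(x)\le C_\varphi$ for all $x\in\mathbb R$, $\varphi(x)\ge c_\varphi$ for all $x\in(-\tau,\tau)$, and $\int_{\mathbb R}x^2\varphi(x)\,dx<\infty$. Suppose moreover that for every $k\in\mathcal Z_l$, $l\in\mathcal L$, the density $\varphi_{lk}$ is continuous near $\theta_{0,lk}$ (i.e. $\varphi$ is continuous near $\theta_{0,lk}/\sigma_l$). Let $\delta>1/2$. Then, for $\beta$ the bounded Lipschitz metric for weak convergence of probability measures on $H(\delta)$, as $n\to\infty$, $$\beta(\Pi_n\circ\tau_{\mathbb X^{(n)}}^{-1},\mathcal N)\to0\quad\text{in }P_{f_0}^n\text{-probability}.$$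
   Context: Basis. $L^2=L^2([0,1])$, $\langle f,g\rangle=\int_0^1 f\bar g$. Let $S\in\mathbb N$. Fix an $S$-regular orthonormal basis $\{\psi_{lk}: l\in\mathcal L,k\in\mathcal Z_l\}$ of $L^2$ ($\mathcal L,\mathcal Z_l\subset\mathbb Z$) with characteristic sequence $a_l$, meaning that every $\psi_{lk}$ is $S$-times differentiable with all derivatives in $L^2$ and either (a) $|\mathcal Z_l|=1$ and $a_l=\max(2,|l|)$, or (b) $\mathcal L\subset\mathbb N=\{1,2,\dots\}$ and $a_l=|\mathcal Z_l|=2^l$. Coefficients are treated as real. Space $H(\delta)$. For $\delta>1/2$, $H(\delta)$ is the Hilbert space of linear forms $f$ on $\mathrm{span}\{\psi_{lk}\}$ (identified with their coefficients $\langle f,\psi_{lk}\rangle$) with $\|f\|_{H(\delta)}^2=\sum_{l}a_l^{-1}(\log a_l)^{-2\delta}\sum_{k}|\langle f,\psi_{lk}\rangle|^2<\infty$. It contains $L^2$. Standard white noise $\mathbb W$, with i.i.d. $N(0,1)$ coefficients in the basis, is a tight centered Gaussian Borel random variable in $H(\delta)$; its law is $\mathcal N$. Model. For $f\in L^2$, $P_f^n$ is the law of $\mathbb X^{(n)}=f+n^{-1/2}\mathbb W$, equivalently of the observations $\mathbb X^{(n)}_{lk}=\theta_{lk}+n^{-1/2}\varepsilon_{lk}$ with $\theta_{lk}=\langle f,\psi_{lk}\rangle$ and $\varepsilon_{lk}$ i.i.d. $N(0,1)$. $\Pi_n=\Pi(\cdot\mid\mathbb X^{(n)})$ is the posterior,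 i.e. the conditional law of $f$ given $\mathbb X^{(n)}$ when $f\sim\Pi$, $\mathbb X^{(n)}\mid f\sim P_f^n$ (for product priors: the product over $(l,k)$ of the densities proportional to $\theta\mapsto e^{-n(\mathbb X^{(n)}_{lk}-\theta)^2/2}\varphi_{lk}(\theta)$), viewed as a Borel measure on $H(\delta)$. Data are generated under $P_{f_0}^n$. Further notation. $\tau_z(f)=\sqrt n(f-z)$ for $f,z\in H(\delta)$; $\beta(\mu,\nu)=\sup_u|\int u\,d(\mu-\nu)|$ over $u:H(\delta)\to\mathbb R$ with $\sup|u|+\mathrm{Lip}(u)\le1$. *)

theory Defs
  imports "HOL-Probability.Probability"
begin

subsection \<open>Square integrable functions on the unit interval and regular bases\<close>

definition L2 :: "(real \<Rightarrow> complex) set" where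
  "L2 = {f \<in> borel_measurable (lebesgue_on {0..1}).
           integrable (lebesgue_on {0..1}) (\<lambda>x. (norm (f x))\<^sup>2)}"

definition L2_inner :: "(real \<Rightarrow> complex) \<Rightarrow> (real \<Rightarrow> complex) \<Rightarrow> complex" where
  "L2_inner f g = (\<integral>x. f x * cnj (g x) \<partial>lebesgue_on {0..1})"

definition L2_norm :: "(real \<Rightarrow> complex) \<Rightarrow> real" where
  "L2_norm f = sqrt (\<integral>x. (norm (f x))\<^sup>2 \<partial>lebesgue_on {0..1})"

definition orthonormal_basis :: "'i set \<Rightarrow> ('i \<Rightarrow> real \<Rightarrow> complex) \<Rightarrow> bool" where
  "orthonormal_basis I \<psi> \<longleftrightarrow>
     (\<forall>i\<in>I. \<psi> i \<in> L2) \<and>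
     (\<forall>i\<in>I. \<forall>j\<in>I. L2_inner (\<psi> i) (\<psi> j) = (if i = j then 1 else 0)) \<and>
     (\<forall>f\<in>L2. \<forall>e>0. \<exists>J c. finite J \<and> J \<subseteq> I \<and>
        L2_norm (\<lambda>x. f x - (\<Sum>j\<in>J. c j * \<psi> j x)) < e)"

text \<open>Derivatives at the end points 0 and 1 are one-sided.\<close>

definition L2_differentiable :: "nat \<Rightarrow> (real \<Rightarrow> complex) \<Rightarrow> bool" where
  "L2_differentiable S f \<longleftrightarrow> (\<exists>D. D 0 = f \<and>
     (\<forall>j<S. \<forall>x\<in>{0..1}. (D j has_vector_derivative D (Suc j) x) (at x within {0..1})) \<and>
     (\<forall>j\<le>S. D j \<in> L2))"

definition regular_basis ::
  "nat \<Rightarrow> int set \<Rightarrow> (int \<Rightarrow> int set) \<Rightarrow> (int \<Rightarrow> real) \<Rightarrow> (int \<times> int \<Rightarrow> real \<Rightarrow> complex) \<Rightarrow> bool" where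
  "regular_basis S L Z a \<psi> \<longleftrightarrow>
     orthonormal_basis (Sigma L Z) \<psi> \<and>
     (\<forall>i\<in>Sigma L Z. L2_differentiable S (\<psi> i)) \<and>
     ((\<forall>l\<in>L. card (Z l) = 1 \<and> a l = real_of_int (max 2 \<bar>l\<bar>)) \<or>
      (L \<subseteq> {1..} \<and> (\<forall>l\<in>L. a l = real (card (Z l)) \<and> card (Z l) = 2 ^ nat l)))"


subsection \<open>The space of coefficient sequences\<close>

text \<open>
  A linear form is represented by its real coefficients, a function that is extensional on the
  index set \<open>I\<close> (so that elements are points of the product space \<open>Pi\<^sub>M I\<close>).  The space
  \<open>H(\<delta>)\<close> is \<open>H_space I (H_weight a \<delta>)\<close> with \<open>I = Sigma L Z\<close>.
\<close>

definition H_weight :: "(int \<Rightarrow> real) \<Rightarrow> real \<Rightarrow> int \<times> int \<Rightarrow> real" where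
  "H_weight a \<delta> = (\<lambda>(l, k). inverse (a l) * ln (a l) powr (- 2 * \<delta>))"

definition H_space :: "'i set \<Rightarrow> ('i \<Rightarrow> real) \<Rightarrow> ('i \<Rightarrow> real) set" where
  "H_space I w = {h \<in> extensional I. (\<lambda>i. w i * (h i)\<^sup>2) summable_on I}"

definition H_norm :: "'i set \<Rightarrow> ('i \<Rightarrow> real) \<Rightarrow> ('i \<Rightarrow> real) \<Rightarrow> real" where
  "H_norm I w h = sqrt (\<Sum>\<^sub>\<infinity>i\<in>I. w i * (h i)\<^sup>2)"

definition H_dist :: "'i set \<Rightarrow> ('i \<Rightarrow> real) \<Rightarrow> ('i \<Rightarrow> real) \<Rightarrow> ('i \<Rightarrow> real) \<Rightarrow> real" where
  "H_dist I w f g = H_norm I w (\<lambda>i\<in>I. f i - g i)"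

definition H_borel :: "'i set \<Rightarrow> ('i \<Rightarrow> real) \<Rightarrow> ('i \<Rightarrow> real) measure" where
  "H_borel I w = sigma (H_space I w)
     {U. openin (Metric_space.mtopology (H_space I w) (H_dist I w)) U}"

text \<open>
  A probability measure on the product space \<open>Pi\<^sub>M I borel\<close> that is carried by \<open>H_space I w\<close>,
  viewed as a Borel measure on \<open>H_space I w\<close>.  Points outside (a null set for the white noise law, and for the posterior given almost every observation) are sent
  to 0; the map is measurable by \<open>measurable_to_H\<close> below.
\<close>

definition to_H :: "'i set \<Rightarrow> ('i \<Rightarrow> real) \<Rightarrow> ('i \<Rightarrow> real) \<Rightarrow> ('i \<Rightarrow> real)" where
  "to_H I w x = (if x \<in> H_space I w then x else (\<lambda>i\<in>I. 0))"

definition H_law :: "'i set \<Rightarrow> ('i \<Rightarrow> real) \<Rightarrow> ('i \<Rightarrow> real) measure \<Rightarrow> ('i \<Rightarrow> real) measure" where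
  "H_law I w \<mu> = distr \<mu> (H_borel I w) (to_H I w)"


subsection \<open>White noise model, prior and posterior\<close>

definition white_noise :: "'i set \<Rightarrow> ('i \<Rightarrow> real) \<Rightarrow> ('i \<Rightarrow> real) measure" where
  "white_noise I w = H_law I w (PiM I (\<lambda>i. density lborel std_normal_density))"

definition basis_coeffs :: "'i set \<Rightarrow> ('i \<Rightarrow> real \<Rightarrow> complex) \<Rightarrow> (real \<Rightarrow> complex) \<Rightarrow> 'i \<Rightarrow> real" where
  "basis_coeffs I \<psi> f = (\<lambda>i\<in>I. Re (L2_inner f (\<psi> i)))"

definition obs_law :: "'i set \<Rightarrow> ('i \<Rightarrow> real) \<Rightarrow> nat \<Rightarrow> ('i \<Rightarrow> real) \<Rightarrow> ('i \<Rightarrow> real) measure" where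
  "obs_law I w n \<theta> = distr (white_noise I w) (H_borel I w)
     (\<lambda>W. \<lambda>i\<in>I. \<theta> i + W i / sqrt (real n))"

definition prior_density ::
  "(real \<Rightarrow> real) \<Rightarrow> (int \<Rightarrow> real) \<Rightarrow> int \<times> int \<Rightarrow> real \<Rightarrow> real" where
  "prior_density \<phi> \<sigma> = (\<lambda>(l, k) x. inverse (\<sigma> l) * \<phi> (x / \<sigma> l))"

text \<open>
  The posterior under the product prior with coordinate densities \<open>p i\<close>, given the observation
  \<open>x\<close>; that this is the conditional law is \<open>posterior_is_conditional_law\<close> below.
\<close>

definition posterior_density :: "nat \<Rightarrow> (real \<Rightarrow> real) \<Rightarrow> real \<Rightarrow> real \<Rightarrow> real" where
  "posterior_density n q y t =
     exp (- real n * (y - t)\<^sup>2 / 2) * q t /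
     (\<integral>s. exp (- real n * (y - s)\<^sup>2 / 2) * q s \<partial>lborel)"

definition posterior ::
  "'i set \<Rightarrow> ('i \<Rightarrow> real) \<Rightarrow> ('i \<Rightarrow> real \<Rightarrow> real) \<Rightarrow> nat \<Rightarrow> ('i \<Rightarrow> real) \<Rightarrow> ('i \<Rightarrow> real) measure" where
  "posterior I w p n x =
     H_law I w (PiM I (\<lambda>i. density lborel (\<lambda>t. ennreal (posterior_density n (p i) (x i) t))))"

definition rescale :: "'i set \<Rightarrow> nat \<Rightarrow> ('i \<Rightarrow> real) \<Rightarrow> ('i \<Rightarrow> real) \<Rightarrow> 'i \<Rightarrow> real" where
  "rescale I n z f = (\<lambda>i\<in>I. sqrt (real n) * (f i - z i))"


subsection \<open>Bounded Lipschitz metric and convergence in probability\<close>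

definition BL_ball :: "'a set \<Rightarrow> ('a \<Rightarrow> 'a \<Rightarrow> real) \<Rightarrow> ('a \<Rightarrow> real) set" where
  "BL_ball X d = {u. \<exists>A B. 0 \<le> A \<and> 0 \<le> B \<and> A + B \<le> 1 \<and>
     (\<forall>x\<in>X. \<bar>u x\<bar> \<le> A) \<and> (\<forall>x\<in>X. \<forall>y\<in>X. \<bar>u x - u y\<bar> \<le> B * d x y)}"

definition BL_dist :: "'a set \<Rightarrow> ('a \<Rightarrow> 'a \<Rightarrow> real) \<Rightarrow> 'a measure \<Rightarrow> 'a measure \<Rightarrow> real" where
  "BL_dist X d \<mu> \<nu> = (SUP u\<in>BL_ball X d. \<bar>(\<integral>x. u x \<partial>\<mu>) - (\<integral>x. u x \<partial>\<nu>)\<bar>)"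

text \<open>
  The outer measure makes the definition meaningful without a separate measurability claim for
  \<open>Y n\<close>; for measurable \<open>Y n\<close> it is the usual notion.
\<close>

definition tends_to_0_in_prob :: "(nat \<Rightarrow> 'a measure) \<Rightarrow> (nat \<Rightarrow> 'a \<Rightarrow> real) \<Rightarrow> bool" where
  "tends_to_0_in_prob P Y \<longleftrightarrow>
     (\<forall>e>0. (\<lambda>n. outer_measure_of (P n) {x \<in> space (P n). e < \<bar>Y n x\<bar>}) \<longlonglongrightarrow> 0)"

subsection \<open>The metric space and its Borel sets\<close>

context
  fixes I :: "'i set" and w :: "'i \<Rightarrow> real"
  assumes w_pos: "\<And>i. i \<in> I \<Longrightarrow> 0 < w i"
begin

lemma H_spaceI:
  assumes "x \<in> extensional I" "0 \<le> B"
    and B: "\<And>F. finite F \<Longrightarrow> F \<subseteq> I \<Longrightarrow> (\<Sum>i\<in>F. w i * (x i)\<^sup>2) \<le> B\<^sup>2"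
  shows "x \<in> H_space I w" "H_norm I w x \<le> B"
proof -
  have s: "(\<lambda>i. w i * (x i)\<^sup>2) summable_on I"
  proof (rule nonneg_bdd_above_summable_on)
    show "0 \<le> w i * (x i)\<^sup>2" if "i \<in> I" for i using w_pos[OF that] by simp
    show "bdd_above (sum (\<lambda>i. w i * (x i)\<^sup>2) ` {F. F \<subseteq> I \<and> finite F})"
      using B by (intro bdd_aboveI[of _ "B\<^sup>2"]) auto
  qed
  then show "x \<in> H_space I w" using assms by (simp add: H_space_def)
  have "(\<Sum>\<^sub>\<infinity>i\<in>I. w i * (x i)\<^sup>2) \<le> B\<^sup>2" by (rule infsum_le_finite_sums[OF s B])
  then show "H_norm I w x \<le> B" using \<open>0 \<le> B\<close> by (simp add: H_norm_def real_le_lsqrt)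
qed

lemma H_norm_nonneg: "0 \<le> H_norm I w x"
  unfolding H_norm_def using w_pos by (auto intro!: infsum_nonneg simp: less_imp_le)

lemma H_norm_power2: "(H_norm I w x)\<^sup>2 = (\<Sum>\<^sub>\<infinity>i\<in>I. w i * (x i)\<^sup>2)"
  unfolding H_norm_def using w_pos
  by (intro real_sqrt_pow2 infsum_nonneg) (auto simp: less_imp_le)

lemma sum_le_H_norm:
  assumes "x \<in> H_space I w" "finite F" "F \<subseteq> I"
  shows "(\<Sum>i\<in>F. w i * (x i)\<^sup>2) \<le> (H_norm I w x)\<^sup>2"
  unfolding H_norm_power2 using assms w_pos
  by (intro finite_sum_le_infsum) (auto simp: H_space_def less_imp_le)

lemma sum_as_L2_set:
  assumes "F \<subseteq> I"
  shows "(\<Sum>i\<in>F. w i * (x i)\<^sup>2) = (L2_set (\<lambda>i. sqrt (w i) * x i) F)\<^sup>2"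
proof -
  have "w i * (x i)\<^sup>2 = (sqrt (w i) * x i)\<^sup>2" if "i \<in> F" for i
    using w_pos[of i] assms that by (auto simp: power_mult_distrib)
  then show ?thesis by (simp add: L2_set_def sum_nonneg)
qed

lemma H_space_add:
  assumes x: "x \<in> H_space I w" and y: "y \<in> H_space I w"
  shows "(\<lambda>i\<in>I. x i + y i) \<in> H_space I w"
    "H_norm I w (\<lambda>i\<in>I. x i + y i) \<le> H_norm I w x + H_norm I w y"
proof -
  have "(\<Sum>i\<in>F. w i * ((\<lambda>i\<in>I. x i + y i) i)\<^sup>2) \<le> (H_norm I w x + H_norm I w y)\<^sup>2"
    if F: "finite F" "F \<subseteq> I" for F
  proof -
    have le: "L2_set (\<lambda>i. sqrt (w i) * z i) F \<le> H_norm I w z" if "z \<in> H_space I w" for z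
      using sum_le_H_norm[OF that F] H_norm_nonneg
      unfolding sum_as_L2_set[OF F(2)] by (rule power2_le_imp_le)
    have "L2_set (\<lambda>i. sqrt (w i) * (\<lambda>i\<in>I. x i + y i) i) F
        = L2_set (\<lambda>i. sqrt (w i) * x i + sqrt (w i) * y i) F"
      using F by (intro L2_set_cong) (auto simp: algebra_simps)
    also have "\<dots> \<le> L2_set (\<lambda>i. sqrt (w i) * x i) F + L2_set (\<lambda>i. sqrt (w i) * y i) F"
      by (rule L2_set_triangle_ineq)
    also have "\<dots> \<le> H_norm I w x + H_norm I w y" by (intro add_mono le x y)
    finally show ?thesis
      unfolding sum_as_L2_set[OF F(2)] by (rule power_mono) simp
  qed
  from H_spaceI[OF restrict_extensional add_nonneg_nonneg[OF H_norm_nonneg H_norm_nonneg] this]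
  show "(\<lambda>i\<in>I. x i + y i) \<in> H_space I w"
    "H_norm I w (\<lambda>i\<in>I. x i + y i) \<le> H_norm I w x + H_norm I w y"
    by blast+
qed

lemma H_space_uminus: "x \<in> H_space I w \<Longrightarrow> (\<lambda>i\<in>I. - x i) \<in> H_space I w"
  unfolding H_space_def by (auto cong: summable_on_cong)

lemma H_space_diff:
  assumes "x \<in> H_space I w" "y \<in> H_space I w"
  shows "(\<lambda>i\<in>I. x i - y i) \<in> H_space I w"
proof -
  have "(\<lambda>i\<in>I. x i - y i) = (\<lambda>i\<in>I. x i + (\<lambda>i\<in>I. - y i) i)" by (auto simp: restrict_def)
  then show ?thesis using H_space_add(1)[OF assms(1) H_space_uminus[OF assms(2)]] by simp
qed

lemma zero_in_H_space: "(\<lambda>i\<in>I. 0) \<in> H_space I w"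
  by (rule H_spaceI(1)[of _ 0]) (auto simp: sum_nonpos intro!: sum_nonpos)

lemma Metric_space_H: "Metric_space (H_space I w) (H_dist I w)"
proof
  fix x y
  show "0 \<le> H_dist I w x y" by (simp add: H_dist_def H_norm_nonneg)
  show "H_dist I w x y = H_dist I w y x"
    by (auto simp: H_dist_def H_norm_def power2_commute cong: infsum_cong)
next
  fix x y assume x: "x \<in> H_space I w" and y: "y \<in> H_space I w"
  show "(H_dist I w x y = 0) = (x = y)"
  proof
    assume "H_dist I w x y = 0"
    then have 0: "(H_norm I w (\<lambda>i\<in>I. x i - y i))\<^sup>2 = 0" by (simp add: H_dist_def)
    have "x i = y i" if "i \<in> I" for i
      using sum_le_H_norm[OF H_space_diff[OF x y], of "{i}"] that w_pos[OF that]
      unfolding 0 by (simp add: mult_le_0_iff)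
    then show "x = y" using x y unfolding H_space_def by (auto intro: extensionalityI)
  next
    assume "x = y"
    then show "H_dist I w x y = 0"
      by (auto simp: H_dist_def H_norm_def intro!: infsum_0)
  qed
next
  fix x y z assume "x \<in> H_space I w" "y \<in> H_space I w" "z \<in> H_space I w"
  note H_space_add(2)[OF H_space_diff[OF this(1,2)] H_space_diff[OF this(2,3)]]
  moreover have "(\<lambda>i\<in>I. (\<lambda>i\<in>I. x i - y i) i + (\<lambda>i\<in>I. y i - z i) i) = (\<lambda>i\<in>I. x i - z i)"
    by (auto simp: restrict_def)
  ultimately show "H_dist I w x z \<le> H_dist I w x y + H_dist I w y z"
    by (simp add: H_dist_def)
qed

lemma space_H_borel: "space (H_borel I w) = H_space I w"
  unfolding H_borel_def by (rule space_measure_of)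
    (auto simp: Metric_space.openin_mtopology[OF Metric_space_H])

lemma H_separable:
  assumes "countable I"
  shows "\<exists>D. countable D \<and> D \<subseteq> H_space I w \<and>
    (\<forall>h\<in>H_space I w. \<forall>e>0. \<exists>q\<in>D. H_dist I w h q < e)"
proof (intro exI conjI ballI allI impI)
  let ?D = "\<Union>F\<in>{F. finite F \<and> F \<subseteq> I}. (\<lambda>q. \<lambda>i\<in>I. if i \<in> F then q i else 0) ` (F \<rightarrow>\<^sub>E \<rat>)"
  show "countable ?D"
    using countable_Collect_finite_subset[OF assms]
    by (auto intro!: countable_UN countable_image countable_PiE countable_rat)
  show "?D \<subseteq> H_space I w"
  proof safe
    fix F q assume F: "finite F" "F \<subseteq> I"
    let ?x = "\<lambda>i\<in>I. if i \<in> F then q i else (0::real)"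
    have *: "0 \<le> w i * (?x i)\<^sup>2" if "i \<in> I" for i using w_pos[OF that] by simp
    have "(\<Sum>i\<in>G. w i * (?x i)\<^sup>2) \<le> (sqrt (\<Sum>i\<in>F. w i * (?x i)\<^sup>2))\<^sup>2"
      if G: "finite G" "G \<subseteq> I" for G
    proof -
      have "(\<Sum>i\<in>G. w i * (?x i)\<^sup>2) = (\<Sum>i\<in>G \<inter> F. w i * (?x i)\<^sup>2)"
        using G by (intro sum.mono_neutral_right) auto
      also have "\<dots> \<le> (\<Sum>i\<in>F. w i * (?x i)\<^sup>2)"
        using F * by (intro sum_mono2) blast+
      also have "\<dots> = (sqrt (\<Sum>i\<in>F. w i * (?x i)\<^sup>2))\<^sup>2"
        using F * by (subst real_sqrt_pow2) (blast intro: sum_nonneg)+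
      finally show ?thesis .
    qed
    moreover have "0 \<le> sqrt (\<Sum>i\<in>F. w i * (?x i)\<^sup>2)"
      using F * by (intro real_sqrt_ge_zero sum_nonneg) blast
    ultimately show "?x \<in> H_space I w" by (intro H_spaceI(1)[OF restrict_extensional])
  qed
  fix h and e :: real assume h: "h \<in> H_space I w" and e: "e > 0"
  define \<epsilon> where "\<epsilon> = e\<^sup>2 / 8"
  have \<epsilon>: "\<epsilon> > 0" using e by (simp add: \<epsilon>_def)
  obtain F where F: "finite F" "F \<subseteq> I"
    and Fd: "dist (\<Sum>i\<in>F. w i * (h i)\<^sup>2) (\<Sum>\<^sub>\<infinity>i\<in>I. w i * (h i)\<^sup>2) \<le> \<epsilon>"
    using infsum_finite_approximation[of "\<lambda>i. w i * (h i)\<^sup>2" I \<epsilon>] h \<epsilon> by (auto simp: H_space_def)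
  have "\<exists>r\<in>\<rat>. w i * (h i - r)\<^sup>2 \<le> \<epsilon> / (card F + 1)" if "i \<in> F" for i
  proof -
    have wi: "w i > 0" using that F w_pos by auto
    define s where "s = sqrt (\<epsilon> / (card F + 1) / w i)"
    have s: "s > 0" using wi \<epsilon> by (simp add: s_def)
    from Rats_dense_in_real[of "h i" "h i + s"] s obtain r where r: "r \<in> \<rat>" "h i < r" "r < h i + s"
      by auto
    then have "(h i - r)\<^sup>2 \<le> s\<^sup>2" by (intro power2_le_iff_abs_le[THEN iffD2]) auto
    also have "s\<^sup>2 = \<epsilon> / (card F + 1) / w i" using wi \<epsilon> by (simp add: s_def)
    finally have "w i * (h i - r)\<^sup>2 \<le> w i * (\<epsilon> / (card F + 1) / w i)"
      using wi by (intro mult_left_mono) auto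
    then show ?thesis using wi r(1) by (intro bexI[of _ r]) auto
  qed
  then obtain q where q: "\<And>i. i \<in> F \<Longrightarrow> q i \<in> \<rat>"
    "\<And>i. i \<in> F \<Longrightarrow> w i * (h i - q i)\<^sup>2 \<le> \<epsilon> / (card F + 1)"
    by metis
  let ?x = "\<lambda>i\<in>I. if i \<in> F then restrict q F i else 0"
  have xD: "?x \<in> ?D" using F q by (intro UN_I[of F] imageI) auto
  have "(\<Sum>i\<in>G. w i * ((\<lambda>i\<in>I. h i - ?x i) i)\<^sup>2) \<le> (e / 2)\<^sup>2" if G: "finite G" "G \<subseteq> I" for G
  proof -
    let ?g = "\<lambda>i. w i * ((\<lambda>i\<in>I. h i - ?x i) i)\<^sup>2"
    have in_F: "?g i = w i * (h i - q i)\<^sup>2" if "i \<in> F" for i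
      using that F(2) by auto
    have out_F: "?g i = w i * (h i)\<^sup>2" if "i \<in> G - F" for i
    proof -
      have "i \<in> I" "i \<notin> F" using that G(2) by auto
      then show ?thesis by simp
    qed
    have "sum ?g G = sum ?g (G \<inter> F) + sum ?g (G - F)"
      by (rule sum.Int_Diff[OF G(1)])
    moreover have "sum ?g (G \<inter> F) \<le> (\<Sum>i\<in>G \<inter> F. \<epsilon> / (card F + 1))"
    proof (rule sum_mono)
      fix i assume "i \<in> G \<inter> F"
      then have "i \<in> F" by simp
      then show "?g i \<le> \<epsilon> / (card F + 1)" unfolding in_F[OF \<open>i \<in> F\<close>] by (rule q(2))
    qed
    moreover have "(\<Sum>i\<in>G \<inter> F. \<epsilon> / (card F + 1)) \<le> (\<Sum>i\<in>F. \<epsilon> / (card F + 1))"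
      using F \<epsilon> by (intro sum_mono2) auto
    moreover have "(\<Sum>i\<in>F. \<epsilon> / (card F + 1)) \<le> \<epsilon>"
    proof -
      have "\<epsilon> * (card F / (card F + 1)) \<le> \<epsilon> * 1"
        using \<epsilon> by (intro mult_left_mono) auto
      then show ?thesis by (simp add: mult.commute)
    qed
    moreover have "sum ?g (G - F) = (\<Sum>i\<in>G - F. w i * (h i)\<^sup>2)"
      by (intro sum.cong refl out_F)
    moreover have "(\<Sum>i\<in>G - F. w i * (h i)\<^sup>2) + (\<Sum>i\<in>F. w i * (h i)\<^sup>2) = (\<Sum>i\<in>G \<union> F. w i * (h i)\<^sup>2)"
      using G F by (subst sum.union_disjoint[symmetric]) auto
    moreover have "(\<Sum>i\<in>G \<union> F. w i * (h i)\<^sup>2) \<le> (\<Sum>\<^sub>\<infinity>i\<in>I. w i * (h i)\<^sup>2)"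
      using sum_le_H_norm[OF h, of "G \<union> F"] G F by (simp add: H_norm_power2)
    moreover have "(e / 2)\<^sup>2 = 2 * \<epsilon>" by (simp add: \<epsilon>_def power2_eq_square)
    ultimately show ?thesis using Fd unfolding dist_real_def abs_le_iff by linarith
  qed
  then have "H_dist I w h ?x \<le> e / 2"
    unfolding H_dist_def using e by (intro H_spaceI(2)[OF restrict_extensional]) auto
  with xD e show "\<exists>q\<in>?D. H_dist I w h q < e"
    by (intro bexI[OF _ xD]) simp
qed

lemma sets_H_borel_subset:
  assumes I: "countable I"
  shows "sets (H_borel I w) \<subseteq> sets (PiM I (\<lambda>i. borel))"
proof -
  interpret H: Metric_space "H_space I w" "H_dist I w" by (rule Metric_space_H)
  let ?P = "PiM I (\<lambda>i. borel :: real measure)"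
  define N :: "('i \<Rightarrow> real) \<Rightarrow> ennreal" where
    "N x = (SUP F\<in>{F. finite F \<and> F \<subseteq> I}. ennreal (\<Sum>i\<in>F. w i * (x i)\<^sup>2))" for x
  have NI: "x \<in> H_space I w \<and> H_norm I w x < r"
    if x: "x \<in> extensional I" "N x < ennreal (r\<^sup>2)" "r > 0" for x r
  proof -
    obtain b where b: "N x = ennreal b" "0 \<le> b" "b < r\<^sup>2"
      using x by (cases "N x" rule: ennreal_cases) (auto simp: ennreal_less_iff)
    have "(\<Sum>i\<in>F. w i * (x i)\<^sup>2) \<le> (sqrt b)\<^sup>2" if "finite F" "F \<subseteq> I" for F
    proof -
      have "ennreal (\<Sum>i\<in>F. w i * (x i)\<^sup>2) \<le> N x" unfolding N_def using that by (auto intro: SUP_upper)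
      then show ?thesis using b by simp
    qed
    from H_spaceI[OF x(1) _ this] b have "x \<in> H_space I w" "H_norm I w x \<le> sqrt b" by auto
    moreover have "sqrt b < r" using b x(3) by (simp add: real_less_lsqrt)
    ultimately show ?thesis by simp
  qed
  have Nle: "N x \<le> ennreal ((H_norm I w x)\<^sup>2)" if "x \<in> H_space I w" for x
    unfolding N_def using sum_le_H_norm[OF that] by (auto intro!: SUP_least ennreal_leI)
  have ball: "H.mball q r = {x \<in> space ?P. N (\<lambda>i\<in>I. x i - q i) < ennreal (r\<^sup>2)}"
    if q: "q \<in> H_space I w" and r: "r > 0" for q r
  proof safe
    fix x assume "x \<in> H.mball q r"
    then have x: "x \<in> H_space I w" "H_dist I w x q < r" by (auto simp: H.commute)
    show "x \<in> space ?P" using x by (auto simp: space_PiM PiE_def H_space_def)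
    have "N (\<lambda>i\<in>I. x i - q i) \<le> ennreal ((H_dist I w x q)\<^sup>2)"
      unfolding H_dist_def by (rule Nle[OF H_space_diff[OF x(1) q]])
    also have "(H_dist I w x q)\<^sup>2 < r\<^sup>2"
      by (rule power_strict_mono[OF x(2)]) auto
    then have "ennreal ((H_dist I w x q)\<^sup>2) < ennreal (r\<^sup>2)"
      by (simp add: ennreal_less_iff)
    finally show "N (\<lambda>i\<in>I. x i - q i) < ennreal (r\<^sup>2)" .
  next
    fix x assume x: "x \<in> space ?P" "N (\<lambda>i\<in>I. x i - q i) < ennreal (r\<^sup>2)"
    then have d: "(\<lambda>i\<in>I. x i - q i) \<in> H_space I w" "H_dist I w x q < r"
      using NI[of "\<lambda>i\<in>I. x i - q i" r] r by (auto simp: H_dist_def)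
    have "(\<lambda>i\<in>I. (\<lambda>i\<in>I. x i - q i) i + q i) = x"
      using x(1) by (auto simp: space_PiM PiE_def extensional_def restrict_def)
    then have "x \<in> H_space I w" using H_space_add(1)[OF d(1) q] by simp
    then show "x \<in> H.mball q r" using d q by (auto simp: H.commute)
  qed
  have meas_ball: "H.mball q r \<in> sets ?P" if "q \<in> H_space I w" and "r > 0" for q r
  proof -
    have "(\<lambda>x. \<Sum>i\<in>F. w i * ((\<lambda>i\<in>I. x i - q i) i)\<^sup>2) \<in> borel_measurable ?P"
      if "finite F" "F \<subseteq> I" for F
    proof (rule borel_measurable_sum)
      fix i assume "i \<in> F"
      then have [measurable]: "(\<lambda>x. x i) \<in> borel_measurable ?P" and "i \<in> I"
        using that by auto
      then show "(\<lambda>x. w i * ((\<lambda>i\<in>I. x i - q i) i)\<^sup>2) \<in> borel_measurable ?P" by simp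
    qed
    then have [measurable]: "(\<lambda>x. N (\<lambda>i\<in>I. x i - q i)) \<in> borel_measurable ?P"
      unfolding N_def using countable_Collect_finite_subset[OF I]
      by (intro borel_measurable_SUP measurable_compose[OF _ measurable_ennreal]) auto
    show ?thesis unfolding ball[OF that] by measurable
  qed
  obtain D where D: "countable D" "D \<subseteq> H_space I w"
    "\<And>h e. h \<in> H_space I w \<Longrightarrow> e > 0 \<Longrightarrow> \<exists>q\<in>D. H_dist I w h q < e"
    using H_separable[OF I] by blast
  have "U \<in> sets ?P" if U: "openin H.mtopology U" for U
  proof -
    define K where "K = {(q, n). q \<in> D \<and> H.mball q (inverse (real (Suc n))) \<subseteq> U}"
    have "x \<in> (\<Union>(q, n)\<in>K. H.mball q (inverse (real (Suc n))))" if x: "x \<in> U" for x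
    proof -
      obtain r where r: "r > 0" "H.mball x r \<subseteq> U" and xH: "x \<in> H_space I w"
        using U x unfolding H.openin_mtopology by blast
      obtain n where n: "inverse (real (Suc n)) < r / 2"
        using reals_Archimedean[of "r / 2"] r by auto
      obtain q where q: "q \<in> D" "H_dist I w x q < inverse (real (Suc n))"
        using D(3)[OF xH, of "inverse (real (Suc n))"] by auto
      have "H.mball q (inverse (real (Suc n))) \<subseteq> H.mball x r"
      proof
        fix y assume "y \<in> H.mball q (inverse (real (Suc n)))"
        then show "y \<in> H.mball x r"
          using H.triangle[of x q y] q n xH by auto
      qed
      with r q have "(q, n) \<in> K" by (auto simp: K_def)
      moreover have "x \<in> H.mball q (inverse (real (Suc n)))"
        using q D xH by (auto simp: H.commute)
      ultimately show ?thesis by blast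
    qed
    then have "U = (\<Union>(q, n)\<in>K. H.mball q (inverse (real (Suc n))))"
      by (auto simp: K_def)
    also have "\<dots> \<in> sets ?P"
    proof (intro sets.countable_UN' )
      show "countable K"
        by (rule countable_subset[of _ "D \<times> UNIV"]) (use D in \<open>auto simp: K_def\<close>)
      show "(\<lambda>x. case x of (q, n) \<Rightarrow> H.mball q (inverse (real (Suc n)))) ` K \<subseteq> sets ?P"
        using D by (auto simp: K_def intro!: meas_ball)
    qed
    finally show ?thesis .
  qed
  then have gen: "{U. openin H.mtopology U} \<subseteq> sets ?P" by auto
  have HP: "H_space I w \<in> sets ?P"
    using gen openin_topspace[of H.mtopology] by auto
  have sub: "{U. openin H.mtopology U} \<subseteq> Pow (H_space I w)"
    by (auto simp: H.openin_mtopology)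
  show ?thesis
  proof
    fix A assume "A \<in> sets (H_borel I w)"
    then have "A \<in> sigma_sets (H_space I w) {U. openin H.mtopology U}"
      unfolding H_borel_def sets_measure_of[OF sub] .
    then show "A \<in> sets ?P"
      by induction (use gen HP in auto)
  qed
qed

lemma measurable_to_H:
  assumes "countable I"
  shows "to_H I w \<in> PiM I (\<lambda>i. borel) \<rightarrow>\<^sub>M H_borel I w"
proof (rule measurableI)
  let ?P = "PiM I (\<lambda>i. borel :: real measure)"
  note sub = sets_H_borel_subset[OF assms]
  have H: "H_space I w \<in> sets ?P"
    using sub sets.top[of "H_borel I w"] by (auto simp: space_H_borel)
  show "to_H I w x \<in> space (H_borel I w)" for x
    by (simp add: to_H_def space_H_borel zero_in_H_space)
  fix A assume A: "A \<in> sets (H_borel I w)"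
  have "to_H I w -` A \<inter> space ?P =
      A \<union> (if (\<lambda>i\<in>I. 0) \<in> A then space ?P - H_space I w else {})"
    using sets.sets_into_space[OF A] sets.sets_into_space[OF H]
    by (auto simp: to_H_def space_H_borel split: if_splits)
  then show "to_H I w -` A \<inter> space ?P \<in> sets ?P"
    using A sub H by auto
qed

end

lemma H_weight_pos:
  assumes "regular_basis S L Z a \<psi>" "i \<in> Sigma L Z"
  shows "0 < H_weight a \<delta> i"
proof -
  obtain l k where i: "i = (l, k)" "l \<in> L" using assms(2) by auto
  have "1 < a l"
    using assms(1) i(2) unfolding regular_basis_def by fastforce
  then show ?thesis by (auto simp: i H_weight_def)
qed

subsection \<open>The posterior is a conditional law\<close>

lemma emeasure_PiM_box:
  fixes M :: "'i \<Rightarrow> real measure"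
  assumes M: "\<And>i. i \<in> I \<Longrightarrow> prob_space (M i)" "\<And>i. i \<in> I \<Longrightarrow> sets (M i) = sets borel"
    and J: "finite J" "J \<subseteq> I" and A: "\<And>i. i \<in> J \<Longrightarrow> A i \<in> sets borel"
  shows "emeasure (PiM I M) (prod_emb I (\<lambda>i. borel) J (Pi\<^sub>E J A)) = (\<Prod>i\<in>J. emeasure (M i) (A i))"
proof -
  have "space (M i) = UNIV" if "i \<in> I" for i
    using sets_eq_imp_space_eq[OF M(2)[OF that]] by simp
  then have "prod_emb I (\<lambda>i. borel) J (Pi\<^sub>E J A) = prod_emb I M J (Pi\<^sub>E J A)"
    by (simp add: prod_emb_def cong: PiE_cong)
  moreover have "A i \<in> sets (M i)" if "i \<in> J" for i
    using A[OF that] M(2)[of i] J that by auto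
  ultimately show ?thesis using emeasure_PiM_emb[of I M J A] M(1) J by auto
qed

lemma kernel_PiM:
  fixes K :: "'i \<Rightarrow> real \<Rightarrow> real measure"
  assumes K: "\<And>i. i \<in> I \<Longrightarrow> K i \<in> borel \<rightarrow>\<^sub>M prob_algebra borel"
  shows "(\<lambda>x. PiM I (\<lambda>i. K i (x i))) \<in> PiM I (\<lambda>i. borel) \<rightarrow>\<^sub>M prob_algebra (PiM I (\<lambda>i. borel))"
proof (rule measurable_prob_algebra_generated[OF sets_PiM Int_stable_prod_algebra prod_algebra_sets_into_space])
  have K': "prob_space (K i t)" "sets (K i t) = sets borel" if "i \<in> I" for i t
    using measurable_space[OF K[OF that], of t] by (auto simp: space_prob_algebra)
  show "prob_space (PiM I (\<lambda>i. K i (x i)))" for x by (intro prob_space_PiM K')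
  show "sets (PiM I (\<lambda>i. K i (x i))) = sets (PiM I (\<lambda>i. borel))" for x
    by (intro sets_PiM_cong refl K')
  fix B assume "B \<in> prod_algebra I (\<lambda>i. borel :: real measure)"
  then obtain J E where B: "B = prod_emb I (\<lambda>i. borel) J (Pi\<^sub>E J E)" "finite J" "J \<subseteq> I"
    "\<And>i. i \<in> J \<Longrightarrow> E i \<in> sets borel"
    by (rule prod_algebraE) auto
  have "(\<lambda>x. emeasure (K i (x i)) (E i)) \<in> borel_measurable (PiM I (\<lambda>i. borel))" if "i \<in> J" for i
  proof -
    have "i \<in> I" using that B by auto
    then have "(\<lambda>t. emeasure (K i t) (E i)) \<in> borel_measurable borel"
      using measurable_emeasure_kernel[OF measurable_prob_algebraD[OF K] B(4)[OF that]] by auto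
    then show ?thesis using \<open>i \<in> I\<close> by (intro measurable_compose[OF measurable_component_singleton])
  qed
  then show "(\<lambda>x. emeasure (PiM I (\<lambda>i. K i (x i))) B) \<in> borel_measurable (PiM I (\<lambda>i. borel))"
    unfolding B(1) by (subst emeasure_PiM_box) (use K' B in auto)
qed

lemma nn_integral_PiM_prod:
  fixes M :: "'i \<Rightarrow> real measure"
  assumes M: "\<And>i. i \<in> I \<Longrightarrow> prob_space (M i)" "\<And>i. i \<in> I \<Longrightarrow> sets (M i) = sets borel"
    and J: "finite J" "J \<subseteq> I" and f: "\<And>i. i \<in> J \<Longrightarrow> f i \<in> borel_measurable borel"
  shows "(\<integral>\<^sup>+x. (\<Prod>i\<in>J. f i (x i)) \<partial>PiM I M) = (\<Prod>i\<in>J. \<integral>\<^sup>+t. f i t \<partial>M i)"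
proof -
  define M' where "M' i = (if i \<in> I then M i else return borel 0)" for i
  have M': "prob_space (M' i)" "sets (M' i) = sets borel" for i
    using M by (auto simp: M'_def prob_space_return)
  interpret product_prob_space M' I
    using M'(1) by (simp add: product_prob_space_def product_prob_space_axioms_def
        product_sigma_finite_def prob_space_imp_sigma_finite)
  have f': "f i \<in> borel_measurable (M' i)" if "i \<in> J" for i
    using f[OF that] by (simp cong: measurable_cong_sets add: M'(2))
  have "PiM I M = PiM I M'" by (intro PiM_cong) (auto simp: M'_def)
  then have "(\<integral>\<^sup>+x. (\<Prod>i\<in>J. f i (x i)) \<partial>PiM I M) = (\<integral>\<^sup>+x. (\<Prod>i\<in>J. f i (restrict x J i)) \<partial>PiM I M')"
    by simp
  also have "\<dots> = (\<integral>\<^sup>+x. (\<Prod>i\<in>J. f i (x i)) \<partial>distr (PiM I M') (PiM J M') (\<lambda>x. restrict x J))"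
    using J f' by (intro nn_integral_distr[symmetric] measurable_restrict_subset borel_measurable_prod_ennreal)
      (auto intro: measurable_compose[OF measurable_component_singleton])
  also have "\<dots> = (\<Prod>i\<in>J. \<integral>\<^sup>+t. f i t \<partial>M' i)"
    unfolding distr_PiM_restrict_finite[OF J]
    using J(1) f' by (rule product_nn_integral_prod)
  also have "\<dots> = (\<Prod>i\<in>J. \<integral>\<^sup>+t. f i t \<partial>M i)"
    using J by (intro prod.cong) (auto simp: M'_def)
  finally show ?thesis .
qed

lemma indicator_box:
  assumes "J \<subseteq> I" "x \<in> space (PiM I (\<lambda>i. borel :: real measure))" "finite J"
  shows "indicator (prod_emb I (\<lambda>i. borel :: real measure) J (Pi\<^sub>E J A)) x = (\<Prod>i\<in>J. indicator (A i) (x i) :: ennreal)"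
proof (cases "\<forall>i\<in>J. x i \<in> A i")
  case True
  then show ?thesis using assms by (auto simp: prod_emb_def space_PiM indicator_def)
next
  case False
  then obtain i where i: "i \<in> J" "x i \<notin> A i" by blast
  then have "(\<Prod>i\<in>J. indicator (A i) (x i) :: ennreal) = 0"
    using assms(3) by (auto simp: indicator_def prod_zero_iff)
  moreover have "x \<notin> prod_emb I (\<lambda>i. borel :: real measure) J (Pi\<^sub>E J A)"
    using i by (auto simp: prod_emb_def)
  ultimately show ?thesis by simp
qed

lemma disintegration_PiM:
  fixes P m :: "'i \<Rightarrow> real measure" and Q K :: "'i \<Rightarrow> real \<Rightarrow> real measure"
  assumes P: "\<And>i. i \<in> I \<Longrightarrow> P i \<in> space (prob_algebra borel)"
    and m: "\<And>i. i \<in> I \<Longrightarrow> m i \<in> space (prob_algebra borel)"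
    and Q: "\<And>i. i \<in> I \<Longrightarrow> Q i \<in> borel \<rightarrow>\<^sub>M prob_algebra borel"
    and K: "\<And>i. i \<in> I \<Longrightarrow> K i \<in> borel \<rightarrow>\<^sub>M prob_algebra borel"
    and eq: "\<And>i A B. i \<in> I \<Longrightarrow> A \<in> sets borel \<Longrightarrow> B \<in> sets borel \<Longrightarrow>
      (\<integral>\<^sup>+t. indicator A t * emeasure (Q i t) B \<partial>P i) = (\<integral>\<^sup>+y. indicator B y * emeasure (K i y) A \<partial>m i)"
    and A: "A \<in> sets (PiM I (\<lambda>i. borel))" and B: "B \<in> sets (PiM I (\<lambda>i. borel))"
  shows "(\<integral>\<^sup>+\<theta>. indicator A \<theta> * emeasure (PiM I (\<lambda>i. Q i (\<theta> i))) B \<partial>PiM I P) =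
         (\<integral>\<^sup>+x. indicator B x * emeasure (PiM I (\<lambda>i. K i (x i))) A \<partial>PiM I m)"
proof -
  let ?S = "PiM I (\<lambda>i. borel :: real measure)"
  let ?Q = "\<lambda>\<theta>. PiM I (\<lambda>i. Q i (\<theta> i))" and ?K = "\<lambda>x. PiM I (\<lambda>i. K i (x i))"
  let ?box = "\<lambda>J A. prod_emb I (\<lambda>i. borel :: real measure) J (Pi\<^sub>E J A)"
  have P': "prob_space (P i)" "sets (P i) = sets borel" if "i \<in> I" for i
    using P[OF that] by (auto simp: space_prob_algebra)
  have m': "prob_space (m i)" "sets (m i) = sets borel" if "i \<in> I" for i
    using m[OF that] by (auto simp: space_prob_algebra)
  have Q': "prob_space (Q i t)" "sets (Q i t) = sets borel" if "i \<in> I" for i t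
    using measurable_space[OF Q[OF that], of t] by (auto simp: space_prob_algebra)
  have K': "prob_space (K i t)" "sets (K i t) = sets borel" if "i \<in> I" for i t
    using measurable_space[OF K[OF that], of t] by (auto simp: space_prob_algebra)
  have sP: "sets (PiM I P) = sets ?S" by (intro sets_PiM_cong refl P')
  have sm: "sets (PiM I m) = sets ?S" by (intro sets_PiM_cong refl m')
  have spP: "space (PiM I P) = space ?S" by (rule sets_eq_imp_space_eq[OF sP])
  have spm: "space (PiM I m) = space ?S" by (rule sets_eq_imp_space_eq[OF sm])
  have ne: "space ?S \<noteq> {}" by (auto simp: space_PiM PiE_eq_empty_iff)
  note pP = prob_space_PiM[of I P, OF P'(1)]
  note pm = prob_space_PiM[of I m, OF m'(1)]
  have kQ: "?Q \<in> ?S \<rightarrow>\<^sub>M subprob_algebra ?S" by (intro measurable_prob_algebraD kernel_PiM Q)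
  have kK: "?K \<in> ?S \<rightarrow>\<^sub>M subprob_algebra ?S" by (intro measurable_prob_algebraD kernel_PiM K)
  have mQ: "(\<lambda>\<theta>. emeasure (?Q \<theta>) B) \<in> borel_measurable ?S" if "B \<in> sets ?S" for B
    using measurable_emeasure_kernel[OF kQ that] .
  have mK: "(\<lambda>\<theta>. emeasure (?K \<theta>) B) \<in> borel_measurable ?S" if "B \<in> sets ?S" for B
    using measurable_emeasure_kernel[OF kK that] .
  have box[measurable]: "?box J A \<in> sets ?S" if "finite J" "J \<subseteq> I" "\<And>i. i \<in> J \<Longrightarrow> A i \<in> sets borel" for J A
    using that by (intro sets_PiM_I) auto
  have ext: "?box J A = ?box L (\<lambda>i. if i \<in> J then A i else UNIV)" if "J \<subseteq> L" "L \<subseteq> I" for J L A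
  proof -
    have "(\<forall>i\<in>J. x i \<in> A i) \<longleftrightarrow> (\<forall>i\<in>L. x i \<in> (if i \<in> J then A i else UNIV))" for x
      using that(1) by auto
    then show ?thesis by (auto simp: prod_emb_def PiE_iff)
  qed
  have step0: "(\<integral>\<^sup>+\<theta>. indicator (?box J A) \<theta> * emeasure (?Q \<theta>) (?box J B) \<partial>PiM I P) =
         (\<integral>\<^sup>+x. indicator (?box J B) x * emeasure (?K x) (?box J A) \<partial>PiM I m)"
    if J: "finite J" "J \<subseteq> I" and A: "\<And>i. i \<in> J \<Longrightarrow> A i \<in> sets borel"
      and B: "\<And>i. i \<in> J \<Longrightarrow> B i \<in> sets borel" for J A B
  proof -
    have JI: "i \<in> I" if "i \<in> J" for i using that J by auto
    have "(\<integral>\<^sup>+\<theta>. indicator (?box J A) \<theta> * emeasure (?Q \<theta>) (?box J B) \<partial>PiM I P) =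
      (\<integral>\<^sup>+\<theta>. (\<Prod>i\<in>J. indicator (A i) (\<theta> i) * emeasure (Q i (\<theta> i)) (B i)) \<partial>PiM I P)"
      using J A B by (intro nn_integral_cong)
        (simp add: spP indicator_box emeasure_PiM_box Q' prod.distrib)
    also have "\<dots> = (\<Prod>i\<in>J. \<integral>\<^sup>+t. indicator (A i) t * emeasure (Q i t) (B i) \<partial>P i)"
      using J A B JI by (intro nn_integral_PiM_prod P' borel_measurable_times_ennreal borel_measurable_indicator
          measurable_emeasure_kernel[OF measurable_prob_algebraD[OF Q]]) auto
    also have "\<dots> = (\<Prod>i\<in>J. \<integral>\<^sup>+y. indicator (B i) y * emeasure (K i y) (A i) \<partial>m i)"
      by (intro prod.cong refl eq JI A B)
    also have "\<dots> = (\<integral>\<^sup>+x. (\<Prod>i\<in>J. indicator (B i) (x i) * emeasure (K i (x i)) (A i)) \<partial>PiM I m)"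
      using J A B JI by (intro nn_integral_PiM_prod[symmetric] m' borel_measurable_times_ennreal borel_measurable_indicator
          measurable_emeasure_kernel[OF measurable_prob_algebraD[OF K]]) auto
    also have "\<dots> = (\<integral>\<^sup>+x. indicator (?box J B) x * emeasure (?K x) (?box J A) \<partial>PiM I m)"
      using J A B by (intro nn_integral_cong)
        (simp add: spm indicator_box emeasure_PiM_box K' prod.distrib)
    finally show ?thesis .
  qed
  have step1: "(\<integral>\<^sup>+\<theta>. indicator (?box J A) \<theta> * emeasure (?Q \<theta>) (?box L B) \<partial>PiM I P) =
         (\<integral>\<^sup>+x. indicator (?box L B) x * emeasure (?K x) (?box J A) \<partial>PiM I m)"
    if "finite J" "J \<subseteq> I" "\<And>i. i \<in> J \<Longrightarrow> A i \<in> sets borel"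
      "finite L" "L \<subseteq> I" "\<And>i. i \<in> L \<Longrightarrow> B i \<in> sets borel" for J L A B
    unfolding ext[of J "J \<union> L" A, OF Un_upper1 Un_least[OF that(2,5)]]
      ext[of L "J \<union> L" B, OF Un_upper2 Un_least[OF that(2,5)]]
    using that by (intro step0) auto
  have step2: "(\<integral>\<^sup>+\<theta>. indicator A \<theta> * emeasure (?Q \<theta>) (?box L B) \<partial>PiM I P) =
         (\<integral>\<^sup>+x. indicator (?box L B) x * emeasure (?K x) A \<partial>PiM I m)"
    if A: "A \<in> sets ?S" and L: "finite L" "L \<subseteq> I" "\<And>i. i \<in> L \<Longrightarrow> B i \<in> sets borel" for A L B
  proof -
    have fm: "(\<lambda>\<theta>. emeasure (?Q \<theta>) (?box L B)) \<in> borel_measurable (PiM I P)"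
      using mQ[OF box[of L B, OF L]] by (simp cong: measurable_cong_sets add: sP)
    have gm: "(indicator (?box L B) :: _ \<Rightarrow> ennreal) \<in> borel_measurable (PiM I m)"
      using box[of L B, OF L] sm by (intro borel_measurable_indicator) simp
    have kK': "?K \<in> density (PiM I m) (indicator (?box L B)) \<rightarrow>\<^sub>M subprob_algebra ?S"
      using kK by (simp cong: measurable_cong_sets add: sm)
    let ?l = "density (PiM I P) (\<lambda>\<theta>. emeasure (?Q \<theta>) (?box L B))"
    let ?r = "density (PiM I m) (indicator (?box L B)) \<bind> ?K"
    have l: "emeasure ?l A = (\<integral>\<^sup>+\<theta>. indicator A \<theta> * emeasure (?Q \<theta>) (?box L B) \<partial>PiM I P)"
      if "A \<in> sets ?S" for A
      using that fm by (simp add: emeasure_density sP mult.commute)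
    have r: "emeasure ?r A = (\<integral>\<^sup>+x. indicator (?box L B) x * emeasure (?K x) A \<partial>PiM I m)"
      if "A \<in> sets ?S" for A
    proof -
      have "emeasure ?r A = (\<integral>\<^sup>+x. emeasure (?K x) A \<partial>density (PiM I m) (indicator (?box L B)))"
        by (rule emeasure_bind[OF _ kK' that]) (simp add: spm ne)
      also have "\<dots> = (\<integral>\<^sup>+x. indicator (?box L B) x * emeasure (?K x) A \<partial>PiM I m)"
        using mK[OF that] gm by (intro nn_integral_density) (simp_all cong: measurable_cong_sets add: sm)
      finally show ?thesis .
    qed
    have "?l = ?r"
    proof (rule measure_eqI_PiM_infinite[of _ I "\<lambda>i. borel"])
      show "sets ?l = sets ?S" by (simp add: sP)
      show "sets ?r = sets ?S" by (rule sets_bind[of _ _ ?S]) (use kK' measurable_space[OF kK] in \<open>auto simp: space_subprob_algebra spm ne\<close>)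
      show "finite_measure ?l"
      proof
        have le1: "emeasure (?Q x) X \<le> 1" for x X
          by (intro prob_space.emeasure_le_1 prob_space_PiM Q')
        have "emeasure ?l (space ?l) = (\<integral>\<^sup>+x. indicator (space ?S) x * emeasure (?Q x) (?box L B) \<partial>PiM I P)"
          using l[OF sets.top] spP by simp
        also have "\<dots> \<le> (\<integral>\<^sup>+x. 1 \<partial>PiM I P)"
          by (intro nn_integral_mono) (auto simp: indicator_def le1)
        finally have "emeasure ?l (space ?l) \<le> (\<integral>\<^sup>+x. 1 \<partial>PiM I P)" .
        then show "emeasure ?l (space ?l) \<noteq> \<infinity>"
          using prob_space.emeasure_space_1[OF pP] by (auto simp: top_unique)
      qed
      show "emeasure ?l (?box J E) = emeasure ?r (?box J E)"
        if "finite J" "J \<subseteq> I" "\<And>i. i \<in> J \<Longrightarrow> E i \<in> sets borel" for E J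
        by (simp only: l[OF box[of J E, OF that]] r[OF box[of J E, OF that]] step1[OF that L])
    qed
    then show ?thesis using l[OF A] r[OF A] by simp
  qed
  have fm: "(\<lambda>x. emeasure (?K x) A) \<in> borel_measurable (PiM I m)"
    using mK[OF A] by (simp cong: measurable_cong_sets add: sm)
  have gm: "(indicator A :: _ \<Rightarrow> ennreal) \<in> borel_measurable (PiM I P)"
    using A sP by (intro borel_measurable_indicator) simp
  have kQ': "?Q \<in> density (PiM I P) (indicator A) \<rightarrow>\<^sub>M subprob_algebra ?S"
    using kQ by (simp cong: measurable_cong_sets add: sP)
  let ?l = "density (PiM I m) (\<lambda>x. emeasure (?K x) A)"
  let ?r = "density (PiM I P) (indicator A) \<bind> ?Q"
  have l: "emeasure ?l B = (\<integral>\<^sup>+x. indicator B x * emeasure (?K x) A \<partial>PiM I m)"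
    if "B \<in> sets ?S" for B
    using that fm by (simp add: emeasure_density sm mult.commute)
  have r: "emeasure ?r B = (\<integral>\<^sup>+\<theta>. indicator A \<theta> * emeasure (?Q \<theta>) B \<partial>PiM I P)"
    if "B \<in> sets ?S" for B
  proof -
    have "emeasure ?r B = (\<integral>\<^sup>+x. emeasure (?Q x) B \<partial>density (PiM I P) (indicator A))"
      by (rule emeasure_bind[OF _ kQ' that]) (simp add: spP ne)
    also have "\<dots> = (\<integral>\<^sup>+x. indicator A x * emeasure (?Q x) B \<partial>PiM I P)"
      using mQ[OF that] gm by (intro nn_integral_density) (simp_all cong: measurable_cong_sets add: sP)
    finally show ?thesis .
  qed
  have "?l = ?r"
  proof (rule measure_eqI_PiM_infinite[of _ I "\<lambda>i. borel"])
    show "sets ?l = sets ?S" by (simp add: sm)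
    show "sets ?r = sets ?S" by (rule sets_bind[of _ _ ?S]) (use kQ' measurable_space[OF kQ] in \<open>auto simp: space_subprob_algebra spP ne\<close>)
    show "finite_measure ?l"
    proof
      have le1: "emeasure (?K x) X \<le> 1" for x X
        by (intro prob_space.emeasure_le_1 prob_space_PiM K')
      have "emeasure ?l (space ?l) = (\<integral>\<^sup>+x. indicator (space ?S) x * emeasure (?K x) A \<partial>PiM I m)"
        using l[OF sets.top] spm by simp
      also have "\<dots> \<le> (\<integral>\<^sup>+x. 1 \<partial>PiM I m)"
        by (intro nn_integral_mono) (auto simp: indicator_def le1)
      finally have "emeasure ?l (space ?l) \<le> (\<integral>\<^sup>+x. 1 \<partial>PiM I m)" .
      then show "emeasure ?l (space ?l) \<noteq> \<infinity>"
        using prob_space.emeasure_space_1[OF pm] by (auto simp: top_unique)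
    qed
    show "emeasure ?l (?box J E) = emeasure ?r (?box J E)"
      if "finite J" "J \<subseteq> I" "\<And>i. i \<in> J \<Longrightarrow> E i \<in> sets borel" for E J
      by (simp only: l[OF box[of J E, OF that]] r[OF box[of J E, OF that]] step2[OF A that])
  qed
  then show ?thesis using l[OF B] r[OF B] by simp
qed

lemma posterior_coordinate:
  fixes p :: "real \<Rightarrow> real"
  assumes n: "0 < n"
    and p: "p \<in> borel_measurable borel" "\<And>t. 0 \<le> p t" "(\<integral>\<^sup>+t. ennreal (p t) \<partial>lborel) = 1"
  defines "P \<equiv> density lborel (\<lambda>t. ennreal (p t))"
    and "Q \<equiv> \<lambda>t. density lborel (\<lambda>y. ennreal (normal_density t (1 / sqrt (real n)) y))"
    and "K \<equiv> \<lambda>y. density lborel (\<lambda>t. ennreal (posterior_density n p y t))"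
  shows "P \<in> space (prob_algebra borel)" "Q \<in> borel \<rightarrow>\<^sub>M prob_algebra borel"
    "K \<in> borel \<rightarrow>\<^sub>M prob_algebra borel"
    "\<exists>m\<in>space (prob_algebra borel). \<forall>A\<in>sets borel. \<forall>B\<in>sets borel.
      (\<integral>\<^sup>+t. indicator A t * emeasure (Q t) B \<partial>P) = (\<integral>\<^sup>+y. indicator B y * emeasure (K y) A \<partial>m)"
proof -
  note [measurable] = p(1)
  define e where "e y t = exp (- real n * (y - t)\<^sup>2 / 2)" for y t
  define Z where "Z y = (\<integral>s. e y s * p s \<partial>lborel)" for y
  define c where "c = 1 / sqrt (2 * pi * (1 / sqrt (real n))\<^sup>2)"
  have e_meas[measurable]: "(\<lambda>(y, t). e y t) \<in> borel_measurable (borel \<Otimes>\<^sub>M borel)"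
    unfolding e_def by measurable
  have e: "0 < e y t" "e y t \<le> 1" for y t by (auto simp: e_def)
  have c: "0 < c" using n by (simp add: c_def)
  have nd: "normal_density t (1 / sqrt (real n)) y = c * e y t" for t y
    using n by (simp add: normal_density_def c_def e_def power_divide field_simps)
  have pd: "posterior_density n p y t = e y t * p t / Z y" for y t
    by (simp add: posterior_density_def e_def Z_def)
  have ip: "integrable lborel p"
    using p by (intro integrableI_nonneg) auto
  have ie: "integrable lborel (\<lambda>s. e y s * p s)" for y
    by (rule Bochner_Integration.integrable_bound[OF ip])
      (use e p(2) in \<open>auto simp: abs_mult mult_left_le_one_le less_imp_le\<close>)
  have Znn: "ennreal (Z y) = (\<integral>\<^sup>+s. ennreal (e y s * p s) \<partial>lborel)" for y
    unfolding Z_def using ie e p(2) by (intro nn_integral_eq_integral[symmetric]) (auto simp: less_imp_le)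
  have Z: "0 < Z y" for y
  proof -
    have "0 \<le> Z y" unfolding Z_def using e p(2) by (intro integral_nonneg_AE) (auto simp: less_imp_le)
    moreover have "Z y \<noteq> 0"
    proof
      assume "Z y = 0"
      then have "AE s in lborel. ennreal (e y s * p s) = 0"
        using Znn[of y] by (subst (asm) eq_commute) (simp add: nn_integral_0_iff_AE)
      then have "AE s in lborel. ennreal (p s) = 0"
        by eventually_elim (use e p(2) in \<open>auto simp: ennreal_eq_0_iff mult_le_0_iff not_le[symmetric]\<close>)
      then have "(\<integral>\<^sup>+s. ennreal (p s) \<partial>lborel) = 0" by (simp add: nn_integral_0_iff_AE)
      then show False using p(3) by simp
    qed
    ultimately show ?thesis by simp
  qed
  have Z_meas[measurable]: "Z \<in> borel_measurable borel"
    unfolding Z_def by measurable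
  have pKnn: "(\<integral>\<^sup>+t. ennreal (posterior_density n p y t) \<partial>lborel) = 1" for y
  proof -
    have "(\<integral>\<^sup>+t. ennreal (posterior_density n p y t) \<partial>lborel) = (\<integral>\<^sup>+t. ennreal (1 / Z y) * ennreal (e y t * p t) \<partial>lborel)"
      using Z[of y] e p(2) by (intro nn_integral_cong) (simp add: pd ennreal_mult'[symmetric])
    also have "\<dots> = ennreal (1 / Z y) * ennreal (Z y)"
      by (subst nn_integral_cmult) (auto simp: Znn)
    also have "\<dots> = 1" using Z[of y] by (simp add: ennreal_mult'[symmetric])
    finally show ?thesis .
  qed
  have kernel: "(\<lambda>y. density lborel (\<lambda>t. ennreal (f y t))) \<in> borel \<rightarrow>\<^sub>M prob_algebra borel"
    if [measurable]: "(\<lambda>(y, t). f y t) \<in> borel_measurable (borel \<Otimes>\<^sub>M borel)"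
      and 1: "\<And>y. (\<integral>\<^sup>+t. ennreal (f y t) \<partial>lborel) = 1" for f :: "real \<Rightarrow> real \<Rightarrow> real"
  proof (rule measurable_prob_algebra_generated[OF sets.sigma_sets_eq[symmetric] sets.Int_stable sets.space_closed])
    show "prob_space (density lborel (\<lambda>t. ennreal (f y t)))" for y
      by (rule prob_spaceI) (simp add: emeasure_density 1)
    fix A :: "real set" assume [measurable]: "A \<in> sets borel"
    have "(\<lambda>y. \<integral>\<^sup>+t. ennreal (f y t) * indicator A t \<partial>lborel) \<in> borel_measurable borel"
      by measurable
    then show "(\<lambda>y. emeasure (density lborel (\<lambda>t. ennreal (f y t))) A) \<in> borel_measurable borel"
      by (simp add: emeasure_density)
  qed simp
  show P: "P \<in> space (prob_algebra borel)"
    using p by (auto simp: P_def space_prob_algebra emeasure_density intro!: prob_spaceI)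
  have Qnn: "(\<integral>\<^sup>+y. ennreal (normal_density t (1 / sqrt (real n)) y) \<partial>lborel) = 1" for t
    using prob_space.emeasure_space_1[OF prob_space_normal_density[of "1 / sqrt (real n)" t]] n
    by (simp add: emeasure_density)
  have nd_meas: "(\<lambda>(t, y). normal_density t (1 / sqrt (real n)) y) \<in> borel_measurable (borel \<Otimes>\<^sub>M borel)"
    unfolding nd by measurable
  have pd_meas: "(\<lambda>(y, t). posterior_density n p y t) \<in> borel_measurable (borel \<Otimes>\<^sub>M borel)"
    unfolding pd by measurable
  show "Q \<in> borel \<rightarrow>\<^sub>M prob_algebra borel" unfolding Q_def by (rule kernel[OF nd_meas Qnn])
  show "K \<in> borel \<rightarrow>\<^sub>M prob_algebra borel" unfolding K_def by (rule kernel[OF pd_meas pKnn])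
  define m where "m = density lborel (\<lambda>y. ennreal (c * Z y))"
  have eq: "(\<integral>\<^sup>+t. indicator A t * emeasure (Q t) B \<partial>P) = (\<integral>\<^sup>+y. indicator B y * emeasure (K y) A \<partial>m)"
    if [measurable]: "A \<in> sets borel" "B \<in> sets borel" for A B
  proof -
    have "(\<integral>\<^sup>+t. indicator A t * emeasure (Q t) B \<partial>P)
       = (\<integral>\<^sup>+t. ennreal (p t) * (indicator A t * (\<integral>\<^sup>+y. ennreal (c * e y t) * indicator B y \<partial>lborel)) \<partial>lborel)"
      unfolding P_def Q_def nd by (subst nn_integral_density) (auto simp: emeasure_density)
    also have "\<dots> = (\<integral>\<^sup>+t. (\<integral>\<^sup>+y. ennreal (p t) * (indicator A t * (ennreal (c * e y t) * indicator B y)) \<partial>lborel) \<partial>lborel)"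
      by (simp add: nn_integral_cmult)
    also have "\<dots> = (\<integral>\<^sup>+y. (\<integral>\<^sup>+t. ennreal (p t) * (indicator A t * (ennreal (c * e y t) * indicator B y)) \<partial>lborel) \<partial>lborel)"
      by (rule lborel_pair.Fubini') measurable
    also have "\<dots> = (\<integral>\<^sup>+y. (\<integral>\<^sup>+t. ennreal (c * Z y) * indicator B y * (ennreal (posterior_density n p y t) * indicator A t) \<partial>lborel) \<partial>lborel)"
    proof (intro nn_integral_cong)
      fix y t
      have "ennreal (p t) * ennreal (c * e y t) = ennreal (c * Z y) * ennreal (posterior_density n p y t)"
        using Z[of y] c e[of y t] p(2)[of t]
        by (simp add: pd ennreal_mult'[symmetric] less_imp_le mult.commute mult.left_commute)
      then show "ennreal (p t) * (indicator A t * (ennreal (c * e y t) * indicator B y)) =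
          ennreal (c * Z y) * indicator B y * (ennreal (posterior_density n p y t) * indicator A t)"
        by (metis mult.assoc mult.commute)
    qed
    also have "\<dots> = (\<integral>\<^sup>+y. ennreal (c * Z y) * indicator B y * emeasure (K y) A \<partial>lborel)"
      unfolding K_def pd by (simp add: nn_integral_cmult emeasure_density)
    also have "\<dots> = (\<integral>\<^sup>+y. indicator B y * emeasure (K y) A \<partial>m)"
    proof -
      have "(\<lambda>y. emeasure (K y) A) \<in> borel_measurable borel"
        using measurable_emeasure_kernel[OF measurable_prob_algebraD[OF kernel[OF pd_meas pKnn]] that(1)]
        by (simp add: K_def)
      then show ?thesis unfolding m_def by (subst nn_integral_density) (auto simp: mult.assoc)
    qed
    finally show ?thesis .
  qed
  have "emeasure m UNIV = 1"
  proof -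
    have "emeasure (Q t) UNIV = 1" for t by (simp add: Q_def emeasure_density Qnn)
    moreover have "emeasure (K t) UNIV = 1" for t
      using pKnn[of t] by (simp add: K_def pd emeasure_density)
    moreover have "emeasure P UNIV = 1" using p by (simp add: P_def emeasure_density)
    ultimately show ?thesis using eq[of UNIV UNIV] by (simp add: P_def m_def)
  qed
  then have "m \<in> space (prob_algebra borel)"
    by (auto simp: space_prob_algebra m_def intro!: prob_spaceI)
  with eq show "\<exists>m\<in>space (prob_algebra borel). \<forall>A\<in>sets borel. \<forall>B\<in>sets borel.
      (\<integral>\<^sup>+t. indicator A t * emeasure (Q t) B \<partial>P) = (\<integral>\<^sup>+y. indicator B y * emeasure (K y) A \<partial>m)"
    by blast
qed

text \<open>
  If \<open>\<theta>\<close> is distributed as the prior \<open>Pr\<close> and the observations have law \<open>Q \<theta>\<close> given \<open>\<theta>\<close>,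
  then the kernel \<open>K\<close> in the definition of \<open>posterior\<close> is a regular conditional law of \<open>\<theta>\<close>
  given the observations.
\<close>

lemma posterior_is_conditional_law:
  fixes p :: "'i \<Rightarrow> real \<Rightarrow> real"
  assumes n: "0 < n"
    and p: "\<And>i. i \<in> I \<Longrightarrow> p i \<in> borel_measurable borel" "\<And>i t. i \<in> I \<Longrightarrow> 0 \<le> p i t"
      "\<And>i. i \<in> I \<Longrightarrow> (\<integral>\<^sup>+t. ennreal (p i t) \<partial>lborel) = 1"
  defines "Pr \<equiv> PiM I (\<lambda>i. density lborel (\<lambda>t. ennreal (p i t)))"
    and "Q \<equiv> \<lambda>\<theta>. PiM I (\<lambda>i. density lborel (\<lambda>y. ennreal (normal_density (\<theta> i) (1 / sqrt (real n)) y)))"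
    and "K \<equiv> \<lambda>x. PiM I (\<lambda>i. density lborel (\<lambda>t. ennreal (posterior_density n (p i) (x i) t)))"
    and "E \<equiv> PiM I (\<lambda>i. borel :: real measure)"
  shows "K \<in> E \<rightarrow>\<^sub>M prob_algebra E"
    "A \<in> sets E \<Longrightarrow> B \<in> sets E \<Longrightarrow>
      (\<integral>\<^sup>+\<theta>. indicator A \<theta> * emeasure (Q \<theta>) B \<partial>Pr) =
      (\<integral>\<^sup>+x. indicator B x * emeasure (K x) A \<partial>(Pr \<bind> Q))"
proof -
  note coord = posterior_coordinate[OF n p]
  let ?Q = "\<lambda>(i::'i) t. density lborel (\<lambda>y. ennreal (normal_density t (1 / sqrt (real n)) y))"
  let ?K = "\<lambda>i y. density lborel (\<lambda>t. ennreal (posterior_density n (p i) y t))"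
  have "\<forall>i\<in>I. \<exists>m. m \<in> space (prob_algebra borel) \<and> (\<forall>A\<in>sets borel. \<forall>B\<in>sets borel.
      (\<integral>\<^sup>+t. indicator A t * emeasure (?Q i t) B \<partial>density lborel (\<lambda>t. ennreal (p i t))) =
      (\<integral>\<^sup>+y. indicator B y * emeasure (?K i y) A \<partial>m))"
    using coord(4) unfolding Bex_def by (intro ballI)
  from bchoice[OF this] obtain m where
    "\<forall>i\<in>I. m i \<in> space (prob_algebra borel) \<and> (\<forall>A\<in>sets borel. \<forall>B\<in>sets borel.
      (\<integral>\<^sup>+t. indicator A t * emeasure (?Q i t) B \<partial>density lborel (\<lambda>t. ennreal (p i t))) =
      (\<integral>\<^sup>+y. indicator B y * emeasure (?K i y) A \<partial>m i))" ..
  then have m: "\<And>i. i \<in> I \<Longrightarrow> m i \<in> space (prob_algebra borel)"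
    and eq: "\<And>i A B. i \<in> I \<Longrightarrow> A \<in> sets borel \<Longrightarrow> B \<in> sets borel \<Longrightarrow>
      (\<integral>\<^sup>+t. indicator A t * emeasure (?Q i t) B \<partial>density lborel (\<lambda>t. ennreal (p i t))) =
      (\<integral>\<^sup>+y. indicator B y * emeasure (?K i y) A \<partial>m i)"
    by blast+
  have dis: "(\<integral>\<^sup>+\<theta>. indicator A \<theta> * emeasure (Q \<theta>) B \<partial>Pr) =
      (\<integral>\<^sup>+x. indicator B x * emeasure (K x) A \<partial>PiM I m)" if "A \<in> sets E" "B \<in> sets E" for A B
    unfolding Pr_def Q_def K_def
    by (rule disintegration_PiM[where Q = ?Q and K = ?K])
      (use that m eq coord in \<open>auto simp: E_def\<close>)
  show K: "K \<in> E \<rightarrow>\<^sub>M prob_algebra E"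
    unfolding K_def E_def by (rule kernel_PiM[where K = ?K]) (use coord in auto)
  have Q: "Q \<in> E \<rightarrow>\<^sub>M prob_algebra E"
    unfolding Q_def E_def by (rule kernel_PiM[where K = ?Q]) (use coord in auto)
  have sPr: "sets Pr = sets E" unfolding Pr_def E_def by (intro sets_PiM_cong) auto
  have sm: "sets (PiM I m) = sets E"
    unfolding E_def using m by (intro sets_PiM_cong) (auto simp: space_prob_algebra)
  have Pr: "Pr \<in> space (prob_algebra E)"
    using coord(1) sPr by (auto simp: Pr_def space_prob_algebra intro!: prob_space_PiM)
  have "Pr \<bind> Q = PiM I m"
  proof (rule measure_eqI)
    show "sets (Pr \<bind> Q) = sets (PiM I m)" unfolding sets_bind'[OF Pr Q] sm ..
    fix B assume "B \<in> sets (Pr \<bind> Q)"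
    then have B: "B \<in> sets E" by (simp add: sets_bind'[OF Pr Q])
    have KE: "emeasure (K x) (space E) = 1" if "x \<in> space E" for x
      using measurable_space[OF K that] prob_space.emeasure_space_1[of "K x"] sets_eq_imp_space_eq[of "K x" E]
      by (auto simp: space_prob_algebra)
    have "emeasure (Pr \<bind> Q) B = (\<integral>\<^sup>+\<theta>. emeasure (Q \<theta>) B \<partial>Pr)"
      by (rule emeasure_bind_prob_algebra[OF Pr Q B])
    also have "\<dots> = (\<integral>\<^sup>+\<theta>. indicator (space E) \<theta> * emeasure (Q \<theta>) B \<partial>Pr)"
      using sets_eq_imp_space_eq[OF sPr] by (intro nn_integral_cong) simp
    also have "\<dots> = (\<integral>\<^sup>+x. indicator B x * emeasure (K x) (space E) \<partial>PiM I m)"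
      by (rule dis[OF sets.top B])
    also have "\<dots> = (\<integral>\<^sup>+x. indicator B x \<partial>PiM I m)"
      using sets_eq_imp_space_eq[OF sm] KE by (intro nn_integral_cong) simp
    also have "\<dots> = emeasure (PiM I m) B" using B sm by simp
    finally show "emeasure (Pr \<bind> Q) B = emeasure (PiM I m) B" .
  qed
  then show "A \<in> sets E \<Longrightarrow> B \<in> sets E \<Longrightarrow>
      (\<integral>\<^sup>+\<theta>. indicator A \<theta> * emeasure (Q \<theta>) B \<partial>Pr) =
      (\<integral>\<^sup>+x. indicator B x * emeasure (K x) A \<partial>(Pr \<bind> Q))"
    using dis by simp
qed

end

theory Submission
  imports Defs
begin

text \<open>
  Both laws are products, and the rescaled posterior of one coordinate has density proportional to
  \<open>h \<mapsto> g h * P (\<epsilon> + h)\<close>, where \<open>g\<close> is the standard normal density, \<open>P\<close> is the prior density seen at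
  scale \<open>1 / sqrt n\<close> around the truth, and \<open>\<epsilon> = sqrt n * (X i - \<theta> i)\<close> is standard normal.  For a fixed
  coordinate, continuity of the prior at the truth and Scheffe's lemma give convergence to the normal
  law in expected total variation.  The expected second moments are bounded uniformly in \<open>n\<close>
  and in the coordinate, so that by summability of the weights the coordinates outside a large finite
  set are negligible in the norm of \<open>H(\<delta>)\<close>, for the posterior as for the white noise.  Markov's
  inequality turns the resulting bound on the expected distance into convergence in probability.
\<close>

subsection \<open>The rescaled posterior of one coordinate\<close>

text \<open>In \<open>tilt\<close> the variable \<open>h\<close> stands for
  \<open>sqrt n * (f i - X i)\<close>, so that \<open>e + h\<close> is the distance of
  \<open>f i\<close> from the truth in units of \<open>1 / sqrt n\<close>. Total variation can serve
  finitely many coordinates only: if there are infinitely many, then for every \<open>n\<close> some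
  have a prior scale far below \<open>1 / sqrt n\<close>, and there the posterior stays close to the
  prior. What survives there is a second moment bound, and it must be uniform in the ratio of the
  prior scale to \<open>1 / sqrt n\<close>, which can be any positive number. The obstacle is the
  normalizer in \<open>tilt\<close>, which may be tiny when the noise \<open>e\<close> is large.
  Averaging over the noise repairs this: the noise has density \<open>std_normal_density e\<close>,
  and the normalizer is at least a multiple of this very factor, so that the two cancel. The margin
  \<open>\<tau> - M\<close> supplies the interval around the truth on which the prior density is
  bounded below, as this estimate requires. The bounds live in \<open>ennreal\<close>, so that
  observations with an infinite bound need no null set argument.\<close>

definition tilt :: "(real \<Rightarrow> real) \<Rightarrow> real \<Rightarrow> real \<Rightarrow> real" where
  "tilt P e h = std_normal_density h * P (e + h) / (\<integral>k. std_normal_density k * P (e + k) \<partial>lborel)"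

lemma measurable_tilt [measurable]:
  assumes [measurable]: "P \<in> borel_measurable borel"
  shows "(\<lambda>(e, h). tilt P e h) \<in> borel_measurable (borel \<Otimes>\<^sub>M borel)"
  unfolding tilt_def by measurable

lemma tilt_nonneg: "(\<And>t. 0 \<le> P t) \<Longrightarrow> 0 \<le> tilt P e h"
  unfolding tilt_def by (intro divide_nonneg_nonneg mult_nonneg_nonneg integral_nonneg_AE) auto

lemma nn_integral_shift:
  fixes f :: "real \<Rightarrow> ennreal"
  assumes [measurable]: "f \<in> borel_measurable borel"
  shows "(\<integral>\<^sup>+x. f (t + x) \<partial>lborel) = (\<integral>\<^sup>+x. f x \<partial>lborel)"
  using nn_integral_real_affine[of f 1 t] by simp

lemma nn_integral_std_normal: "(\<integral>\<^sup>+x. ennreal (std_normal_density x) \<partial>lborel) = 1"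
  using prob_space.emeasure_space_1[OF prob_space_normal_density[of 1 0]] by (simp add: emeasure_density)

lemma nn_integral_std_normal_power2: "(\<integral>\<^sup>+x. ennreal (x\<^sup>2 * std_normal_density x) \<partial>lborel) = 1"
proof -
  have "has_bochner_integral lborel (\<lambda>x. std_normal_density x * x\<^sup>2) 1"
    using std_normal_moment_even[of 1] by simp
  then show ?thesis
    by (subst nn_integral_eq_integral) (auto simp: has_bochner_integral_iff mult.commute)
qed

lemma std_normal_density_le_1: "std_normal_density x \<le> 1"
proof -
  have "std_normal_density x \<le> 1 / sqrt (2 * pi) * 1"
    unfolding std_normal_density_def by (intro mult_left_mono) auto
  also have "\<dots> \<le> 1" using pi_ge_two by simp
  finally show ?thesis .
qed

context
  fixes P :: "real \<Rightarrow> real"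
  assumes P [measurable]: "P \<in> borel_measurable borel" and nonneg: "\<And>t. 0 \<le> P t"
    and prob: "(\<integral>\<^sup>+t. ennreal (P t) \<partial>lborel) = 1"
begin

lemma integrable_std_normal_times: "integrable lborel (\<lambda>k. std_normal_density k * P (e + k))"
proof (rule Bochner_Integration.integrable_bound)
  have "integrable lborel P" using prob nonneg by (intro integrableI_nonneg) auto
  then show "integrable lborel (\<lambda>k. P (e + k))" using lborel_integrable_real_affine[of P 1 e] by simp
  show "AE k in lborel. norm (std_normal_density k * P (e + k)) \<le> norm (P (e + k))"
    using nonneg by (auto simp: abs_mult mult_left_le_one_le std_normal_density_le_1)
qed simp

lemma tilt_normalizer:
  "ennreal (\<integral>k. std_normal_density k * P (e + k) \<partial>lborel)
    = (\<integral>\<^sup>+k. ennreal (std_normal_density k * P (e + k)) \<partial>lborel)"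
  using integrable_std_normal_times nonneg by (intro nn_integral_eq_integral[symmetric]) auto

text \<open>The Gaussian density vanishes nowhere, so a zero integral would force \<open>P\<close>
  to vanish almost everywhere, against its total mass 1. This makes the division in
  \<open>tilt\<close> a genuine one.\<close>

lemma tilt_normalizer_pos: "0 < (\<integral>k. std_normal_density k * P (e + k) \<partial>lborel)"
proof -
  have "(\<integral>\<^sup>+k. ennreal (std_normal_density k * P (e + k)) \<partial>lborel) \<noteq> 0"
  proof
    assume "(\<integral>\<^sup>+k. ennreal (std_normal_density k * P (e + k)) \<partial>lborel) = 0"
    then have "AE k in lborel. ennreal (std_normal_density k * P (e + k)) = 0"
      by (simp add: nn_integral_0_iff_AE)
    then have "AE k in lborel. ennreal (P (e + k)) = 0"
    proof eventually_elim
      case (elim k)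
      then show ?case
        using nonneg[of "e + k"] normal_density_pos[of 1 0 k] by (simp add: ennreal_eq_0_iff mult_le_0_iff)
    qed
    then have "(\<integral>\<^sup>+k. ennreal (P (e + k)) \<partial>lborel) = 0" by (simp add: nn_integral_0_iff_AE)
    then show False using prob nn_integral_shift[of "\<lambda>t. ennreal (P t)" e] by simp
  qed
  then show ?thesis using tilt_normalizer[of e] by (metis ennreal_neg not_less)
qed

lemma nn_integral_tilt: "(\<integral>\<^sup>+h. ennreal (tilt P e h) \<partial>lborel) = 1"
proof -
  let ?Z = "\<integral>k. std_normal_density k * P (e + k) \<partial>lborel"
  have "(\<integral>\<^sup>+h. ennreal (tilt P e h) \<partial>lborel)
      = (\<integral>\<^sup>+h. ennreal (1 / ?Z) * ennreal (std_normal_density h * P (e + h)) \<partial>lborel)"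
    using tilt_normalizer_pos[of e] nonneg
    by (intro nn_integral_cong) (simp add: tilt_def ennreal_mult'[symmetric])
  also have "\<dots> = ennreal (1 / ?Z) * ennreal ?Z"
    by (subst nn_integral_cmult) (simp_all add: tilt_normalizer)
  also have "\<dots> = 1" using tilt_normalizer_pos[of e] by (simp add: ennreal_mult'[symmetric])
  finally show ?thesis .
qed

text \<open>Integrating over half of the interval \<open>(-r, r)\<close>, on the side where \<open>e v \<ge> 0\<close>, leaves a factor
  that grows exponentially in \<open>\<bar>e\<bar>\<close>.\<close>

lemma tilt_normalizer_lower:
  assumes r: "0 < r" and kappa: "0 < \<kappa>" "\<And>v. \<bar>v\<bar> < r \<Longrightarrow> \<kappa> \<le> P v"
  shows "\<kappa> * (r / 2) * exp (- r\<^sup>2 / 2) * exp (r * \<bar>e\<bar> / 2) * std_normal_density e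
    \<le> (\<integral>k. std_normal_density k * P (e + k) \<partial>lborel)"
proof -
  \<comment> \<open>In the variable \<open>v = e + k\<close> this is \<open>(r / 2, r)\<close> or
    \<open>(- r, - r / 2)\<close>. The sign of \<open>v\<close> agrees with that of
    \<open>e\<close>, whence \<open>e * v \<ge> r * |e| / 2\<close>.\<close>
  define S where "S = (if 0 \<le> e then {r / 2 - e <..< r - e} else {- r - e <..< - r / 2 - e})"
  define b where "b = \<kappa> * exp (- r\<^sup>2 / 2) * exp (r * \<bar>e\<bar> / 2) * std_normal_density e"
  have b: "0 \<le> b" using kappa by (simp add: b_def)
  have low: "b \<le> std_normal_density k * P (e + k)" if "k \<in> S" for k
  proof -
    define v where "v = e + k"
    have v: "\<bar>v\<bar> < r" "r * \<bar>e\<bar> / 2 \<le> e * v"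
    proof -
      show "\<bar>v\<bar> < r" using that r by (auto simp: S_def v_def split: if_splits)
      show "r * \<bar>e\<bar> / 2 \<le> e * v"
      proof (cases "0 \<le> e")
        case True
        then have "e * (r / 2) \<le> e * v" using that by (intro mult_left_mono) (auto simp: S_def v_def)
        then show ?thesis using True by (simp add: mult.commute)
      next
        case False
        then have "(- e) * (r / 2) \<le> (- e) * (- v)"
          using that by (intro mult_left_mono) (auto simp: S_def v_def)
        then show ?thesis using False by (simp add: mult.commute)
      qed
    qed
    have "v\<^sup>2 \<le> r\<^sup>2" using v(1) r by (intro power2_le_iff_abs_le[THEN iffD2]) auto
    \<comment> \<open>Expanding the square factors the Gaussian at \<open>k = v - e\<close> into
      \<open>exp (- v^2 / 2)\<close>, \<open>exp (e * v)\<close> and \<open>exp (- e^2 / 2)\<close>.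
      The first two are bounded below on \<open>S\<close>, the third becomes
      \<open>std_normal_density e\<close>.\<close>
    moreover have "k\<^sup>2 = v\<^sup>2 - 2 * (e * v) + e\<^sup>2" by (simp add: v_def power2_eq_square algebra_simps)
    ultimately have "- r\<^sup>2 / 2 + r * \<bar>e\<bar> / 2 + - e\<^sup>2 / 2 \<le> - k\<^sup>2 / 2" using v(2) by (simp add: field_simps)
    then have "exp (- r\<^sup>2 / 2) * exp (r * \<bar>e\<bar> / 2) * exp (- e\<^sup>2 / 2) \<le> exp (- k\<^sup>2 / 2)"
      unfolding exp_add[symmetric] by simp
    then have "exp (- r\<^sup>2 / 2) * exp (r * \<bar>e\<bar> / 2) * std_normal_density e \<le> std_normal_density k"
      unfolding std_normal_density_def by (simp add: divide_right_mono)
    then have "(exp (- r\<^sup>2 / 2) * exp (r * \<bar>e\<bar> / 2) * std_normal_density e) * \<kappa> \<le> std_normal_density k * P v"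
      using kappa v(1) by (intro mult_mono) auto
    then show ?thesis by (simp add: b_def v_def algebra_simps)
  qed
  have "ennreal (b * (r / 2)) = (\<integral>\<^sup>+k. ennreal b * indicator S k \<partial>lborel)"
    using r b by (subst nn_integral_cmult_indicator) (auto simp: S_def ennreal_mult'[symmetric])
  also have "\<dots> \<le> (\<integral>\<^sup>+k. ennreal (std_normal_density k * P (e + k)) \<partial>lborel)"
    using low by (intro nn_integral_mono) (auto simp: indicator_def ennreal_leI)
  also have "\<dots> = ennreal (\<integral>k. std_normal_density k * P (e + k) \<partial>lborel)"
    by (rule tilt_normalizer[symmetric])
  finally have "b * (r / 2) \<le> (\<integral>k. std_normal_density k * P (e + k) \<partial>lborel)"
    using tilt_normalizer_pos[of e] by (simp add: ennreal_le_iff)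
  then show ?thesis by (simp add: b_def algebra_simps)
qed

text \<open>The factor \<open>std_normal_density e\<close> in the lower bound for the normalizer
  cancels the density of the noise. What remains has no normalizer, so it can be integrated over
  \<open>e\<close> and \<open>h\<close> in either order.\<close>

lemma std_normal_times_tilt_le:
  assumes r: "0 < r" and kappa: "0 < \<kappa>" "\<And>v. \<bar>v\<bar> < r \<Longrightarrow> \<kappa> \<le> P v"
  shows "std_normal_density e * tilt P e h
    \<le> 2 / (\<kappa> * r) * exp (r\<^sup>2 / 2) * exp (- (r * \<bar>e\<bar> / 2)) * (std_normal_density h * P (e + h))"
proof -
  let ?N = "std_normal_density h * P (e + h)"
  let ?d = "\<kappa> * (r / 2) * exp (- r\<^sup>2 / 2) * exp (r * \<bar>e\<bar> / 2) * std_normal_density e"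
  have ge: "0 < std_normal_density e" by (rule normal_density_pos) simp
  have d: "0 < ?d" using ge r kappa by (intro mult_pos_pos) auto
  have "tilt P e h \<le> ?N / ?d"
    unfolding tilt_def using tilt_normalizer_lower[OF assms, of e] nonneg
    by (intro divide_left_mono mult_pos_pos[OF tilt_normalizer_pos d] mult_nonneg_nonneg) auto
  then have "std_normal_density e * tilt P e h \<le> std_normal_density e * (?N / ?d)"
    using ge by (intro mult_left_mono) auto
  also have "\<dots> = 2 / (\<kappa> * r) * exp (r\<^sup>2 / 2) * exp (- (r * \<bar>e\<bar> / 2)) * ?N"
    using ge r kappa by (simp add: exp_minus field_simps)
  finally show ?thesis .
qed

end

section \<open>Expected second moment of a tilted Gaussian\<close>

lemma nn_integral_exp_abs:
  assumes "0 < (a::real)"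
  shows "(\<integral>\<^sup>+x. ennreal (exp (- (a * \<bar>x\<bar>))) \<partial>lborel) \<le> ennreal (2 / a)"
proof -
  let ?d = "\<lambda>x. ennreal (exponential_density a x)"
  have 1: "(\<integral>\<^sup>+x. ?d x \<partial>lborel) = 1"
    using prob_space.emeasure_space_1[OF prob_space_exponential_density[OF assms]]
    by (simp add: emeasure_density)
  have 2: "(\<integral>\<^sup>+x. ?d (- x) \<partial>lborel) = 1"
    using nn_integral_real_affine[of ?d "-1" 0] 1 by simp
  \<comment> \<open>The exponential density and its reflection both count at the origin, so the
    integrands satisfy only an inequality there.\<close>
  have "(\<integral>\<^sup>+x. ennreal (exp (- (a * \<bar>x\<bar>))) \<partial>lborel)
      \<le> (\<integral>\<^sup>+x. ennreal (1 / a) * (?d x + ?d (- x)) \<partial>lborel)"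
    using assms by (intro nn_integral_mono)
      (auto simp: exponential_density_def ennreal_plus[symmetric] ennreal_mult'[symmetric] mult.commute
        simp del: ennreal_plus intro!: ennreal_leI)
  also have "\<dots> = ennreal (1 / a) * (1 + 1)"
    by (subst nn_integral_cmult) (auto simp: nn_integral_add 1 2)
  also have "\<dots> = ennreal (2 / a)"
    using assms by (simp add: ennreal_mult'[symmetric] ennreal_numeral[symmetric] del: ennreal_numeral)
  finally show ?thesis .
qed

text \<open>In the application \<open>\<kappa> * R\<close> and \<open>B / \<kappa>\<close> depend neither on \<open>n\<close> nor on the coordinate, while \<open>R\<close>
  itself may be arbitrarily small.  For \<open>R < \<rho>\<close> the estimate comes from Fubini and \<open>\<integral>P = 1\<close>
  instead of the bound \<open>P \<le> B\<close>.\<close>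

lemma tilt_second_moment:
  fixes P :: "real \<Rightarrow> real"
  assumes P [measurable]: "P \<in> borel_measurable borel" and nonneg: "\<And>t. 0 \<le> P t"
    and prob: "(\<integral>\<^sup>+t. ennreal (P t) \<partial>lborel) = 1"
    and R: "0 < R" and kappa: "0 < \<kappa>" "\<And>v. \<bar>v\<bar> < R \<Longrightarrow> \<kappa> \<le> P v" and B: "\<And>v. P v \<le> B"
    and rho: "0 < \<rho>"
  shows "(\<integral>\<^sup>+e. ennreal (std_normal_density e) * (\<integral>\<^sup>+h. ennreal (h\<^sup>2 * tilt P e h) \<partial>lborel) \<partial>lborel)
    \<le> ennreal (2 * exp (\<rho>\<^sup>2 / 2) * max (1 / (\<kappa> * R)) (4 * B / (\<kappa> * \<rho>\<^sup>2)))" (is "?L \<le> _")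
proof -
  let ?g = "std_normal_density"
  \<comment> \<open>The cap at \<open>\<rho>\<close> keeps \<open>exp (r^2 / 2)\<close> bounded: in
    the application \<open>R\<close> grows like \<open>sqrt n\<close>.\<close>
  define r where "r = min R \<rho>"
  have r: "0 < r" "r \<le> R" "r \<le> \<rho>" using R rho by (auto simp: r_def)
  define A where "A = 2 / (\<kappa> * r) * exp (r\<^sup>2 / 2)"
  have A: "0 < A" using r kappa by (simp add: A_def)
  have er: "exp (r\<^sup>2 / 2) \<le> exp (\<rho>\<^sup>2 / 2)" using r by (simp add: power_mono)
  have Bp: "0 < B" using kappa(1) kappa(2)[of 0] B[of 0] R by simp
  have le: "?g e * tilt P e h \<le> A * exp (- (r * \<bar>e\<bar> / 2)) * (?g h * P (e + h))" for e h
    using std_normal_times_tilt_le[OF P nonneg prob r(1) kappa(1) kappa(2), of e h] r(2)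
    unfolding A_def by auto
  have "?L = (\<integral>\<^sup>+e. \<integral>\<^sup>+h. ennreal (h\<^sup>2) * ennreal (?g e * tilt P e h) \<partial>lborel \<partial>lborel)"
    using tilt_nonneg[OF nonneg]
    by (auto intro!: nn_integral_cong simp: nn_integral_cmult[symmetric] ennreal_mult'[symmetric] ac_simps)
  also have "\<dots> \<le> (\<integral>\<^sup>+e. \<integral>\<^sup>+h. ennreal (h\<^sup>2) * ennreal (A * exp (- (r * \<bar>e\<bar> / 2)) * (?g h * P (e + h))) \<partial>lborel \<partial>lborel)"
    by (intro nn_integral_mono mult_left_mono ennreal_leI le) simp
  finally have main: "?L \<le> \<dots>" .
  show ?thesis
  proof (cases "R < \<rho>")
    case True
    have "ennreal (h\<^sup>2) * ennreal (A * exp (- (r * \<bar>e\<bar> / 2)) * (?g h * P (e + h)))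
        \<le> ennreal A * (ennreal (h\<^sup>2 * ?g h) * ennreal (P (e + h)))" for e h
    proof -
      have "A * exp (- (r * \<bar>e\<bar> / 2)) * (?g h * P (e + h)) \<le> A * 1 * (?g h * P (e + h))"
        using A nonneg r by (intro mult_right_mono mult_left_mono) auto
      then have "h\<^sup>2 * (A * exp (- (r * \<bar>e\<bar> / 2)) * (?g h * P (e + h))) \<le> h\<^sup>2 * (A * 1 * (?g h * P (e + h)))"
        by (intro mult_left_mono) auto
      then show ?thesis
        using A nonneg by (simp add: ennreal_mult'[symmetric] ennreal_leI ac_simps)
    qed
    then have "?L \<le> (\<integral>\<^sup>+e. \<integral>\<^sup>+h. ennreal A * (ennreal (h\<^sup>2 * ?g h) * ennreal (P (e + h))) \<partial>lborel \<partial>lborel)"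
      by (intro order.trans[OF main] nn_integral_mono)
    also have "\<dots> = (\<integral>\<^sup>+h. \<integral>\<^sup>+e. ennreal A * (ennreal (h\<^sup>2 * ?g h) * ennreal (P (h + e))) \<partial>lborel \<partial>lborel)"
      by (subst lborel_pair.Fubini') (auto simp: add.commute)
    also have "\<dots> = ennreal A"
      using nn_integral_shift[of "\<lambda>t. ennreal (P t)"] prob
      by (simp add: nn_integral_cmult nn_integral_std_normal_power2)
    also have "A \<le> 2 * exp (\<rho>\<^sup>2 / 2) * (1 / (\<kappa> * R))"
    proof -
      have "A = 2 / (\<kappa> * R) * exp (r\<^sup>2 / 2)" using True by (simp add: A_def r_def)
      also have "\<dots> \<le> 2 / (\<kappa> * R) * exp (\<rho>\<^sup>2 / 2)" using kappa R by (intro mult_left_mono er) auto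
      finally show ?thesis by simp
    qed
    also have "\<dots> \<le> 2 * exp (\<rho>\<^sup>2 / 2) * max (1 / (\<kappa> * R)) (4 * B / (\<kappa> * \<rho>\<^sup>2))"
      by (intro mult_left_mono) auto
    finally show ?thesis by (simp add: ennreal_leI)
  next
    \<comment> \<open>With \<open>r = \<rho>\<close> the factor \<open>1 / \<kappa>\<close> in
      \<open>A\<close> may be large, and it is \<open>P \<le> B\<close> that compensates it. The two
      integrals then separate: the exponential contributes at most \<open>4 / \<rho>\<close> and the
      Gaussian second moment 1, which together with \<open>A\<close> gives the second entry of the
      maximum.\<close>
    case False
    then have r_eq: "r = \<rho>" by (simp add: r_def)
    have "ennreal (h\<^sup>2) * ennreal (A * exp (- (r * \<bar>e\<bar> / 2)) * (?g h * P (e + h)))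
        \<le> ennreal (A * B) * (ennreal (exp (- (r / 2 * \<bar>e\<bar>))) * ennreal (h\<^sup>2 * ?g h))" for e h
    proof -
      have "A * exp (- (r * \<bar>e\<bar> / 2)) * (?g h * P (e + h)) \<le> A * exp (- (r * \<bar>e\<bar> / 2)) * (?g h * B)"
        using A B by (intro mult_left_mono) auto
      then have "h\<^sup>2 * (A * exp (- (r * \<bar>e\<bar> / 2)) * (?g h * P (e + h))) \<le> h\<^sup>2 * (A * exp (- (r * \<bar>e\<bar> / 2)) * (?g h * B))"
        by (rule mult_left_mono) auto
      then show ?thesis
        using A Bp nonneg by (simp add: ennreal_mult'[symmetric] ennreal_leI ac_simps)
    qed
    then have "?L \<le> (\<integral>\<^sup>+e. \<integral>\<^sup>+h. ennreal (A * B) * (ennreal (exp (- (r / 2 * \<bar>e\<bar>))) * ennreal (h\<^sup>2 * ?g h)) \<partial>lborel \<partial>lborel)"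
      by (intro order.trans[OF main] nn_integral_mono)
    also have "\<dots> = ennreal (A * B) * (\<integral>\<^sup>+e. ennreal (exp (- (r / 2 * \<bar>e\<bar>))) \<partial>lborel)"
      by (simp add: nn_integral_cmult nn_integral_std_normal_power2)
    also have "\<dots> \<le> ennreal (A * B) * ennreal (2 / (r / 2))"
      by (intro mult_left_mono nn_integral_exp_abs) (use r in auto)
    also have "\<dots> = ennreal (2 * exp (\<rho>\<^sup>2 / 2) * (4 * B / (\<kappa> * \<rho>\<^sup>2)))"
      using A Bp r kappa by (simp add: ennreal_mult'[symmetric] A_def r_eq power2_eq_square)
    also have "\<dots> \<le> ennreal (2 * exp (\<rho>\<^sup>2 / 2) * max (1 / (\<kappa> * R)) (4 * B / (\<kappa> * \<rho>\<^sup>2)))"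
      by (intro ennreal_leI mult_left_mono) auto
    finally show ?thesis .
  qed
qed

text \<open>The density of \<open>sqrt n * (t - \<theta>)\<close> when \<open>t\<close> has density
  \<open>p\<close>. For \<open>n = 0\<close> division by zero makes it the zero function, and its
  \<open>tilt\<close> is then zero as well.\<close>

definition local_density :: "(real \<Rightarrow> real) \<Rightarrow> real \<Rightarrow> nat \<Rightarrow> real \<Rightarrow> real" where
  "local_density p \<theta> n v = p (\<theta> + v / sqrt (real n)) / sqrt (real n)"

lemma measurable_local_density [measurable]:
  assumes [measurable]: "p \<in> borel_measurable borel"
  shows "local_density p \<theta> n \<in> borel_measurable borel"
  unfolding local_density_def by measurable

lemma local_density_nonneg: "(\<And>t. 0 \<le> p t) \<Longrightarrow> 0 \<le> local_density p \<theta> n v"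
  by (simp add: local_density_def)

lemma nn_integral_local_density:
  assumes [measurable]: "p \<in> borel_measurable borel" and n: "0 < n"
  shows "(\<integral>\<^sup>+v. ennreal (local_density p \<theta> n v) \<partial>lborel) = (\<integral>\<^sup>+t. ennreal (p t) \<partial>lborel)"
proof -
  have "(\<integral>\<^sup>+t. ennreal (p t) \<partial>lborel)
      = ennreal (1 / sqrt n) * (\<integral>\<^sup>+v. ennreal (p (\<theta> + v / sqrt n)) \<partial>lborel)"
    using nn_integral_real_affine[of "\<lambda>t. ennreal (p t)" "1 / sqrt n" \<theta>] n by simp
  also have "\<dots> = (\<integral>\<^sup>+v. ennreal (local_density p \<theta> n v) \<partial>lborel)"
    by (subst nn_integral_cmult[symmetric])
      (auto simp: local_density_def ennreal_mult'[symmetric] intro!: nn_integral_cong)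
  finally show ?thesis ..
qed

text \<open>The factors \<open>1 / sqrt n\<close> cancel between numerator and normalizer. The
  remaining prior values converge to \<open>p \<theta>\<close> at every point, and in the normalizer
  this limit passes under the integral by domination with \<open>B\<close> times the Gaussian. Since
  \<open>p \<theta>\<close> is positive, it cancels from the quotient.\<close>

lemma tilt_tendsto_std_normal_pointwise:
  fixes p :: "real \<Rightarrow> real"
  assumes p [measurable]: "p \<in> borel_measurable borel" and nonneg: "\<And>t. 0 \<le> p t"
    and B: "\<And>t. p t \<le> B" and cont: "isCont p \<theta>" and pos: "0 < p \<theta>"
  shows "(\<lambda>n. tilt (local_density p \<theta> n) e h) \<longlonglongrightarrow> std_normal_density h"
proof -
  let ?g = std_normal_density
  let ?q = "\<lambda>n k. p (\<theta> + (e + k) / sqrt (real n))"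
  have lim: "(\<lambda>n. ?q n k) \<longlonglongrightarrow> p \<theta>" for k
  proof (rule isCont_tendsto_compose[OF cont])
    have "(\<lambda>n. (e + k) / sqrt (real n)) \<longlonglongrightarrow> 0"
      by (intro real_tendsto_divide_at_top[OF tendsto_const] filterlim_compose[OF sqrt_at_top]
          filterlim_real_sequentially)
    from tendsto_add[OF tendsto_const this, of \<theta>]
    show "(\<lambda>n. \<theta> + (e + k) / sqrt (real n)) \<longlonglongrightarrow> \<theta>" by simp
  qed
  have ig: "integrable lborel ?g" by simp
  have "(\<lambda>n. \<integral>k. ?g k * ?q n k \<partial>lborel) \<longlonglongrightarrow> (\<integral>k. ?g k * p \<theta> \<partial>lborel)"
  proof (rule integral_dominated_convergence[where w = "\<lambda>k. ?g k * B"])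
    show "AE k in lborel. norm (?g k * ?q n k) \<le> ?g k * B" for n
      using nonneg B by (auto simp: abs_mult intro!: mult_left_mono)
    show "AE k in lborel. (\<lambda>n. ?g k * ?q n k) \<longlonglongrightarrow> ?g k * p \<theta>"
      by (intro AE_I2 tendsto_mult tendsto_const lim)
  qed (use ig in auto)
  moreover have "(\<integral>k. ?g k * p \<theta> \<partial>lborel) = p \<theta>"
    by simp
  ultimately have "(\<lambda>n. \<integral>k. ?g k * ?q n k \<partial>lborel) \<longlonglongrightarrow> p \<theta>" by simp
  from tendsto_divide[OF tendsto_mult[OF tendsto_const lim] this, of "?g h" h] pos
  have "(\<lambda>n. ?g h * ?q n h / (\<integral>k. ?g k * ?q n k \<partial>lborel)) \<longlonglongrightarrow> ?g h" by simp
  then show ?thesis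
  proof (rule Lim_transform_eventually)
    show "\<forall>\<^sub>F n in sequentially.
        ?g h * ?q n h / (\<integral>k. ?g k * ?q n k \<partial>lborel) = tilt (local_density p \<theta> n) e h"
      using eventually_gt_at_top[of 0]
      by eventually_elim (simp add: tilt_def local_density_def)
  qed
qed

text \<open>Scheffe's lemma works for one value \<open>e\<close> of the noise at a time. The inner
  integral never exceeds 2, so dominated convergence carries the limit through the average over
  \<open>e\<close>.\<close>

lemma tilt_tendsto_std_normal:
  fixes p :: "real \<Rightarrow> real"
  assumes p [measurable]: "p \<in> borel_measurable borel" and nonneg: "\<And>t. 0 \<le> p t"
    and prob: "(\<integral>\<^sup>+t. ennreal (p t) \<partial>lborel) = 1"
    and B: "\<And>t. p t \<le> B" and cont: "isCont p \<theta>" and pos: "0 < p \<theta>"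
  shows "(\<lambda>n. \<integral>\<^sup>+e. ennreal (std_normal_density e) *
      (\<integral>\<^sup>+h. ennreal \<bar>tilt (local_density p \<theta> n) e h - std_normal_density h\<bar> \<partial>lborel) \<partial>lborel) \<longlonglongrightarrow> 0"
proof -
  let ?g = std_normal_density
  let ?t = "\<lambda>n. tilt (local_density p \<theta> n)"
  let ?D = "\<lambda>n e. \<integral>\<^sup>+h. ennreal \<bar>?t n e h - ?g h\<bar> \<partial>lborel"
  \<comment> \<open>At \<open>n = 0\<close> the tilt is zero, so the bound by 1 holds for all
    \<open>n\<close> and the dominated convergence rule applies to the whole sequence.\<close>
  have t1: "(\<integral>\<^sup>+h. ennreal (?t n e h) \<partial>lborel) \<le> 1" for n e
  proof (cases "n = 0")
    case False
    then show ?thesis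
      by (subst nn_integral_tilt) (auto simp: local_density_nonneg nonneg nn_integral_local_density prob)
  qed (simp add: tilt_def local_density_def)
  have t0: "0 \<le> ?t n e h" for n e h by (intro tilt_nonneg local_density_nonneg nonneg)
  have D2: "?D n e \<le> 2" for n e
  proof -
    have "?D n e \<le> (\<integral>\<^sup>+h. ennreal (?t n e h) + ennreal (?g h) \<partial>lborel)"
    proof (rule nn_integral_mono)
      fix h
      have "\<bar>?t n e h - ?g h\<bar> \<le> ?t n e h + ?g h"
        using t0[of n e h] normal_density_nonneg[of 0 1 h] by linarith
      then show "ennreal \<bar>?t n e h - ?g h\<bar> \<le> ennreal (?t n e h) + ennreal (?g h)"
        using t0 by (simp add: ennreal_plus[symmetric] ennreal_leI del: ennreal_plus)
    qed
    also have "\<dots> = (\<integral>\<^sup>+h. ennreal (?t n e h) \<partial>lborel) + 1"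
      by (subst nn_integral_add) (simp_all add: nn_integral_std_normal)
    also have "\<dots> \<le> 1 + 1" by (intro add_right_mono t1)
    finally show ?thesis by simp
  qed
  have D0: "(\<lambda>n. ?D n e) \<longlonglongrightarrow> 0" for e
  proof -
    have "(\<lambda>n. \<integral>\<^sup>+h. norm (?t n e h - ?g h) \<partial>lborel) \<longlonglongrightarrow> 0"
    proof (rule Scheffe_lemma2)
      show "AE h in lborel. (\<lambda>n. ?t n e h) \<longlonglongrightarrow> ?g h"
        by (intro AE_I2 tilt_tendsto_std_normal_pointwise[OF p nonneg B cont pos])
      show "(\<integral>\<^sup>+h. norm (?t n e h) \<partial>lborel) \<le> (\<integral>\<^sup>+h. norm (?g h) \<partial>lborel)" for n
        using t1[of n e] t0 by (simp add: nn_integral_std_normal)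
    qed auto
    then show ?thesis by simp
  qed
  have "(\<lambda>n. \<integral>\<^sup>+e. ennreal (?g e) * ?D n e \<partial>lborel) \<longlonglongrightarrow> (\<integral>\<^sup>+(e::real). 0 \<partial>lborel)"
  proof (rule nn_integral_dominated_convergence[where w = "\<lambda>e. ennreal (?g e) * 2"])
    show "(\<integral>\<^sup>+e. ennreal (?g e) * 2 \<partial>lborel) < \<infinity>"
      by (simp add: nn_integral_multc nn_integral_std_normal)
    show "AE e in lborel. (\<lambda>n. ennreal (?g e) * ?D n e) \<longlonglongrightarrow> 0"
    proof (intro AE_I2)
      fix e show "(\<lambda>n. ennreal (?g e) * ?D n e) \<longlonglongrightarrow> 0"
        using ennreal_tendsto_cmult[OF _ D0, of "ennreal (?g e)" e] by simp
    qed
  qed (auto intro!: mult_left_mono D2)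
  then show ?thesis by simp
qed

text \<open>Under the substitution \<open>t = y + h / sqrt n\<close> the likelihood becomes
  \<open>sqrt (2 * pi)\<close> times the Gaussian density at \<open>h\<close>; this constant and the
  Jacobian cancel against the normalizer. The point \<open>\<theta>\<close> merely fixes an origin,
  because \<open>?e + h = sqrt n * (t - \<theta>)\<close>.\<close>

lemma distr_posterior_density:
  assumes p [measurable]: "p \<in> borel_measurable borel" and n: "0 < n"
  shows "distr (density lborel (\<lambda>t. ennreal (posterior_density n p y t))) borel (\<lambda>t. sqrt (real n) * (t - y))
    = density lborel (\<lambda>h. ennreal (tilt (local_density p \<theta> n) (sqrt (real n) * (y - \<theta>)) h))"
proof (rule measure_eqI)
  let ?e = "sqrt (real n) * (y - \<theta>)" and ?g = std_normal_density and ?s = "sqrt (real n)"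
  fix A assume "A \<in> sets (distr (density lborel (\<lambda>t. ennreal (posterior_density n p y t))) borel (\<lambda>t. sqrt (real n) * (t - y)))"
  then have [measurable]: "A \<in> sets borel" by simp
  define Z where "Z = (\<integral>s. exp (- real n * (y - s)\<^sup>2 / 2) * p s \<partial>lborel)"
  have e: "exp (- real n * (y - (y + h / ?s))\<^sup>2 / 2) = sqrt (2 * pi) * ?g h" for h
    using n by (simp add: std_normal_density_def power_divide)
  have l: "?s * local_density p \<theta> n (?e + h) = p (y + h / ?s)" for h
    using n by (simp add: local_density_def add_divide_distrib)
  have "Z = 1 / ?s * (\<integral>h. exp (- real n * (y - (y + h / ?s))\<^sup>2 / 2) * p (y + h / ?s) \<partial>lborel)"
    unfolding Z_def using n by (subst lborel_integral_real_affine[of "1 / ?s" _ y]) auto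
  also have "\<dots> = 1 / ?s * (\<integral>h. sqrt (2 * pi) * ?s * (?g h * local_density p \<theta> n (?e + h)) \<partial>lborel)"
    unfolding e l[symmetric] by (simp add: mult_ac)
  also have "\<dots> = sqrt (2 * pi) * (\<integral>h. ?g h * local_density p \<theta> n (?e + h) \<partial>lborel)"
    using n by simp
  finally have Z: "Z = sqrt (2 * pi) * (\<integral>h. ?g h * local_density p \<theta> n (?e + h) \<partial>lborel)" .
  have t: "posterior_density n p y (y + h / ?s) = ?s * tilt (local_density p \<theta> n) ?e h" for h
    unfolding posterior_density_def Z_def[symmetric] Z e l[symmetric] tilt_def by simp
  have [measurable]: "posterior_density n p y \<in> borel_measurable borel"
    unfolding posterior_density_def Z_def[symmetric] by measurable
  have "emeasure (distr (density lborel (\<lambda>t. ennreal (posterior_density n p y t))) borel (\<lambda>t. ?s * (t - y))) A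
      = (\<integral>\<^sup>+t. ennreal (posterior_density n p y t) * indicator A (?s * (t - y)) \<partial>lborel)"
    by (subst emeasure_distr)
      (simp_all add: emeasure_density measurable_sets_borel[of "\<lambda>t. ?s * (t - y)" borel A] indicator_vimage)
  also have "\<dots> = ennreal (1 / ?s) * (\<integral>\<^sup>+h. ennreal (posterior_density n p y (y + h / ?s)) * indicator A h \<partial>lborel)"
    using n by (subst nn_integral_real_affine[where c = "1 / ?s" and t = y]) auto
  also have "\<dots> = (\<integral>\<^sup>+h. ennreal (tilt (local_density p \<theta> n) ?e h) * indicator A h \<partial>lborel)"
    using n unfolding t
    by (subst nn_integral_cmult[symmetric])
      (auto simp: ennreal_mult'[symmetric] mult.assoc[symmetric] intro!: nn_integral_cong)
  also have "\<dots> = emeasure (density lborel (\<lambda>h. ennreal (tilt (local_density p \<theta> n) ?e h))) A"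
    by (simp add: emeasure_density)
  finally show "emeasure (distr (density lborel (\<lambda>t. ennreal (posterior_density n p y t))) borel (\<lambda>t. ?s * (t - y))) A
     = emeasure (density lborel (\<lambda>h. ennreal (tilt (local_density p \<theta> n) ?e h))) A" .
qed simp

subsection \<open>Sums and product measures\<close>

text \<open>The space is defined through \<open>infsum\<close>, whereas the estimates use
  \<open>nn_integral\<close> over \<open>count_space\<close>, where Tonelli's theorem applies to any
  nonnegative family. This lemma and the next translate between the two.\<close>

lemma ennreal_infsum:
  fixes f :: "'i \<Rightarrow> real"
  assumes "f summable_on A" "\<And>i. i \<in> A \<Longrightarrow> 0 \<le> f i"
  shows "ennreal (\<Sum>\<^sub>\<infinity>i\<in>A. f i) = (\<integral>\<^sup>+i. ennreal (f i) \<partial>count_space A)"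
proof -
  have "Infinite_Set_Sum.abs_summable_on f A"
    using summable_on_iff_abs_summable_on_real[THEN iffD1, OF assms(1)] by (simp only: abs_summable_equivalent)
  then show ?thesis using assms(2) by (simp add: nn_integral_conv_infsetsum infsetsum_infsum)
qed

lemma summable_on_nn_integral:
  fixes f :: "'i \<Rightarrow> real"
  assumes "(\<integral>\<^sup>+i. ennreal (f i) \<partial>count_space A) < \<infinity>" "\<And>i. i \<in> A \<Longrightarrow> 0 \<le> f i"
  shows "f summable_on A"
proof -
  have "integrable (count_space A) f"
    using assms by (intro integrableI_nonneg) (auto simp: AE_count_space)
  then have "Infinite_Set_Sum.abs_summable_on f A" by (simp add: abs_summable_on_def)
  then show ?thesis
    by (simp only: summable_on_iff_abs_summable_on_real[THEN iffD2] abs_summable_equivalent)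
qed

lemma nn_integral_count_space_split:
  assumes "finite F" "F \<subseteq> I"
  shows "(\<integral>\<^sup>+i. f i \<partial>count_space I) = (\<integral>\<^sup>+i. f i \<partial>count_space (I - F)) + (\<Sum>i\<in>F. f i)"
proof -
  have "(\<integral>\<^sup>+i. f i \<partial>count_space I) = (\<integral>\<^sup>+i. f i * indicator (I - F) i + f i * indicator F i \<partial>count_space I)"
    by (intro nn_integral_cong) (auto simp: indicator_def)
  also have "\<dots> = (\<integral>\<^sup>+i\<in>I - F. f i \<partial>count_space I) + (\<integral>\<^sup>+i\<in>F. f i \<partial>count_space I)"
    by (rule nn_integral_add) auto
  also have "(\<integral>\<^sup>+i\<in>I - F. f i \<partial>count_space I) = (\<integral>\<^sup>+i. f i \<partial>count_space (I - F))"
    by (subst nn_integral_count_space_indicator[of "I - F"]) (auto simp: nn_integral_count_space_indicator[of I] indicator_def intro!: nn_integral_cong)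
  also have "(\<integral>\<^sup>+i\<in>F. f i \<partial>count_space I) = (\<integral>\<^sup>+i. f i \<partial>count_space F)"
    using assms by (subst nn_integral_count_space_indicator[of F]) (auto simp: nn_integral_count_space_indicator[of I] indicator_def intro!: nn_integral_cong)
  finally show ?thesis using assms by (simp add: nn_integral_count_space_finite)
qed

section \<open>Images of product measures and exchange of coordinates\<close>

lemma sets_PiM_borel:
  "(\<And>i. i \<in> I \<Longrightarrow> sets (M i) = sets borel) \<Longrightarrow> sets (PiM I M) = sets (PiM I (\<lambda>i. borel))"
  by (intro sets_PiM_cong refl)

text \<open>The preimage of a box is again a box, and finite measures on an infinite product are
  determined by boxes over finitely many coordinates. It serves both the rescaling and the
  truncation.\<close>

lemma distr_PiM_map:
  fixes M :: "'i \<Rightarrow> real measure" and T :: "'i \<Rightarrow> real \<Rightarrow> real"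
  assumes M: "\<And>i. i \<in> I \<Longrightarrow> prob_space (M i)" "\<And>i. i \<in> I \<Longrightarrow> sets (M i) = sets borel"
    and T: "\<And>i. i \<in> I \<Longrightarrow> T i \<in> borel_measurable borel"
  shows "distr (PiM I M) (PiM I (\<lambda>i. borel)) (\<lambda>x. \<lambda>i\<in>I. T i (x i)) = PiM I (\<lambda>i. distr (M i) borel (T i))"
proof (rule measure_eqI_PiM_infinite[of _ I "\<lambda>i. borel"])
  let ?T = "\<lambda>x. \<lambda>i\<in>I. T i (x i)"
  have TM: "T i \<in> M i \<rightarrow>\<^sub>M borel" if "i \<in> I" for i
    using T[OF that] M(2)[OF that] by (simp cong: measurable_cong_sets)
  have sM: "sets (PiM I M) = sets (PiM I (\<lambda>i. borel))" by (rule sets_PiM_borel[OF M(2)])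
  have meas: "?T \<in> PiM I M \<rightarrow>\<^sub>M PiM I (\<lambda>i. borel)"
  proof (rule measurable_restrict)
    fix i assume "i \<in> I"
    from measurable_compose[OF measurable_component_singleton[OF this, of M] TM[OF this]]
    show "(\<lambda>x. T i (x i)) \<in> PiM I M \<rightarrow>\<^sub>M borel" .
  qed
  show "sets (distr (PiM I M) (PiM I (\<lambda>i. borel)) ?T) = sets (PiM I (\<lambda>i. borel))" by simp
  show "sets (PiM I (\<lambda>i. distr (M i) borel (T i))) = sets (PiM I (\<lambda>i. borel))"
    by (rule sets_PiM_borel) simp
  show "finite_measure (distr (PiM I M) (PiM I (\<lambda>i. borel)) ?T)"
    by (intro prob_space.finite_measure prob_space.prob_space_distr prob_space_PiM M meas)
  fix A :: "'i \<Rightarrow> real set" and J assume J: "finite J" "J \<subseteq> I" and A: "\<And>i. i \<in> J \<Longrightarrow> A i \<in> sets borel"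
  let ?box = "\<lambda>A. prod_emb I (\<lambda>i. borel :: real measure) J (Pi\<^sub>E J A)"
  have "?T -` ?box A \<inter> space (PiM I M) = ?box (\<lambda>i. T i -` A i)"
    using J(2) by (auto simp: prod_emb_def space_PiM PiE_iff subset_iff sets_eq_imp_space_eq[OF M(2)])
  moreover have "?box A \<in> sets (PiM I (\<lambda>i. borel))" using J A by (intro sets_PiM_I) auto
  ultimately have "emeasure (distr (PiM I M) (PiM I (\<lambda>i. borel)) ?T) (?box A) = emeasure (PiM I M) (?box (\<lambda>i. T i -` A i))"
    using meas by (simp add: emeasure_distr)
  also have "\<dots> = (\<Prod>i\<in>J. emeasure (M i) (T i -` A i))"
    using J A T by (intro emeasure_PiM_box M) (auto intro: measurable_sets_borel)
  also have "\<dots> = (\<Prod>i\<in>J. emeasure (distr (M i) borel (T i)) (A i))"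
  proof (intro prod.cong refl)
    fix i assume i: "i \<in> J"
    then have "i \<in> I" using J by blast
    from emeasure_distr[OF TM[OF this] A[OF i]] sets_eq_imp_space_eq[OF M(2)[OF this]]
    show "emeasure (M i) (T i -` A i) = emeasure (distr (M i) borel (T i)) (A i)" by simp
  qed
  also have "\<dots> = emeasure (PiM I (\<lambda>i. distr (M i) borel (T i))) (?box A)"
    by (intro emeasure_PiM_box[symmetric] prob_space.prob_space_distr M TM J A) auto
  finally show "emeasure (distr (PiM I M) (PiM I (\<lambda>i. borel)) ?T) (?box A)
    = emeasure (PiM I (\<lambda>i. distr (M i) borel (T i))) (?box A)" .
qed

text \<open>The coordinates other than \<open>j\<close> have the same law on both sides. Integrating
  them out first leaves a function of coordinate \<open>j\<close> alone, still measurable and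
  bounded by 1, to which the hypothesis on \<open>D\<close> applies.\<close>

lemma integral_PiM_update_bound:
  fixes M :: "'i \<Rightarrow> real measure" and v :: "('i \<Rightarrow> real) \<Rightarrow> real"
  assumes M: "\<And>i. i \<in> I \<Longrightarrow> prob_space (M i)" "\<And>i. i \<in> I \<Longrightarrow> sets (M i) = sets borel"
    and N: "prob_space N" "sets N = sets borel" and j: "j \<in> I"
    and D: "\<And>f. f \<in> borel_measurable borel \<Longrightarrow> (\<And>t. \<bar>f t\<bar> \<le> 1) \<Longrightarrow>
      ennreal \<bar>(\<integral>t. f t \<partial>M j) - (\<integral>t. f t \<partial>N)\<bar> \<le> D"
    and v: "v \<in> borel_measurable (PiM I (\<lambda>i. borel))" "\<And>x. \<bar>v x\<bar> \<le> 1"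
  shows "ennreal \<bar>(\<integral>x. v x \<partial>PiM I M) - (\<integral>x. v x \<partial>PiM I (M(j := N)))\<bar> \<le> D"
proof -
  let ?J = "I - {j}"
  define f where "f t = (\<integral>x. v (x(j := t)) \<partial>PiM ?J M)" for t
  have J: "insert j ?J = I" using j by auto
  interpret R: prob_space "PiM ?J M" by (intro prob_space_PiM M) auto
  have sR: "sets (PiM ?J M) = sets (PiM ?J (\<lambda>i. borel))" by (rule sets_PiM_borel) (simp add: M)
  have "(\<lambda>(t, x). x(j := t)) \<in> borel \<Otimes>\<^sub>M PiM ?J (\<lambda>i. borel) \<rightarrow>\<^sub>M PiM (insert j ?J) (\<lambda>i. borel)"
    unfolding split_beta' by (intro measurable_fun_upd[where J = ?J]) auto
  then have upd: "(\<lambda>(t, x). x(j := t)) \<in> borel \<Otimes>\<^sub>M PiM ?J M \<rightarrow>\<^sub>M PiM I (\<lambda>i. borel)"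
    unfolding J by (simp cong: measurable_cong_sets sets_pair_measure_cong add: sR)
  have vm: "(\<lambda>(t, x). v (x(j := t))) \<in> borel_measurable (borel \<Otimes>\<^sub>M PiM ?J M)"
    using measurable_compose[OF upd v(1)] by (simp add: split_beta')
  have f_meas: "f \<in> borel_measurable borel"
    unfolding f_def by (rule R.borel_measurable_lebesgue_integral[OF vm])
  have f_bd: "\<bar>f t\<bar> \<le> 1" for t
  proof -
    have "norm (f t) \<le> (\<integral>x. norm (v (x(j := t))) \<partial>PiM ?J M)"
      unfolding f_def by (rule integral_norm_bound)
    also have "\<dots> \<le> (\<integral>x. 1 \<partial>PiM ?J M)" using v(2) by (intro integral_mono') auto
    finally have "norm (f t) \<le> (\<integral>x. 1 \<partial>PiM ?J M)" .
    then show ?thesis by (simp add: R.prob_space)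
  qed
  \<comment> \<open>Stated for every family that agrees with \<open>M\<close> off \<open>j\<close>,
    since it is used for \<open>M\<close> and for \<open>M(j := N)\<close> with one and the same
    \<open>f\<close>.\<close>
  have step: "(\<integral>x. v x \<partial>PiM I M') = (\<integral>t. f t \<partial>M' j)"
    if M': "\<And>i. i \<in> I \<Longrightarrow> prob_space (M' i)" "\<And>i. i \<in> I \<Longrightarrow> sets (M' i) = sets borel"
      and eq: "\<And>i. i \<in> ?J \<Longrightarrow> M' i = M i" for M'
  proof -
    have P: "PiM ?J M' = PiM ?J M" by (intro PiM_cong refl eq)
    interpret j: prob_space "M' j" by (rule M'(1)[OF j])
    interpret pair_prob_space "M' j" "PiM ?J M" ..
    have sp: "sets (M' j \<Otimes>\<^sub>M PiM ?J M) = sets (borel \<Otimes>\<^sub>M PiM ?J M)"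
      by (intro sets_pair_measure_cong refl M'(2) j)
    have upd': "(\<lambda>(t, x). x(j := t)) \<in> M' j \<Otimes>\<^sub>M PiM ?J M \<rightarrow>\<^sub>M PiM I M'"
      using upd by (simp cong: measurable_cong_sets add: sp sets_PiM_borel[OF M'(2)])
    have vm': "(\<lambda>(t, x). v (x(j := t))) \<in> borel_measurable (M' j \<Otimes>\<^sub>M PiM ?J M)"
      using vm by (simp cong: measurable_cong_sets add: sp)
    have "distr (M' j \<Otimes>\<^sub>M PiM ?J M') (PiM (insert j ?J) M') (\<lambda>(t, x). x(j := t)) = PiM (insert j ?J) M'"
      by (rule distr_pair_PiM_eq_PiM) (use M'(1) j in auto)
    then have "(\<integral>x. v x \<partial>PiM I M') = (\<integral>x. v x \<partial>distr (M' j \<Otimes>\<^sub>M PiM ?J M) (PiM I M') (\<lambda>(t, x). x(j := t)))"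
      unfolding J P by (simp only:)
    also have "\<dots> = (\<integral>z. v ((\<lambda>(t, x). x(j := t)) z) \<partial>(M' j \<Otimes>\<^sub>M PiM ?J M))"
      using v(1) by (intro integral_distr upd') (simp cong: measurable_cong_sets add: sets_PiM_borel[OF M'(2)])
    also have "\<dots> = (\<integral>(t, x). v (x(j := t)) \<partial>(M' j \<Otimes>\<^sub>M PiM ?J M))"
      by (simp add: split_beta')
    also have "\<dots> = (\<integral>t. \<integral>x. v (x(j := t)) \<partial>PiM ?J M \<partial>M' j)"
    proof -
      have "integrable (M' j \<Otimes>\<^sub>M PiM ?J M) (\<lambda>(t, x). v (x(j := t)))"
        by (rule P.integrable_const_bound[where B = 1]) (use vm' v(2) in auto)
      from integral_fst'[OF this] show ?thesis by simp
    qed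
    finally show ?thesis by (simp add: f_def)
  qed
  have "(\<integral>x. v x \<partial>PiM I M) = (\<integral>t. f t \<partial>M j)" by (rule step) (use M in auto)
  moreover have "(\<integral>x. v x \<partial>PiM I (M(j := N))) = (\<integral>t. f t \<partial>N)"
    using step[of "M(j := N)"] M N by auto
  ultimately show ?thesis using D[OF f_meas f_bd] by simp
qed

text \<open>Coordinates are exchanged one at a time through the hybrid products \<open>?H F\<close>,
  and the errors add up by the triangle inequality.\<close>

lemma integral_PiM_replace_bound:
  fixes M N :: "'i \<Rightarrow> real measure" and v :: "('i \<Rightarrow> real) \<Rightarrow> real"
  assumes M: "\<And>i. i \<in> I \<Longrightarrow> prob_space (M i)" "\<And>i. i \<in> I \<Longrightarrow> sets (M i) = sets borel"
    and N: "\<And>i. i \<in> I \<Longrightarrow> prob_space (N i)" "\<And>i. i \<in> I \<Longrightarrow> sets (N i) = sets borel"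
    and F: "finite F" "F \<subseteq> I"
    and D: "\<And>i f. i \<in> F \<Longrightarrow> f \<in> borel_measurable borel \<Longrightarrow> (\<And>t. \<bar>f t\<bar> \<le> 1) \<Longrightarrow>
      ennreal \<bar>(\<integral>t. f t \<partial>M i) - (\<integral>t. f t \<partial>N i)\<bar> \<le> D i"
    and v: "v \<in> borel_measurable (PiM I (\<lambda>i. borel))" "\<And>x. \<bar>v x\<bar> \<le> 1"
  shows "ennreal \<bar>(\<integral>x. v x \<partial>PiM I M) - (\<integral>x. v x \<partial>PiM I (\<lambda>i. if i \<in> F then N i else M i))\<bar> \<le> (\<Sum>i\<in>F. D i)"
  using F D
proof (induction F rule: finite_induct)
  case empty
  then show ?case by simp
next
  case (insert j F)
  let ?H = "\<lambda>F i. if i \<in> F then N i else M i"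
  let ?a = "\<integral>x. v x \<partial>PiM I M" and ?b = "\<lambda>F. \<integral>x. v x \<partial>PiM I (?H F)"
  have "?H (insert j F) = (?H F)(j := N j)" by auto
  moreover have "ennreal \<bar>?b F - (\<integral>x. v x \<partial>PiM I ((?H F)(j := N j)))\<bar> \<le> D j"
  proof (rule integral_PiM_update_bound[OF _ _ _ _ _ _ v])
    fix f :: "real \<Rightarrow> real" assume "f \<in> borel_measurable borel" "\<And>t. \<bar>f t\<bar> \<le> 1"
    from insert.prems(2)[OF insertI1 this] insert.hyps(2)
    show "ennreal \<bar>(\<integral>t. f t \<partial>?H F j) - (\<integral>t. f t \<partial>N j)\<bar> \<le> D j" by simp
  qed (use insert.prems(1) M N in auto)
  ultimately have 1: "ennreal \<bar>?b F - ?b (insert j F)\<bar> \<le> D j" by simp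
  have 2: "ennreal \<bar>?a - ?b F\<bar> \<le> (\<Sum>i\<in>F. D i)" using insert.prems by (intro insert.IH) auto
  have "ennreal \<bar>?a - ?b (insert j F)\<bar> \<le> ennreal (\<bar>?a - ?b F\<bar> + \<bar>?b F - ?b (insert j F)\<bar>)"
    by (intro ennreal_leI) simp
  also have "\<dots> \<le> (\<Sum>i\<in>F. D i) + D j" unfolding ennreal_plus[OF abs_ge_zero abs_ge_zero] by (intro add_mono 1 2)
  finally show ?case using insert.hyps by (simp add: add.commute)
qed

subsection \<open>Measures on the weighted sequence space\<close>

context
  fixes I :: "'i set" and w :: "'i \<Rightarrow> real"
  assumes w_pos: "\<And>i. i \<in> I \<Longrightarrow> 0 < w i"
begin

lemma H_norm_power2_nn_integral:
  assumes "x \<in> H_space I w"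
  shows "ennreal ((H_norm I w x)\<^sup>2) = (\<integral>\<^sup>+i. ennreal (w i * (x i)\<^sup>2) \<partial>count_space I)"
proof -
  have "(H_norm I w x)\<^sup>2 = (\<Sum>\<^sub>\<infinity>i\<in>I. w i * (x i)\<^sup>2)" by (rule H_norm_power2) (rule w_pos)
  then show ?thesis
    using assms w_pos by (auto intro!: ennreal_infsum simp: H_space_def less_imp_le)
qed

lemma H_space_nn_integral:
  assumes "x \<in> extensional I" "(\<integral>\<^sup>+i. ennreal (w i * (x i)\<^sup>2) \<partial>count_space I) < \<infinity>"
  shows "x \<in> H_space I w"
  using assms w_pos unfolding H_space_def
  by (auto intro!: summable_on_nn_integral simp: less_imp_le)

lemma H_space_scale:
  assumes "x \<in> H_space I w"
  shows "(\<lambda>i\<in>I. c * x i) \<in> H_space I w"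
proof -
  have "(\<lambda>i. c\<^sup>2 * (w i * (x i)\<^sup>2)) summable_on I"
    using assms by (intro summable_on_cmult_right) (simp add: H_space_def)
  then show ?thesis
    by (simp add: H_space_def power_mult_distrib mult_ac cong: summable_on_cong)
qed

text \<open>\<open>H_borel\<close> is generated by the metric topology, so it is enough that
  preimages of open sets are open. Coordinate projections and bounded Lipschitz test functions are
  both covered.\<close>

lemma lipschitz_measurable_H_borel:
  fixes f :: "('i \<Rightarrow> real) \<Rightarrow> real"
  assumes "0 \<le> B"
    and f: "\<And>x y. x \<in> H_space I w \<Longrightarrow> y \<in> H_space I w \<Longrightarrow> \<bar>f x - f y\<bar> \<le> B * H_dist I w x y"
  shows "f \<in> borel_measurable (H_borel I w)"
proof (rule borel_measurableI)
  interpret H: Metric_space "H_space I w" "H_dist I w" by (rule Metric_space_H) (rule w_pos)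
  fix S :: "real set" assume S: "open S"
  have "openin H.mtopology (f -` S \<inter> H_space I w)"
    unfolding H.openin_mtopology
  proof (intro conjI allI impI)
    fix x assume x: "x \<in> f -` S \<inter> H_space I w"
    then obtain e where e: "0 < e" "ball (f x) e \<subseteq> S" using S by (auto simp: open_contains_ball)
    \<comment> \<open>The radius uses \<open>B + 1\<close> instead of \<open>B\<close> so that
      \<open>B = 0\<close> is no exception.\<close>
    have "H.mball x (e / (B + 1)) \<subseteq> f -` S \<inter> H_space I w"
    proof
      fix y assume y: "y \<in> H.mball x (e / (B + 1))"
      then have "y \<in> H_space I w" "H_dist I w x y < e / (B + 1)" by auto
      moreover have "\<bar>f x - f y\<bar> \<le> B * H_dist I w x y" using x calculation by (intro f) auto
      moreover have "B * H_dist I w x y \<le> (B + 1) * H_dist I w x y" by (simp add: algebra_simps)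
      moreover have "(B + 1) * H_dist I w x y < e"
        using calculation(2) \<open>0 \<le> B\<close> by (simp add: field_simps)
      ultimately have "f y \<in> ball (f x) e" by (simp add: dist_real_def)
      then show "y \<in> f -` S \<inter> H_space I w" using e \<open>y \<in> H_space I w\<close> by auto
    qed
    then show "\<exists>r>0. H.mball x r \<subseteq> f -` S \<inter> H_space I w"
      using e \<open>0 \<le> B\<close> by (intro exI[of _ "e / (B + 1)"]) auto
  qed auto
  then have "f -` S \<inter> H_space I w \<in> sets (H_borel I w)"
    unfolding H_borel_def by (subst sets_measure_of) (auto simp: H.openin_mtopology intro: sigma_sets.Basic)
  moreover have "space (H_borel I w) = H_space I w" by (rule space_H_borel) (rule w_pos)
  ultimately show "f -` S \<inter> space (H_borel I w) \<in> sets (H_borel I w)" by simp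
qed

lemma measurable_H_component:
  assumes i: "i \<in> I"
  shows "(\<lambda>x. x i) \<in> borel_measurable (H_borel I w)"
\<comment> \<open>A single term \<open>w i * (x i - y i)^2\<close> is at most the squared distance,
  which yields the Lipschitz constant \<open>1 / sqrt (w i)\<close>.\<close>
proof (rule lipschitz_measurable_H_borel[of "1 / sqrt (w i)"])
  fix x y assume "x \<in> H_space I w" "y \<in> H_space I w"
  from sum_le_H_norm[of I w _ "{i}", OF w_pos H_space_diff[of I w, OF w_pos this]] i
  have "w i * (x i - y i)\<^sup>2 \<le> (H_dist I w x y)\<^sup>2" by (simp add: H_dist_def)
  then have "sqrt (w i) * \<bar>x i - y i\<bar> \<le> sqrt ((H_dist I w x y)\<^sup>2)"
    using real_sqrt_le_mono by (fastforce simp: real_sqrt_mult)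
  also have "\<dots> = H_dist I w x y" by (simp add: H_dist_def H_norm_nonneg[of I w, OF w_pos])
  finally show "\<bar>x i - y i\<bar> \<le> 1 / sqrt (w i) * H_dist I w x y"
    using w_pos[OF i] by (simp add: field_simps)
qed (use w_pos[OF i] in auto)

text \<open>On \<open>H_space\<close> the map \<open>to_H\<close> is the identity, so composing with
  it changes nothing. Measurability into \<open>H_borel\<close> is thereby reduced to measurability
  of each coordinate.\<close>

lemma measurable_into_H_borel:
  assumes I: "countable I"
    and f: "f \<in> M \<rightarrow>\<^sub>M PiM I (\<lambda>i. borel)" "\<And>x. x \<in> space M \<Longrightarrow> f x \<in> H_space I w"
  shows "f \<in> M \<rightarrow>\<^sub>M H_borel I w"
proof -
  have "(\<lambda>x. to_H I w (f x)) \<in> M \<rightarrow>\<^sub>M H_borel I w"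
    using measurable_to_H[of I w, OF w_pos I] f(1) by (rule measurable_compose[rotated])
  then show ?thesis
    by (rule measurable_cong[THEN iffD1, rotated]) (simp add: to_H_def f(2))
qed

lemma measurable_coordinatewise_H_borel:
  assumes I: "countable I" and T: "\<And>i. i \<in> I \<Longrightarrow> T i \<in> borel_measurable borel"
    and H: "\<And>x. x \<in> H_space I w \<Longrightarrow> (\<lambda>i\<in>I. T i (x i)) \<in> H_space I w"
  shows "(\<lambda>x. \<lambda>i\<in>I. T i (x i)) \<in> H_borel I w \<rightarrow>\<^sub>M H_borel I w"
proof (rule measurable_into_H_borel[OF I])
  show "(\<lambda>x. \<lambda>i\<in>I. T i (x i)) \<in> H_borel I w \<rightarrow>\<^sub>M PiM I (\<lambda>i. borel)"
  proof (rule measurable_restrict)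
    fix i assume "i \<in> I"
    from measurable_compose[OF measurable_H_component[OF this] T[OF this]]
    show "(\<lambda>x. T i (x i)) \<in> H_borel I w \<rightarrow>\<^sub>M borel" .
  qed
qed (auto simp: space_H_borel[of I w, OF w_pos] H)

lemma BL_ball_measurable:
  assumes "u \<in> BL_ball (H_space I w) (H_dist I w)"
  shows "u \<in> borel_measurable (H_borel I w)"
  using assms unfolding BL_ball_def by (blast intro: lipschitz_measurable_H_borel)

end

lemma BL_ballD:
  assumes "u \<in> BL_ball X d" "x \<in> X" "y \<in> X" "0 \<le> d x y"
  shows "\<bar>u x\<bar> \<le> 1" "\<bar>u x - u y\<bar> \<le> d x y"
proof -
  obtain A B where AB: "0 \<le> A" "0 \<le> B" "A + B \<le> 1" "\<And>x. x \<in> X \<Longrightarrow> \<bar>u x\<bar> \<le> A"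
    "\<And>x y. x \<in> X \<Longrightarrow> y \<in> X \<Longrightarrow> \<bar>u x - u y\<bar> \<le> B * d x y"
    using assms(1) by (auto simp: BL_ball_def)
  show "\<bar>u x\<bar> \<le> 1" using AB(1-3) AB(4)[OF assms(2)] by linarith
  have "B * d x y \<le> 1 * d x y" using AB(1-3) assms(4) by (intro mult_right_mono) auto
  then show "\<bar>u x - u y\<bar> \<le> d x y" using AB(5)[OF assms(2,3)] by simp
qed

text \<open>An enumeration of an infinite countable \<open>I\<close> turns the integral into a
  series over \<open>nat\<close>.\<close>

lemma measurable_nn_integral_count_space:
  fixes f :: "'i \<Rightarrow> 'a \<Rightarrow> ennreal"
  assumes "countable I" and [measurable]: "\<And>i. i \<in> I \<Longrightarrow> f i \<in> borel_measurable M"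
  shows "(\<lambda>x. \<integral>\<^sup>+i. f i x \<partial>count_space I) \<in> borel_measurable M"
proof cases
  assume "finite I" then show ?thesis by (simp add: nn_integral_count_space_finite)
next
  assume "infinite I"
  then have [simp]: "I \<noteq> {}" by auto
  note * = bij_betw_from_nat_into[OF \<open>countable I\<close> \<open>infinite I\<close>]
  have "(\<integral>\<^sup>+i. f i x \<partial>count_space I) = (\<Sum>n. f (from_nat_into I n) x)" for x
    by (simp add: nn_integral_bij_count_space[symmetric, OF *] nn_integral_count_space_nat)
  then show ?thesis by (simp add: from_nat_into)
qed

section \<open>Second moments under a product measure\<close>

context
  fixes I :: "'i set" and w :: "'i \<Rightarrow> real" and M :: "'i \<Rightarrow> real measure"
  assumes I: "countable I" and w_pos: "\<And>i. i \<in> I \<Longrightarrow> 0 < w i"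
    and M: "\<And>i. i \<in> I \<Longrightarrow> prob_space (M i)" "\<And>i. i \<in> I \<Longrightarrow> sets (M i) = sets borel"
begin

lemma nn_integral_PiM_component:
  assumes "i \<in> I" "f \<in> borel_measurable borel"
  shows "(\<integral>\<^sup>+x. f (x i) \<partial>PiM I M) = (\<integral>\<^sup>+t. f t \<partial>M i)"
proof -
  have f: "f \<in> borel_measurable (M i)" using assms M(2) by (simp cong: measurable_cong_sets)
  have "(\<integral>\<^sup>+x. f (x i) \<partial>PiM I M) = (\<integral>\<^sup>+t. f t \<partial>distr (PiM I M) (M i) (\<lambda>x. x i))"
    by (subst nn_integral_distr) (use assms f in auto)
  then show ?thesis using distr_PiM_component[of I M i, OF M(1) assms(1)] by simp
qed

lemma nn_integral_PiM_weighted: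
  assumes J: "J \<subseteq> I"
  shows "(\<integral>\<^sup>+x. (\<integral>\<^sup>+i. ennreal (w i * (x i)\<^sup>2) \<partial>count_space J) \<partial>PiM I M)
    = (\<integral>\<^sup>+i. ennreal (w i) * (\<integral>\<^sup>+t. ennreal (t\<^sup>2) \<partial>M i) \<partial>count_space J)"
proof -
  have m: "(\<lambda>x. ennreal (w i * (x i)\<^sup>2)) \<in> borel_measurable (PiM I M)" if "i \<in> J" for i
  proof -
    have "(\<lambda>x. x i) \<in> PiM I M \<rightarrow>\<^sub>M M i" using that J by (intro measurable_component_singleton) auto
    then have [measurable]: "(\<lambda>x. x i) \<in> borel_measurable (PiM I M)"
      using that J M(2)[of i] by (auto cong: measurable_cong_sets)
    show ?thesis by measurable
  qed
  have "(\<integral>\<^sup>+x. (\<integral>\<^sup>+i. ennreal (w i * (x i)\<^sup>2) \<partial>count_space J) \<partial>PiM I M)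
     = (\<integral>\<^sup>+i. (\<integral>\<^sup>+x. ennreal (w i * (x i)\<^sup>2) \<partial>PiM I M) \<partial>count_space J)"
    by (rule nn_integral_count_space_nn_integral) (use m countable_subset[OF J I] in auto)
  also have "\<dots> = (\<integral>\<^sup>+i. ennreal (w i) * (\<integral>\<^sup>+t. ennreal (t\<^sup>2) \<partial>M i) \<partial>count_space J)"
  proof (intro nn_integral_cong)
    fix i assume "i \<in> space (count_space J)"
    then have i: "i \<in> I" using J by auto
    have "(\<integral>\<^sup>+x. ennreal (w i * (x i)\<^sup>2) \<partial>PiM I M) = (\<integral>\<^sup>+t. ennreal (w i * t\<^sup>2) \<partial>M i)"
      by (rule nn_integral_PiM_component[OF i]) simp
    also have "\<dots> = (\<integral>\<^sup>+t. ennreal (w i) * ennreal (t\<^sup>2) \<partial>M i)"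
      using w_pos[OF i] by (intro nn_integral_cong) (simp add: ennreal_mult)
    also have "\<dots> = ennreal (w i) * (\<integral>\<^sup>+t. ennreal (t\<^sup>2) \<partial>M i)"
      by (rule nn_integral_cmult) (use M(2)[OF i] in \<open>simp cong: measurable_cong_sets\<close>)
    finally show "(\<integral>\<^sup>+x. ennreal (w i * (x i)\<^sup>2) \<partial>PiM I M) = ennreal (w i) * (\<integral>\<^sup>+t. ennreal (t\<^sup>2) \<partial>M i)" .
  qed
  finally show ?thesis .
qed

text \<open>A nonnegative variable with finite mean is finite almost surely, so the weighted sum off
  \<open>F\<close> converges. The coordinates in \<open>F\<close> add a finite sum whatever their
  moments are, which is why the moment condition concerns \<open>I - F\<close> only.\<close>

lemma AE_PiM_H_space:
  assumes F: "finite F" "F \<subseteq> I"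
    and fin: "(\<integral>\<^sup>+i. ennreal (w i) * (\<integral>\<^sup>+t. ennreal (t\<^sup>2) \<partial>M i) \<partial>count_space (I - F)) < \<infinity>"
  shows "AE x in PiM I M. x \<in> H_space I w"
proof -
  let ?q = "\<lambda>x. \<integral>\<^sup>+i. ennreal (w i * (x i)\<^sup>2) \<partial>count_space (I - F)"
  have sM: "sets (PiM I M) = sets (PiM I (\<lambda>i. borel))" by (rule sets_PiM_borel[OF M(2)])
  have "?q \<in> borel_measurable (PiM I (\<lambda>i. borel))"
    using I by (intro measurable_nn_integral_count_space) auto
  then have "?q \<in> borel_measurable (PiM I M)" by (simp cong: measurable_cong_sets add: sM)
  then have "AE x in PiM I M. ?q x \<noteq> \<infinity>"
    using fin by (intro nn_integral_PInf_AE) (simp_all add: nn_integral_PiM_weighted)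
  with AE_space show ?thesis
  proof eventually_elim
    case (elim x)
    have "?q x < \<infinity>" using elim(2) by (simp add: less_top)
    then have "(\<integral>\<^sup>+i. ennreal (w i * (x i)\<^sup>2) \<partial>count_space I) < \<infinity>"
      unfolding nn_integral_count_space_split[OF F] by (simp add: F)
    then show ?case
      using elim(1) by (intro H_space_nn_integral w_pos) (auto simp: space_PiM PiE_iff)
  qed
qed

end

section \<open>Truncation to finitely many coordinates\<close>

definition truncate :: "'i set \<Rightarrow> 'i set \<Rightarrow> ('i \<Rightarrow> real) \<Rightarrow> 'i \<Rightarrow> real" where
  "truncate I F x = (\<lambda>i\<in>I. if i \<in> F then x i else 0)"

lemma truncate_in_H_space:
  assumes "\<And>i. i \<in> I \<Longrightarrow> 0 < w i" "finite F" "F \<subseteq> I"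
  shows "truncate I F x \<in> H_space I w"
proof (rule H_space_nn_integral)
  have "(\<integral>\<^sup>+i. ennreal (w i * (truncate I F x i)\<^sup>2) \<partial>count_space (I - F)) = (\<integral>\<^sup>+i. 0 \<partial>count_space (I - F))"
    by (intro nn_integral_cong) (auto simp: truncate_def)
  then show "(\<integral>\<^sup>+i. ennreal (w i * (truncate I F x i)\<^sup>2) \<partial>count_space I) < \<infinity>"
    unfolding nn_integral_count_space_split[OF assms(2,3)] by (simp add: assms)
qed (auto simp: truncate_def assms)

lemma measurable_truncate:
  assumes "countable I" "\<And>i. i \<in> I \<Longrightarrow> 0 < w i" "finite F" "F \<subseteq> I"
  shows "truncate I F \<in> PiM I (\<lambda>i. borel) \<rightarrow>\<^sub>M H_borel I w"
proof (rule measurable_into_H_borel)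
  show "truncate I F \<in> PiM I (\<lambda>i. borel) \<rightarrow>\<^sub>M PiM I (\<lambda>i. borel)"
    unfolding truncate_def by (intro measurable_restrict) auto
qed (use assms in \<open>auto intro: truncate_in_H_space\<close>)

lemma H_dist_truncate:
  assumes w: "\<And>i. i \<in> I \<Longrightarrow> 0 < w i" and F: "finite F" "F \<subseteq> I" and x: "x \<in> H_space I w"
  shows "ennreal ((H_dist I w x (truncate I F x))\<^sup>2) = (\<integral>\<^sup>+i. ennreal (w i * (x i)\<^sup>2) \<partial>count_space (I - F))"
proof -
  have "ennreal ((H_dist I w x (truncate I F x))\<^sup>2)
      = (\<integral>\<^sup>+i. ennreal (w i * ((\<lambda>i\<in>I. x i - truncate I F x i) i)\<^sup>2) \<partial>count_space I)"
    unfolding H_dist_def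
    by (intro H_norm_power2_nn_integral w H_space_diff x truncate_in_H_space F)
  also have "\<dots> = (\<integral>\<^sup>+i. ennreal (w i * ((\<lambda>i\<in>I. x i - truncate I F x i) i)\<^sup>2) \<partial>count_space (I - F))"
    unfolding nn_integral_count_space_split[OF F] using F(2) by (auto simp: truncate_def intro!: sum.neutral)
  also have "\<dots> = (\<integral>\<^sup>+i. ennreal (w i * (x i)\<^sup>2) \<partial>count_space (I - F))"
    by (intro nn_integral_cong) (auto simp: truncate_def)
  finally show ?thesis .
qed

context
  fixes I :: "'i set" and w :: "'i \<Rightarrow> real" and u :: "('i \<Rightarrow> real) \<Rightarrow> real" and F :: "'i set" and s :: real
  assumes I: "countable I" and w_pos: "\<And>i. i \<in> I \<Longrightarrow> 0 < w i"
    and u: "u \<in> BL_ball (H_space I w) (H_dist I w)"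
    and F: "finite F" "F \<subseteq> I" and s: "0 < s"
begin

text \<open>Truncation moves \<open>x\<close> by some distance \<open>d\<close>, hence the test
  function by at most \<open>d\<close>, and \<open>d \<le> s + d^2 / s\<close>. The mean of
  \<open>d^2\<close> is the weighted tail of second moments. A bound linear in this tail, rather
  than in its square root, can later be averaged over the data by Tonelli's theorem.\<close>

lemma H_law_truncate_bound:
  fixes M :: "'i \<Rightarrow> real measure"
  assumes M: "\<And>i. i \<in> I \<Longrightarrow> prob_space (M i)" "\<And>i. i \<in> I \<Longrightarrow> sets (M i) = sets borel"
    and fin: "(\<integral>\<^sup>+i. ennreal (w i) * (\<integral>\<^sup>+t. ennreal (t\<^sup>2) \<partial>M i) \<partial>count_space (I - F)) < \<infinity>"
  shows "ennreal \<bar>(\<integral>x. u x \<partial>H_law I w (PiM I M)) - (\<integral>x. u (truncate I F x) \<partial>PiM I M)\<bar>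
    \<le> ennreal s + ennreal (1 / s) *
        (\<integral>\<^sup>+i. ennreal (w i) * (\<integral>\<^sup>+t. ennreal (t\<^sup>2) \<partial>M i) \<partial>count_space (I - F))"
proof -
  interpret P: prob_space "PiM I M" by (rule prob_space_PiM[OF M(1)])
  interpret H: Metric_space "H_space I w" "H_dist I w" by (rule Metric_space_H) (rule w_pos)
  let ?q = "\<lambda>x. \<integral>\<^sup>+i. ennreal (w i * (x i)\<^sup>2) \<partial>count_space (I - F)"
  have sM: "sets (PiM I M) = sets (PiM I (\<lambda>i. borel))" by (rule sets_PiM_borel[OF M(2)])
  have u_meas: "u \<in> borel_measurable (H_borel I w)" by (rule BL_ball_measurable[OF w_pos u])
  have toH: "to_H I w \<in> PiM I M \<rightarrow>\<^sub>M H_borel I w"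
    using measurable_to_H[of I w, OF w_pos I] by (simp cong: measurable_cong_sets add: sM)
  have tr: "truncate I F \<in> PiM I M \<rightarrow>\<^sub>M H_borel I w"
    using measurable_truncate[OF I w_pos F] by (simp cong: measurable_cong_sets add: sM)
  have toH_in: "to_H I w x \<in> H_space I w" for x
    by (auto simp: to_H_def zero_in_H_space[of I w, OF w_pos])
  have tr_in: "truncate I F x \<in> H_space I w" for x by (rule truncate_in_H_space[OF w_pos F])
  have int1: "integrable (PiM I M) (\<lambda>x. u (to_H I w x))"
    by (rule P.integrable_const_bound[where B = 1])
      (use measurable_compose[OF toH u_meas] BL_ballD(1)[OF u toH_in toH_in H.nonneg] in auto)
  have int2: "integrable (PiM I M) (\<lambda>x. u (truncate I F x))"
    by (rule P.integrable_const_bound[where B = 1])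
      (use measurable_compose[OF tr u_meas] BL_ballD(1)[OF u tr_in tr_in H.nonneg] in auto)
  \<comment> \<open>Almost every point lies in the space, so the default value of
    \<open>to_H\<close> does not enter the integrals.\<close>
  have AE: "AE x in PiM I M. x \<in> H_space I w" by (rule AE_PiM_H_space[OF I w_pos M F fin])
  have "?q \<in> borel_measurable (PiM I (\<lambda>i. borel))"
    using I by (intro measurable_nn_integral_count_space) auto
  then have q_meas: "?q \<in> borel_measurable (PiM I M)" by (simp cong: measurable_cong_sets add: sM)
  have "(\<integral>x. u x \<partial>H_law I w (PiM I M)) = (\<integral>x. u (to_H I w x) \<partial>PiM I M)"
    unfolding H_law_def by (rule integral_distr[OF toH u_meas])
  then have "(\<integral>x. u x \<partial>H_law I w (PiM I M)) - (\<integral>x. u (truncate I F x) \<partial>PiM I M)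
      = (\<integral>x. u (to_H I w x) - u (truncate I F x) \<partial>PiM I M)"
    using int1 int2 by simp
  then have "ennreal \<bar>(\<integral>x. u x \<partial>H_law I w (PiM I M)) - (\<integral>x. u (truncate I F x) \<partial>PiM I M)\<bar>
      \<le> (\<integral>\<^sup>+x. norm (u (to_H I w x) - u (truncate I F x)) \<partial>PiM I M)"
    using integral_norm_bound_ennreal[OF Bochner_Integration.integrable_diff[OF int1 int2]] by simp
  also have "\<dots> \<le> (\<integral>\<^sup>+x. ennreal s + ennreal (1 / s) * ?q x \<partial>PiM I M)"
  proof (rule nn_integral_mono_AE)
    show "AE x in PiM I M. ennreal (norm (u (to_H I w x) - u (truncate I F x))) \<le> ennreal s + ennreal (1 / s) * ?q x"
      using AE
    proof eventually_elim
      case (elim x)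
      let ?d = "H_dist I w x (truncate I F x)"
      have "?d \<le> s + 1 / s * ?d\<^sup>2"
      proof (cases "?d \<le> s")
        case True
        then show ?thesis using s by (intro add_increasing2) auto
      next
        case False
        then have "s * ?d \<le> ?d * ?d" by (intro mult_right_mono) auto
        then have "?d \<le> 1 / s * ?d\<^sup>2" using s by (simp add: field_simps power2_eq_square)
        then show ?thesis using s by linarith
      qed
      moreover have "\<bar>u x - u (truncate I F x)\<bar> \<le> ?d"
        by (rule BL_ballD(2)[OF u elim tr_in H.nonneg])
      ultimately have "ennreal \<bar>u x - u (truncate I F x)\<bar> \<le> ennreal (s + 1 / s * ?d\<^sup>2)"
        by (intro ennreal_leI) linarith
      also have "\<dots> = ennreal s + ennreal (1 / s) * ennreal (?d\<^sup>2)"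
        using s by (subst ennreal_plus) (auto simp: ennreal_mult'[symmetric])
      finally show ?case using elim by (simp add: to_H_def H_dist_truncate[OF w_pos F elim])
    qed
  qed
  also have "\<dots> = ennreal s + ennreal (1 / s) * (\<integral>\<^sup>+x. ?q x \<partial>PiM I M)"
    using q_meas by (simp add: nn_integral_add nn_integral_cmult P.emeasure_space_1)
  also have "(\<integral>\<^sup>+x. ?q x \<partial>PiM I M)
      = (\<integral>\<^sup>+i. ennreal (w i) * (\<integral>\<^sup>+t. ennreal (t\<^sup>2) \<partial>M i) \<partial>count_space (I - F))"
    by (rule nn_integral_PiM_weighted[OF I w_pos M]) auto
  finally show ?thesis .
qed

text \<open>Four laws are linked: each product is replaced by its truncation at the cost of a tail
  term, and the two truncations differ only through the coordinates in \<open>F\<close>, which are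
  exchanged one by one.\<close>

lemma H_law_compare:
  fixes M N :: "'i \<Rightarrow> real measure"
  assumes M: "\<And>i. i \<in> I \<Longrightarrow> prob_space (M i)" "\<And>i. i \<in> I \<Longrightarrow> sets (M i) = sets borel"
    and N: "\<And>i. i \<in> I \<Longrightarrow> prob_space (N i)" "\<And>i. i \<in> I \<Longrightarrow> sets (N i) = sets borel"
    and D: "\<And>i f. i \<in> F \<Longrightarrow> f \<in> borel_measurable borel \<Longrightarrow> (\<And>t. \<bar>f t\<bar> \<le> 1) \<Longrightarrow>
      ennreal \<bar>(\<integral>t. f t \<partial>M i) - (\<integral>t. f t \<partial>N i)\<bar> \<le> D i"
    and finM: "(\<integral>\<^sup>+i. ennreal (w i) * (\<integral>\<^sup>+t. ennreal (t\<^sup>2) \<partial>M i) \<partial>count_space (I - F)) < \<infinity>" (is "?T M < \<infinity>")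
    and finN: "(\<integral>\<^sup>+i. ennreal (w i) * (\<integral>\<^sup>+t. ennreal (t\<^sup>2) \<partial>N i) \<partial>count_space (I - F)) < \<infinity>"
  shows "ennreal \<bar>(\<integral>x. u x \<partial>H_law I w (PiM I M)) - (\<integral>x. u x \<partial>H_law I w (PiM I N))\<bar>
    \<le> (ennreal s + ennreal (1 / s) * ?T M) + (\<Sum>i\<in>F. D i) + (ennreal s + ennreal (1 / s) * ?T N)"
proof -
  interpret H: Metric_space "H_space I w" "H_dist I w" by (rule Metric_space_H) (rule w_pos)
  let ?K = "\<lambda>i. if i \<in> F then N i else M i"
  let ?v = "\<lambda>x. u (truncate I F x)"
  have tr_in: "truncate I F x \<in> H_space I w" for x by (rule truncate_in_H_space[OF w_pos F])
  have u_meas: "u \<in> borel_measurable (H_borel I w)" by (rule BL_ball_measurable[OF w_pos u])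
  have v: "?v \<in> borel_measurable (PiM I (\<lambda>i. borel))" "\<bar>?v x\<bar> \<le> 1" for x
    using measurable_compose[OF measurable_truncate[OF I w_pos F] u_meas]
      BL_ballD(1)[OF u tr_in tr_in H.nonneg] by auto
  \<comment> \<open>The truncated test function sees only \<open>F\<close>, where \<open>?K\<close>
    and \<open>N\<close> coincide. Formally, the image under truncation turns every other marginal
    into the point mass at 0, so that the image products are equal.\<close>
  have eq: "(\<integral>x. ?v x \<partial>PiM I ?K) = (\<integral>x. ?v x \<partial>PiM I N)"
  proof -
    let ?R = "\<lambda>i t. if i \<in> F then t else (0::real)"
    have T: "?R i \<in> borel_measurable borel" for i by simp
    have expand: "(\<integral>x. ?v x \<partial>PiM I Q) = (\<integral>x. u x \<partial>distr (PiM I (\<lambda>i. distr (Q i) borel (?R i))) (H_borel I w) (\<lambda>x. truncate I F x))"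
      if Q: "\<And>i. i \<in> I \<Longrightarrow> prob_space (Q i)" "\<And>i. i \<in> I \<Longrightarrow> sets (Q i) = sets borel" for Q
    proof -
      have sQ: "sets (PiM I Q) = sets (PiM I (\<lambda>i. borel))" by (rule sets_PiM_borel[OF Q(2)])
      have trb: "truncate I F \<in> PiM I (\<lambda>i. borel) \<rightarrow>\<^sub>M PiM I (\<lambda>i. borel)"
        unfolding truncate_def by (intro measurable_restrict) auto
      have trQ: "truncate I F \<in> PiM I Q \<rightarrow>\<^sub>M PiM I (\<lambda>i. borel)"
        using trb by (simp cong: measurable_cong_sets add: sQ)
      \<comment> \<open>Idempotence allows a second truncation to be inserted, so that the integral
        can be read off the image law.\<close>
      have idem: "truncate I F (truncate I F x) = truncate I F x" for x
        by (auto simp: truncate_def)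
      have "PiM I (\<lambda>i. distr (Q i) borel (?R i)) = distr (PiM I Q) (PiM I (\<lambda>i. borel)) (truncate I F)"
        using distr_PiM_map[of I Q ?R, OF Q T] by (simp add: truncate_def[abs_def])
      then have "(\<integral>x. u x \<partial>distr (PiM I (\<lambda>i. distr (Q i) borel (?R i))) (H_borel I w) (truncate I F))
          = (\<integral>x. u x \<partial>distr (PiM I Q) (H_borel I w) (truncate I F \<circ> truncate I F))"
        by (simp add: distr_distr[OF measurable_truncate[OF I w_pos F] trQ])
      also have "truncate I F \<circ> truncate I F = truncate I F" by (auto simp: idem)
      also have "(\<integral>x. u x \<partial>distr (PiM I Q) (H_borel I w) (truncate I F)) = (\<integral>x. ?v x \<partial>PiM I Q)"
        using measurable_truncate[OF I w_pos F]
        by (intro integral_distr u_meas) (simp cong: measurable_cong_sets add: sQ)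
      finally show ?thesis ..
    qed
    have "distr (?K i) borel (?R i) = distr (N i) borel (?R i)" if i: "i \<in> I" for i
    proof (cases "i \<in> F")
      case False
      have "distr (Q i) borel (\<lambda>t. 0::real) = return borel 0" if "prob_space (Q i)" for Q :: "'i \<Rightarrow> real measure"
        using that by (intro prob_space.distr_const) auto
      then show ?thesis using False M(1)[OF i] N(1)[OF i] by simp
    qed simp
    then have "PiM I (\<lambda>i. distr (?K i) borel (?R i)) = PiM I (\<lambda>i. distr (N i) borel (?R i))"
      by (intro PiM_cong refl)
    then show ?thesis using expand[of ?K] expand[of N] M N by simp
  qed
  have 1: "ennreal \<bar>(\<integral>x. ?v x \<partial>PiM I M) - (\<integral>x. ?v x \<partial>PiM I N)\<bar> \<le> (\<Sum>i\<in>F. D i)"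
    unfolding eq[symmetric] by (rule integral_PiM_replace_bound) (fact M N F v | erule D; assumption)+
  let ?a = "\<integral>x. u x \<partial>H_law I w (PiM I M)" and ?b = "\<integral>x. ?v x \<partial>PiM I M"
    and ?c = "\<integral>x. ?v x \<partial>PiM I N" and ?d = "\<integral>x. u x \<partial>H_law I w (PiM I N)"
  have tri: "\<bar>a - d\<bar> \<le> \<bar>a - b\<bar> + \<bar>b - c\<bar> + \<bar>d - c\<bar>" for a b c d :: real by linarith
  have "ennreal \<bar>?a - ?d\<bar> \<le> ennreal (\<bar>?a - ?b\<bar> + \<bar>?b - ?c\<bar> + \<bar>?d - ?c\<bar>)"
    by (rule ennreal_leI[OF tri])
  also have "\<dots> = ennreal \<bar>?a - ?b\<bar> + ennreal \<bar>?b - ?c\<bar> + ennreal \<bar>?d - ?c\<bar>"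
    by simp
  also have "\<dots> \<le> (ennreal s + ennreal (1 / s) * ?T M) + (\<Sum>i\<in>F. D i) + (ennreal s + ennreal (1 / s) * ?T N)"
    by (intro add_mono 1 H_law_truncate_bound M N finM finN)
  finally show ?thesis .
qed

end

subsection \<open>Summability of the weights\<close>

text \<open>The integers are covered by two copies of \<open>nat\<close>, on each of which the
  absolute value gives back the index.\<close>

lemma summable_on_int_abs:
  fixes f :: "nat \<Rightarrow> real"
  assumes "\<And>n. 0 \<le> f n" "summable f"
  shows "(\<lambda>l::int. f (nat \<bar>l\<bar>)) summable_on A"
proof -
  have f: "f summable_on UNIV" using assms by (simp add: summable_on_UNIV_nonneg_real_iff)
  have "(\<lambda>l::int. f (nat \<bar>l\<bar>)) summable_on range int"
    by (subst summable_on_reindex) (auto simp: comp_def f)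
  moreover have "(\<lambda>l::int. f (nat \<bar>l\<bar>)) summable_on range (\<lambda>n. - int n)"
    by (subst summable_on_reindex) (auto simp: comp_def f inj_on_def)
  ultimately have "(\<lambda>l::int. f (nat \<bar>l\<bar>)) summable_on range int \<union> range (\<lambda>n. - int n)"
    by (rule summable_on_union)
  moreover have "range int \<union> range (\<lambda>n. - int n) = UNIV"
  proof (intro equalityI subset_UNIV subsetI)
    fix l :: int
    show "l \<in> range int \<union> range (\<lambda>n. - int n)" by (cases l rule: int_cases2) auto
  qed
  ultimately show ?thesis using summable_on_subset_banach by (metis subset_UNIV)
qed

lemma summable_scaled_powr:
  assumes "1 < (s::real)" "0 < c"
  shows "summable (\<lambda>n. (real n * c) powr (- s))"
proof -
  have "summable (\<lambda>n. real n powr (- s))" using assms by (simp add: summable_real_powr_iff)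
  from summable_mult2[OF this, of "c powr (- s)"]
  show ?thesis using assms by (simp add: powr_mult)
qed

text \<open>Cauchy condensation removes the factor \<open>1 / n\<close> and turns the logarithm into
  a multiple of \<open>n\<close>, leaving a convergent power series of exponent \<open>- s\<close>.
  The form \<open>max 2 n\<close> is that of the characteristic sequence with one function per
  level, and it keeps the logarithm positive.\<close>

lemma summable_inverse_ln_powr:
  assumes "1 < (s::real)"
  shows "summable (\<lambda>n. inverse (max 2 (real n)) * ln (max 2 (real n)) powr (- s))" (is "summable ?f")
proof -
  have "?f (Suc m) \<le> ?f m" for m
  proof -
    let ?a = "max 2 (real m)" and ?b = "max 2 (real (Suc m))"
    have ab: "2 \<le> ?a" "?a \<le> ?b" by auto
    have "0 < ln ?a" using ab by (intro ln_gt_zero) auto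
    moreover have "ln ?a \<le> ln ?b" using ab by (intro ln_mono) auto
    ultimately have "ln ?b powr (- s) \<le> ln ?a powr (- s)" using assms by (intro powr_mono2') auto
    moreover have "inverse ?b \<le> inverse ?a" using ab by (intro le_imp_inverse_le) auto
    ultimately show ?thesis using ab by (intro mult_mono) auto
  qed
  moreover have "0 \<le> ?f m" for m by simp
  ultimately have "summable ?f \<longleftrightarrow> summable (\<lambda>n. 2 ^ n * ?f (2 ^ n))"
    by (rule condensation_test)
  also have "\<dots> \<longleftrightarrow> summable (\<lambda>n. (real n * ln 2) powr (- s))"
  proof (rule summable_cong)
    \<comment> \<open>The identity starts at \<open>n = 1\<close>, because
      \<open>max 2 (2 ^ 0)\<close> is 2 and not 1.\<close>
    show "\<forall>\<^sub>F n in sequentially. 2 ^ n * ?f (2 ^ n) = (real n * ln 2) powr (- s)"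
      using eventually_ge_at_top[of 1]
    proof eventually_elim
      case (elim n)
      have "(2::real) ^ 1 \<le> 2 ^ n" using elim by (intro power_increasing) auto
      then have "max 2 (real (2 ^ n)) = 2 ^ n" by simp
      then show ?case by (simp add: ln_realpow)
    qed
  qed
  finally show ?thesis using summable_scaled_powr[OF assms, of "ln 2"] by simp
qed

text \<open>The weights are summed level by level. With one function per level, the condensation
  result applies. With \<open>2 ^ l\<close> functions, their number cancels
  \<open>inverse (a l)\<close> and leaves \<open>(l * ln 2) powr (- 2 * \<delta>)\<close>. In both
  cases \<open>2 * \<delta> > 1\<close> gives convergence.\<close>

lemma H_weight_summable:
  assumes "regular_basis S L Z a \<psi>" "1 / 2 < \<delta>"
  shows "H_weight a \<delta> summable_on Sigma L Z"
proof -
  have s: "1 < 2 * \<delta>" using assms(2) by simp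
  define g where "g l = real (card (Z l)) * (inverse (a l) * ln (a l) powr (- (2 * \<delta>)))" for l
  have *: "finite (Z l) \<and> 0 < a l" if "l \<in> L" for l
    using assms(1) that unfolding regular_basis_def
    by (auto intro!: card_ge_0_finite simp: of_int_max)
  have "g summable_on L"
    using assms(1) unfolding regular_basis_def
  proof (elim conjE disjE)
    assume a: "\<forall>l\<in>L. card (Z l) = 1 \<and> a l = real_of_int (max 2 \<bar>l\<bar>)"
    have "(\<lambda>l::int. (\<lambda>n. inverse (max 2 (real n)) * ln (max 2 (real n)) powr (- (2 * \<delta>))) (nat \<bar>l\<bar>)) summable_on L"
      by (intro summable_on_int_abs summable_inverse_ln_powr s) auto
    then show ?thesis
      by (rule summable_on_cong[THEN iffD1, rotated]) (use a in \<open>simp add: g_def of_int_max\<close>)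
  next
    assume L: "L \<subseteq> {1..}" and a: "\<forall>l\<in>L. a l = real (card (Z l)) \<and> card (Z l) = 2 ^ nat l"
    have "(\<lambda>l::int. (\<lambda>n. (real n * ln 2) powr (- (2 * \<delta>))) (nat \<bar>l\<bar>)) summable_on L"
      by (intro summable_on_int_abs summable_scaled_powr s) auto
    then show ?thesis
    proof (rule summable_on_cong[THEN iffD1, rotated])
      fix l assume "l \<in> L"
      then have "0 \<le> l" "a l = 2 ^ nat l" "card (Z l) = 2 ^ nat l" using a L by auto
      then show "(\<lambda>n. (real n * ln 2) powr (- (2 * \<delta>))) (nat \<bar>l\<bar>) = g l"
        by (simp add: g_def ln_realpow)
    qed
  qed
  then show ?thesis
  proof (rule summable_on_SigmaI[rotated])
    fix l assume l: "l \<in> L"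
    have "(\<Sum>k\<in>Z l. H_weight a \<delta> (l, k)) = g l" by (simp add: H_weight_def g_def)
    then show "((\<lambda>k. H_weight a \<delta> (l, k)) has_sum g l) (Z l)"
      using has_sum_finite[of "Z l" "\<lambda>k. H_weight a \<delta> (l, k)"] *[OF l] by simp
    show "0 \<le> H_weight a \<delta> (l, k)" for k using *[OF l] by (simp add: H_weight_def)
  qed
qed

lemma summable_on_nn_integral_tail:
  fixes w :: "'i \<Rightarrow> real"
  assumes w: "w summable_on I" "\<And>i. i \<in> I \<Longrightarrow> 0 \<le> w i" and e: "0 < e"
  obtains F where "finite F" "F \<subseteq> I" "(\<integral>\<^sup>+i. ennreal (w i) \<partial>count_space (I - F)) \<le> ennreal e"
proof -
  obtain F where F: "finite F" "F \<subseteq> I" "dist (sum w F) (infsum w I) \<le> e"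
    using infsum_finite_approximation[OF w(1) e] by blast
  have wt: "w summable_on (I - F)" using w(1) by (rule summable_on_subset_banach) auto
  have "infsum w I = infsum w (I - F) + sum w F"
    using infsum_Un_disjoint[of w "I - F" F] wt F by (simp add: Un_absorb2 Diff_disjoint Int_commute)
  then have "infsum w (I - F) \<le> e" using F(3) by (simp add: dist_real_def)
  moreover have "ennreal (infsum w (I - F)) = (\<integral>\<^sup>+i. ennreal (w i) \<partial>count_space (I - F))"
    by (rule ennreal_infsum[OF wt]) (use w(2) in auto)
  ultimately have "(\<integral>\<^sup>+i. ennreal (w i) \<partial>count_space (I - F)) \<le> ennreal e"
    by (metis ennreal_leI)
  then show ?thesis using that F by blast
qed

section \<open>Bounding the distance between two laws\<close>

lemma BL_dist_le:
  assumes b: "b < \<infinity>" and u: "\<And>u. u \<in> BL_ball X d \<Longrightarrow> ennreal \<bar>(\<integral>x. u x \<partial>\<mu>) - (\<integral>x. u x \<partial>\<nu>)\<bar> \<le> b"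
    and d: "\<And>x y. 0 \<le> d x y"
  shows "ennreal \<bar>BL_dist X d \<mu> \<nu>\<bar> \<le> b"
proof -
  \<comment> \<open>\<open>BL_dist\<close> is a supremum of reals, so the bound has to be a real
    number. The zero function makes the set of test functions nonempty and the supremum
    nonnegative.\<close>
  obtain r where r: "b = ennreal r" "0 \<le> r" using b by (cases b) auto
  have le: "\<bar>(\<integral>x. u x \<partial>\<mu>) - (\<integral>x. u x \<partial>\<nu>)\<bar> \<le> r" if "u \<in> BL_ball X d" for u
    using u[OF that] r by simp
  have 0: "(\<lambda>_. 0) \<in> BL_ball X d" using d by (auto simp: BL_ball_def intro!: exI[of _ 0])
  have "BL_dist X d \<mu> \<nu> \<le> r"
    unfolding BL_dist_def using 0 le by (intro cSUP_least) auto
  moreover have "0 \<le> BL_dist X d \<mu> \<nu>"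
    unfolding BL_dist_def using le by (intro cSUP_upper2[OF _ 0] bdd_aboveI2) auto
  ultimately show ?thesis using r by (simp add: ennreal_leI)
qed

text \<open>Connects \<open>coordinate_distance\<close> with the exchange of coordinates, whose
  hypothesis \<open>D\<close> speaks of test functions bounded by 1.\<close>

lemma integral_density_diff_bound:
  fixes q r f :: "real \<Rightarrow> real"
  assumes [measurable]: "q \<in> borel_measurable borel" "r \<in> borel_measurable borel" "f \<in> borel_measurable borel"
    and q: "\<And>x. 0 \<le> q x" "(\<integral>\<^sup>+x. ennreal (q x) \<partial>lborel) = 1"
    and r: "\<And>x. 0 \<le> r x" "(\<integral>\<^sup>+x. ennreal (r x) \<partial>lborel) = 1"
    and f: "\<And>x. \<bar>f x\<bar> \<le> 1"
  shows "ennreal \<bar>(\<integral>x. f x \<partial>density lborel (\<lambda>x. ennreal (q x))) - (\<integral>x. f x \<partial>density lborel (\<lambda>x. ennreal (r x)))\<bar>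
    \<le> (\<integral>\<^sup>+x. ennreal \<bar>q x - r x\<bar> \<partial>lborel)"
proof -
  have int: "integrable lborel (\<lambda>x. q x * f x)"
    if [measurable]: "q \<in> borel_measurable borel" and q: "\<And>x. 0 \<le> q x" "(\<integral>\<^sup>+x. ennreal (q x) \<partial>lborel) = 1" for q
  proof (rule Bochner_Integration.integrable_bound)
    show "integrable lborel q" using q by (intro integrableI_nonneg) auto
    show "AE x in lborel. norm (q x * f x) \<le> norm (q x)"
      using f q by (auto simp: abs_mult mult_left_le)
  qed simp
  have dens: "(\<integral>x. f x \<partial>density lborel (\<lambda>x. ennreal (q x))) = (\<integral>x. q x * f x \<partial>lborel)"
    if "q \<in> borel_measurable borel" "\<And>x. 0 \<le> q x" for q
    using that by (subst integral_density) auto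
  have "(\<integral>x. f x \<partial>density lborel (\<lambda>x. ennreal (q x))) - (\<integral>x. f x \<partial>density lborel (\<lambda>x. ennreal (r x)))
      = (\<integral>x. q x * f x - r x * f x \<partial>lborel)"
    using int[of q] int[of r] q r by (simp add: dens)
  also have "ennreal \<bar>\<dots>\<bar> \<le> (\<integral>\<^sup>+x. ennreal (norm (q x * f x - r x * f x)) \<partial>lborel)"
    using integral_norm_bound_ennreal[of lborel "\<lambda>x. q x * f x - r x * f x"] int[of q] int[of r] q r by simp
  also have "\<dots> \<le> (\<integral>\<^sup>+x. ennreal \<bar>q x - r x\<bar> \<partial>lborel)"
    using f by (intro nn_integral_mono ennreal_leI)
      (auto simp: left_diff_distrib[symmetric] abs_mult mult_left_le)
  finally show ?thesis .
qed

subsection \<open>Convergence for product priors\<close>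

text \<open>Markov's inequality for a function \<open>Y\<close> of unknown measurability: its event
  is first enlarged to one defined by the measurable majorant \<open>f\<close>.\<close>

lemma outer_measure_le_nn_integral:
  assumes f: "f \<in> borel_measurable M" and e: "0 < e"
    and le: "\<And>x. x \<in> space M \<Longrightarrow> ennreal \<bar>Y x\<bar> \<le> f x"
  shows "outer_measure_of M {x \<in> space M. e < \<bar>Y x\<bar>} \<le> ennreal (1 / e) * (\<integral>\<^sup>+x. f x \<partial>M)"
proof -
  let ?A = "{x \<in> space M. ennreal e \<le> f x}"
  have A: "?A \<in> sets M" using f by measurable
  have "outer_measure_of M {x \<in> space M. e < \<bar>Y x\<bar>} \<le> outer_measure_of M ?A"
  proof (rule outer_measure_of_mono, safe)
    fix x assume x: "x \<in> space M" "e < \<bar>Y x\<bar>"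
    then have "ennreal e \<le> ennreal \<bar>Y x\<bar>" by (intro ennreal_leI) simp
    then show "ennreal e \<le> f x" using le[OF x(1)] by (rule order.trans)
  qed
  also have "\<dots> = emeasure M {x \<in> space M. 1 \<le> ennreal (1 / e) * f x}"
  proof -
    have "ennreal e \<le> y \<longleftrightarrow> 1 \<le> ennreal (1 / e) * y" for y
    proof
      assume "ennreal e \<le> y"
      then have "ennreal (1 / e) * ennreal e \<le> ennreal (1 / e) * y" by (rule mult_left_mono) simp
      then show "1 \<le> ennreal (1 / e) * y" using e by (simp add: ennreal_mult'[symmetric])
    next
      assume "1 \<le> ennreal (1 / e) * y"
      then have "ennreal e * 1 \<le> ennreal e * (ennreal (1 / e) * y)" by (rule mult_left_mono) simp
      then show "ennreal e \<le> y" using e by (simp add: mult.assoc[symmetric] ennreal_mult'[symmetric])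
    qed
    then show ?thesis using A by (simp add: outer_measure_of_eq)
  qed
  also have "\<dots> \<le> ennreal (1 / e) * (\<integral>\<^sup>+x. f x * indicator (space M) x \<partial>M)"
    using nn_integral_Markov_inequality[of f "space M" M "ennreal (1 / e)"] f by simp
  also have "(\<integral>\<^sup>+x. f x * indicator (space M) x \<partial>M) = (\<integral>\<^sup>+x. f x \<partial>M)"
    by (intro nn_integral_cong) simp
  finally show ?thesis .
qed

abbreviation std_normal :: "real measure" where
  "std_normal \<equiv> density lborel (\<lambda>x. ennreal (std_normal_density x))"

text \<open>Separates the probabilistic argument from the basis. The index set is any countable set,
  and the particular prior enters later only through a moment bound and a limit for each
  coordinate.\<close>

locale product_posterior =
  fixes I :: "'i set" and w \<theta> :: "'i \<Rightarrow> real" and p :: "'i \<Rightarrow> real \<Rightarrow> real"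
  assumes I: "countable I" and w_pos: "\<And>i. i \<in> I \<Longrightarrow> 0 < w i" and w_sum: "w summable_on I"
    and theta: "\<theta> \<in> H_space I w"
    and p_meas: "\<And>i. i \<in> I \<Longrightarrow> p i \<in> borel_measurable borel"
    and p_nonneg: "\<And>i t. i \<in> I \<Longrightarrow> 0 \<le> p i t"
    and p_prob: "\<And>i. i \<in> I \<Longrightarrow> (\<integral>\<^sup>+t. ennreal (p i t) \<partial>lborel) = 1"
begin

definition rescaled_coordinate :: "nat \<Rightarrow> ('i \<Rightarrow> real) \<Rightarrow> 'i \<Rightarrow> real measure" where
  "rescaled_coordinate n X i =
    density lborel (\<lambda>h. ennreal (tilt (local_density (p i) (\<theta> i) n) (sqrt (real n) * (X i - \<theta> i)) h))"

definition coordinate_moment :: "nat \<Rightarrow> 'i \<Rightarrow> real \<Rightarrow> ennreal" where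
  "coordinate_moment n i e = (\<integral>\<^sup>+h. ennreal (h\<^sup>2 * tilt (local_density (p i) (\<theta> i) n) e h) \<partial>lborel)"

text \<open>For \<open>n > 0\<close> this is twice the total variation distance between the rescaled
  posterior of coordinate \<open>i\<close> and the standard normal law, when the noise has the value
  \<open>e\<close>.\<close>

definition coordinate_distance :: "nat \<Rightarrow> 'i \<Rightarrow> real \<Rightarrow> ennreal" where
  "coordinate_distance n i e =
    (\<integral>\<^sup>+h. ennreal \<bar>tilt (local_density (p i) (\<theta> i) n) e h - std_normal_density h\<bar> \<partial>lborel)"

lemma tilt_local_meas:
  assumes "i \<in> I"
  shows "tilt (local_density (p i) (\<theta> i) n) e \<in> borel_measurable borel"
proof -
  note [measurable] = measurable_tilt[OF measurable_local_density[OF p_meas[OF assms]]]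
  have "(\<lambda>h. tilt (local_density (p i) (\<theta> i) n) e h) \<in> borel_measurable borel" by measurable
  then show ?thesis .
qed

lemma tilt_local_nonneg: "i \<in> I \<Longrightarrow> 0 \<le> tilt (local_density (p i) (\<theta> i) n) e h"
  by (intro tilt_nonneg local_density_nonneg p_nonneg)

lemma nn_integral_tilt_local:
  "i \<in> I \<Longrightarrow> 0 < n \<Longrightarrow> (\<integral>\<^sup>+h. ennreal (tilt (local_density (p i) (\<theta> i) n) e h) \<partial>lborel) = 1"
  by (intro nn_integral_tilt measurable_local_density p_meas local_density_nonneg p_nonneg)
    (simp_all add: nn_integral_local_density p_meas p_prob)

lemma prob_space_rescaled_coordinate:
  "i \<in> I \<Longrightarrow> 0 < n \<Longrightarrow> prob_space (rescaled_coordinate n X i)"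
  using tilt_local_meas nn_integral_tilt_local
  by (intro prob_spaceI) (simp add: rescaled_coordinate_def emeasure_density)

lemma sets_rescaled_coordinate: "sets (rescaled_coordinate n X i) = sets borel"
  by (simp add: rescaled_coordinate_def)

lemma prob_space_std_normal: "prob_space std_normal"
  by (rule prob_space_normal_density) simp

lemma nn_integral_power2_std_normal: "(\<integral>\<^sup>+t. ennreal (t\<^sup>2) \<partial>std_normal) = 1"
  using nn_integral_std_normal_power2
  by (subst nn_integral_density) (simp_all add: ennreal_mult'[symmetric] mult.commute)

lemma nn_integral_power2_rescaled_coordinate:
  "i \<in> I \<Longrightarrow> (\<integral>\<^sup>+t. ennreal (t\<^sup>2) \<partial>rescaled_coordinate n X i)
    = coordinate_moment n i (sqrt (real n) * (X i - \<theta> i))"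
  using tilt_local_meas tilt_local_nonneg unfolding rescaled_coordinate_def coordinate_moment_def
  by (subst nn_integral_density) (simp_all add: ennreal_mult'[symmetric] mult.commute)

lemma measurable_coordinate_moment:
  assumes "i \<in> I" shows "coordinate_moment n i \<in> borel_measurable borel"
proof -
  note [measurable] = measurable_tilt[OF measurable_local_density[OF p_meas[OF assms]]]
  show ?thesis unfolding coordinate_moment_def by measurable
qed

lemma measurable_coordinate_distance:
  assumes "i \<in> I" shows "coordinate_distance n i \<in> borel_measurable borel"
proof -
  note [measurable] = measurable_tilt[OF measurable_local_density[OF p_meas[OF assms]]]
  show ?thesis unfolding coordinate_distance_def by measurable
qed

text \<open>The left side applies \<open>to_H\<close> before rescaling, the right side after it. The
  two orders agree almost surely once the posterior is carried by the space. The tail moment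
  condition places the rescaled point in the space almost surely, and undoing the affine map by
  \<open>X\<close> in the space does the same for the original point.\<close>

lemma rescaled_posterior_eq:
  assumes n: "0 < n" and X: "X \<in> H_space I w" and F: "finite F" "F \<subseteq> I"
    and fin: "(\<integral>\<^sup>+i. ennreal (w i) * coordinate_moment n i (sqrt (real n) * (X i - \<theta> i)) \<partial>count_space (I - F)) < \<infinity>"
  shows "distr (posterior I w p n X) (H_borel I w) (rescale I n X) = H_law I w (PiM I (rescaled_coordinate n X))"
proof -
  let ?K = "\<lambda>i. density lborel (\<lambda>t. ennreal (posterior_density n (p i) (X i) t))"
  have K: "prob_space (?K i)" "sets (?K i) = sets borel" if "i \<in> I" for i
    using measurable_space[OF posterior_coordinate(3)[OF n p_meas p_nonneg p_prob], of i "X i"] that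
    by (auto simp: space_prob_algebra)
  have sK: "sets (PiM I ?K) = sets (PiM I (\<lambda>i. borel))" by (rule sets_PiM_borel[OF K(2)])
  have R: "rescale I n X \<in> PiM I (\<lambda>i. borel) \<rightarrow>\<^sub>M PiM I (\<lambda>i. borel)"
    unfolding rescale_def by (intro measurable_restrict) auto
  have RK: "rescale I n X \<in> PiM I ?K \<rightarrow>\<^sub>M PiM I (\<lambda>i. borel)"
    using R by (simp cong: measurable_cong_sets add: sK)
  have R_in: "rescale I n X t \<in> H_space I w" if "t \<in> H_space I w" for t
  proof -
    from H_space_scale[OF w_pos H_space_diff[of I w, OF w_pos that X], of "sqrt n"]
    show ?thesis by (auto simp: rescale_def restrict_def cong: if_cong)
  qed
  have RH: "rescale I n X \<in> H_borel I w \<rightarrow>\<^sub>M H_borel I w"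
    unfolding rescale_def
    by (rule measurable_coordinatewise_H_borel[OF w_pos I]) (use R_in in \<open>auto simp: rescale_def\<close>)
  have toH: "to_H I w \<in> PiM I (\<lambda>i. borel) \<rightarrow>\<^sub>M H_borel I w"
    by (rule measurable_to_H[OF w_pos I])
  have toHK: "to_H I w \<in> PiM I ?K \<rightarrow>\<^sub>M H_borel I w"
    using toH by (simp cong: measurable_cong_sets add: sK)
  have eq: "PiM I (rescaled_coordinate n X) = distr (PiM I ?K) (PiM I (\<lambda>i. borel)) (rescale I n X)"
  proof -
    have "PiM I (rescaled_coordinate n X) = PiM I (\<lambda>i. distr (?K i) borel (\<lambda>t. sqrt (real n) * (t - X i)))"
      unfolding rescaled_coordinate_def
      by (intro PiM_cong refl distr_posterior_density[symmetric] p_meas n)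
    also have "\<dots> = distr (PiM I ?K) (PiM I (\<lambda>i. borel)) (\<lambda>x. \<lambda>i\<in>I. sqrt (real n) * (x i - X i))"
      by (rule distr_PiM_map[symmetric]) (use K in auto)
    finally show ?thesis by (simp add: rescale_def[abs_def])
  qed
  have "AE h in PiM I (rescaled_coordinate n X). h \<in> H_space I w"
  proof (rule AE_PiM_H_space[OF I w_pos _ _ F])
    have "(\<integral>\<^sup>+i. ennreal (w i) * (\<integral>\<^sup>+t. ennreal (t\<^sup>2) \<partial>rescaled_coordinate n X i) \<partial>count_space (I - F))
      = (\<integral>\<^sup>+i. ennreal (w i) * coordinate_moment n i (sqrt (real n) * (X i - \<theta> i)) \<partial>count_space (I - F))"
      by (intro nn_integral_cong) (simp add: nn_integral_power2_rescaled_coordinate)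
    then show "(\<integral>\<^sup>+i. ennreal (w i) * (\<integral>\<^sup>+t. ennreal (t\<^sup>2) \<partial>rescaled_coordinate n X i) \<partial>count_space (I - F)) < \<infinity>"
      using fin by simp
  qed (use n prob_space_rescaled_coordinate sets_rescaled_coordinate in auto)
  then have AE: "AE t in PiM I ?K. rescale I n X t \<in> H_space I w"
    unfolding eq by (rule AE_distrD[OF RK])
  have "distr (posterior I w p n X) (H_borel I w) (rescale I n X)
      = distr (PiM I ?K) (H_borel I w) (rescale I n X \<circ> to_H I w)"
    unfolding posterior_def H_law_def by (rule distr_distr[OF RH toHK])
  also have "\<dots> = distr (PiM I ?K) (H_borel I w) (to_H I w \<circ> rescale I n X)"
  proof (rule distr_cong_AE)
    show "rescale I n X \<circ> to_H I w \<in> PiM I ?K \<rightarrow>\<^sub>M H_borel I w" by (rule measurable_comp[OF toHK RH])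
    show "to_H I w \<circ> rescale I n X \<in> PiM I ?K \<rightarrow>\<^sub>M H_borel I w" by (rule measurable_comp[OF RK toH])
    show "AE t in PiM I ?K. (rescale I n X \<circ> to_H I w) t = (to_H I w \<circ> rescale I n X) t"
      using AE_space AE
    proof eventually_elim
      case (elim t)
      have "t \<in> extensional I" using elim(1) by (simp add: space_PiM PiE_iff)
      then have "(\<lambda>i\<in>I. X i + (\<lambda>i\<in>I. 1 / sqrt n * rescale I n X t i) i) = t"
        using n by (intro ext) (auto simp: rescale_def extensional_def)
      then have "t \<in> H_space I w"
        using H_space_add(1)[of I w, OF w_pos X H_space_scale[OF w_pos elim(2), of "1 / sqrt n"]] by simp
      then show ?case using elim(2) by (simp add: to_H_def)
    qed
  qed simp_all
  also have "\<dots> = H_law I w (PiM I (rescaled_coordinate n X))"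
    unfolding H_law_def eq by (rule distr_distr[symmetric, OF toH RK])
  finally show ?thesis .
qed

section \<open>The law of the observations\<close>

lemma measurable_obs_map:
  "(\<lambda>W. \<lambda>i\<in>I. \<theta> i + W i / sqrt (real n)) \<in> H_borel I w \<rightarrow>\<^sub>M H_borel I w"
proof (rule measurable_coordinatewise_H_borel[OF w_pos I])
  fix x assume "x \<in> H_space I w"
  from H_space_add(1)[of I w, OF w_pos theta H_space_scale[OF w_pos this, of "1 / sqrt n"]]
  show "(\<lambda>i\<in>I. \<theta> i + x i / sqrt (real n)) \<in> H_space I w" by (auto simp: restrict_def cong: if_cong)
qed auto

lemma prob_space_obs_law: "prob_space (obs_law I w n \<theta>)"
proof -
  let ?G = "PiM I (\<lambda>i::'i. std_normal)"
  have sG: "sets ?G = sets (PiM I (\<lambda>i. borel))" by (rule sets_PiM_borel) simp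
  have toH: "to_H I w \<in> ?G \<rightarrow>\<^sub>M H_borel I w"
    using measurable_to_H[of I w, OF w_pos I] by (simp cong: measurable_cong_sets add: sG)
  have "prob_space (white_noise I w)"
    unfolding white_noise_def H_law_def
    by (intro prob_space.prob_space_distr[OF _ toH] prob_space_PiM prob_space_std_normal)
  moreover have "(\<lambda>W. \<lambda>i\<in>I. \<theta> i + W i / sqrt (real n)) \<in> white_noise I w \<rightarrow>\<^sub>M H_borel I w"
    using measurable_obs_map by (simp add: white_noise_def H_law_def)
  ultimately show ?thesis unfolding obs_law_def by (rule prob_space.prob_space_distr)
qed

text \<open>The normalized error \<open>sqrt n * (X i - \<theta> i)\<close> is exactly the white
  noise coordinate, hence standard normal for every positive \<open>n\<close>. Expectations over the
  data thus become one-dimensional Gaussian integrals.\<close>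

lemma nn_integral_obs_law_coordinate:
  assumes n: "0 < n" and i: "i \<in> I" and f: "f \<in> borel_measurable borel"
  shows "(\<integral>\<^sup>+X. f (sqrt (real n) * (X i - \<theta> i)) \<partial>obs_law I w n \<theta>)
    = (\<integral>\<^sup>+e. ennreal (std_normal_density e) * f e \<partial>lborel)"
proof -
  let ?G = "PiM I (\<lambda>i::'i. std_normal)"
  let ?T = "\<lambda>W. \<lambda>i\<in>I. \<theta> i + W i / sqrt (real n)"
  have sG: "sets ?G = sets (PiM I (\<lambda>i. borel))" by (rule sets_PiM_borel) simp
  have toH: "to_H I w \<in> ?G \<rightarrow>\<^sub>M H_borel I w"
    using measurable_to_H[of I w, OF w_pos I] by (simp cong: measurable_cong_sets add: sG)
  have T: "?T \<in> H_borel I w \<rightarrow>\<^sub>M H_borel I w" by (rule measurable_obs_map)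
  have comp: "(\<lambda>X. X i) \<in> borel_measurable (H_borel I w)" by (rule measurable_H_component[OF w_pos i])
  have fm: "(\<lambda>X. f (sqrt (real n) * (X i - \<theta> i))) \<in> borel_measurable (H_borel I w)"
    using comp f by measurable
  have fc: "(\<lambda>X. f (X i)) \<in> borel_measurable (H_borel I w)" using comp f by measurable
  \<comment> \<open>With \<open>F\<close> empty, the expected squared norm of white noise is the sum
    of the weights; its finiteness puts the noise in the space almost surely.\<close>
  have "(\<integral>\<^sup>+i. ennreal (w i) * (\<integral>\<^sup>+t. ennreal (t\<^sup>2) \<partial>std_normal) \<partial>count_space (I - {})) = ennreal (infsum w I)"
    using w_pos by (simp add: nn_integral_power2_std_normal ennreal_infsum[OF w_sum] less_imp_le)
  then have AE: "AE x in ?G. x \<in> H_space I w"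
    using w_pos by (intro AE_PiM_H_space[OF I, where F = "{}"]) (auto simp: prob_space_std_normal)
  have "(\<integral>\<^sup>+X. f (sqrt (real n) * (X i - \<theta> i)) \<partial>obs_law I w n \<theta>)
      = (\<integral>\<^sup>+W. f (sqrt (real n) * (?T W i - \<theta> i)) \<partial>white_noise I w)"
    unfolding obs_law_def using T fm by (subst nn_integral_distr) (auto simp: white_noise_def H_law_def)
  also have "\<dots> = (\<integral>\<^sup>+W. f (W i) \<partial>white_noise I w)" using n i by simp
  also have "\<dots> = (\<integral>\<^sup>+x. f (to_H I w x i) \<partial>?G)"
    unfolding white_noise_def H_law_def by (rule nn_integral_distr[OF toH]) (use fc in simp)
  also have "\<dots> = (\<integral>\<^sup>+x. f (x i) \<partial>?G)"
    using AE by (intro nn_integral_cong_AE) (auto simp: to_H_def elim: eventually_mono)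
  also have "\<dots> = (\<integral>\<^sup>+e. f e \<partial>std_normal)"
    by (rule nn_integral_PiM_component[OF I]) (use w_pos i f prob_space_std_normal in auto)
  also have "\<dots> = (\<integral>\<^sup>+e. ennreal (std_normal_density e) * f e \<partial>lborel)"
    using f by (subst nn_integral_density) auto
  finally show ?thesis .
qed

text \<open>The posterior mean of the squared weighted norm of the rescaled error outside
  \<open>F\<close>; it is still random through \<open>X\<close>.\<close>

definition tail_bound :: "nat \<Rightarrow> 'i set \<Rightarrow> ('i \<Rightarrow> real) \<Rightarrow> ennreal" where
  "tail_bound n F X = (\<integral>\<^sup>+i. ennreal (w i) * coordinate_moment n i (sqrt (real n) * (X i - \<theta> i)) \<partial>count_space (I - F))"

text \<open>If the bound is infinite, there is nothing to show; if it is finite, it provides the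
  moment conditions that the comparison of laws asks for. The estimate therefore holds for every
  observation in the space.\<close>

lemma BL_dist_posterior_le:
  assumes n: "0 < n" and X: "X \<in> H_space I w" and F: "finite F" "F \<subseteq> I" and s: "0 < s"
  shows "ennreal \<bar>BL_dist (H_space I w) (H_dist I w)
      (distr (posterior I w p n X) (H_borel I w) (rescale I n X)) (white_noise I w)\<bar>
    \<le> (ennreal s + ennreal (1 / s) * tail_bound n F X)
      + (\<Sum>i\<in>F. coordinate_distance n i (sqrt (real n) * (X i - \<theta> i)))
      + (ennreal s + ennreal (1 / s) * (\<integral>\<^sup>+i. ennreal (w i) \<partial>count_space (I - F)))" (is "_ \<le> ?B")
proof (cases "?B < \<infinity>")
  case False
  then have "?B = top" by (metis infinity_ennreal_def top.not_eq_extremum)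
  then show ?thesis by (simp only: top_greatest)
next
  case True
  interpret H: Metric_space "H_space I w" "H_dist I w" by (rule Metric_space_H) (rule w_pos)
  have fin: "tail_bound n F X < \<infinity>" "(\<integral>\<^sup>+i. ennreal (w i) \<partial>count_space (I - F)) < \<infinity>"
    using True s by (auto simp: ennreal_mult_less_top ennreal_eq_0_iff less_top[symmetric] ennreal_mult_eq_top_iff)
  have TM: "(\<integral>\<^sup>+i. ennreal (w i) * (\<integral>\<^sup>+t. ennreal (t\<^sup>2) \<partial>rescaled_coordinate n X i) \<partial>count_space (I - F)) = tail_bound n F X"
    unfolding tail_bound_def by (intro nn_integral_cong) (simp add: nn_integral_power2_rescaled_coordinate)
  have TN: "(\<integral>\<^sup>+i. ennreal (w i) * (\<integral>\<^sup>+t. ennreal (t\<^sup>2) \<partial>std_normal) \<partial>count_space (I - F))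
      = (\<integral>\<^sup>+i. ennreal (w i) \<partial>count_space (I - F))"
    by (simp add: nn_integral_power2_std_normal)
  have eq: "distr (posterior I w p n X) (H_borel I w) (rescale I n X) = H_law I w (PiM I (rescaled_coordinate n X))"
    by (rule rescaled_posterior_eq[OF n X F]) (use fin(1) in \<open>simp add: tail_bound_def\<close>)
  show ?thesis
  proof (rule BL_dist_le[OF True])
    fix u assume u: "u \<in> BL_ball (H_space I w) (H_dist I w)"
    have D: "ennreal \<bar>(\<integral>t. f t \<partial>rescaled_coordinate n X i) - (\<integral>t. f t \<partial>std_normal)\<bar>
        \<le> coordinate_distance n i (sqrt (real n) * (X i - \<theta> i))"
      if "i \<in> F" "f \<in> borel_measurable borel" "\<And>t. \<bar>f t\<bar> \<le> 1" for i f
    proof -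
      have i: "i \<in> I" using that F by auto
      show ?thesis
        unfolding rescaled_coordinate_def coordinate_distance_def
        by (intro integral_density_diff_bound tilt_local_meas tilt_local_nonneg nn_integral_tilt_local
            that i n nn_integral_std_normal normal_density_nonneg) simp
    qed
    show "ennreal \<bar>(\<integral>x. u x \<partial>distr (posterior I w p n X) (H_borel I w) (rescale I n X)) - (\<integral>x. u x \<partial>white_noise I w)\<bar> \<le> ?B"
      unfolding eq white_noise_def TM[symmetric] TN[symmetric]
      by (rule H_law_compare[OF I w_pos u F s])
        (use D n prob_space_rescaled_coordinate sets_rescaled_coordinate prob_space_std_normal fin TM TN in auto)
  qed simp
qed

text \<open>Tonelli's theorem moves the average over the data inside the sum over coordinates, where
  the uniform constant \<open>K\<close> factors out and leaves the tail of the weights.\<close>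

lemma nn_integral_bound_le:
  assumes n: "0 < n" and F: "finite F" "F \<subseteq> I" and s: "0 < s"
    and K: "0 \<le> K" "\<And>i. i \<in> I \<Longrightarrow>
      (\<integral>\<^sup>+e. ennreal (std_normal_density e) * coordinate_moment n i e \<partial>lborel) \<le> ennreal K"
    and F_small: "(\<integral>\<^sup>+i. ennreal (w i) \<partial>count_space (I - F)) \<le> ennreal \<zeta>" and zeta: "0 \<le> \<zeta>"
  defines "B \<equiv> \<lambda>X. (ennreal s + ennreal (1 / s) * tail_bound n F X)
      + (\<Sum>i\<in>F. coordinate_distance n i (sqrt (real n) * (X i - \<theta> i)))
      + (ennreal s + ennreal (1 / s) * (\<integral>\<^sup>+i. ennreal (w i) \<partial>count_space (I - F)))"
  shows "B \<in> borel_measurable (obs_law I w n \<theta>)"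
    "(\<integral>\<^sup>+X. B X \<partial>obs_law I w n \<theta>) \<le> ennreal (2 * s + (K + 1) * \<zeta> / s)
      + (\<Sum>i\<in>F. \<integral>\<^sup>+e. ennreal (std_normal_density e) * coordinate_distance n i e \<partial>lborel)"
proof -
  let ?P = "obs_law I w n \<theta>"
  have sP: "sets ?P = sets (H_borel I w)" by (simp add: obs_law_def)
  have comp: "(\<lambda>X. X i) \<in> borel_measurable ?P" if "i \<in> I" for i
    using measurable_H_component[OF w_pos that] by (simp cong: measurable_cong_sets add: sP)
  have cm: "(\<lambda>X. f (sqrt (real n) * (X i - \<theta> i))) \<in> borel_measurable ?P"
    if "i \<in> I" "f \<in> borel_measurable borel" for f :: "real \<Rightarrow> ennreal" and i
    using comp[OF that(1)] that(2) by measurable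
  have mm: "(\<lambda>X. ennreal (w i) * coordinate_moment n i (sqrt (real n) * (X i - \<theta> i))) \<in> borel_measurable ?P" if "i \<in> I" for i
    using cm[OF that measurable_coordinate_moment[OF that]] by measurable
  have tm [measurable]: "tail_bound n F \<in> borel_measurable ?P"
    unfolding tail_bound_def using I mm by (intro measurable_nn_integral_count_space) auto
  have dm [measurable]: "(\<lambda>X. \<Sum>i\<in>F. coordinate_distance n i (sqrt (real n) * (X i - \<theta> i))) \<in> borel_measurable ?P"
    using F by (intro borel_measurable_sum cm measurable_coordinate_distance) auto
  show "B \<in> borel_measurable ?P" unfolding B_def by measurable
  have PP: "emeasure ?P (space ?P) = 1"
    by (rule prob_space.emeasure_space_1[OF prob_space_obs_law])
  have tail: "(\<integral>\<^sup>+X. tail_bound n F X \<partial>?P) \<le> ennreal (K * \<zeta>)"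
  proof -
    have "(\<integral>\<^sup>+X. tail_bound n F X \<partial>?P)
        = (\<integral>\<^sup>+i. (\<integral>\<^sup>+X. ennreal (w i) * coordinate_moment n i (sqrt (real n) * (X i - \<theta> i)) \<partial>?P) \<partial>count_space (I - F))"
      unfolding tail_bound_def using I mm by (intro nn_integral_count_space_nn_integral) auto
    also have "\<dots> \<le> (\<integral>\<^sup>+i. ennreal K * ennreal (w i) \<partial>count_space (I - F))"
    proof (rule nn_integral_mono)
      fix i assume "i \<in> space (count_space (I - F))"
      then have i: "i \<in> I" by simp
      have "(\<integral>\<^sup>+X. ennreal (w i) * coordinate_moment n i (sqrt (real n) * (X i - \<theta> i)) \<partial>?P)
          = ennreal (w i) * (\<integral>\<^sup>+e. ennreal (std_normal_density e) * coordinate_moment n i e \<partial>lborel)"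
        using cm[OF i measurable_coordinate_moment[OF i]]
        by (simp add: nn_integral_cmult nn_integral_obs_law_coordinate[OF n i measurable_coordinate_moment[OF i]])
      also have "\<dots> \<le> ennreal (w i) * ennreal K" by (intro mult_left_mono K i) simp
      finally show "(\<integral>\<^sup>+X. ennreal (w i) * coordinate_moment n i (sqrt (real n) * (X i - \<theta> i)) \<partial>?P) \<le> ennreal K * ennreal (w i)"
        by (simp add: mult.commute)
    qed
    also have "\<dots> = ennreal K * (\<integral>\<^sup>+i. ennreal (w i) \<partial>count_space (I - F))" by (rule nn_integral_cmult) simp
    also have "\<dots> \<le> ennreal K * ennreal \<zeta>" by (intro mult_left_mono F_small) simp
    finally show ?thesis using K(1) by (simp add: ennreal_mult')
  qed
  have "(\<integral>\<^sup>+X. B X \<partial>?P) = (ennreal s + ennreal (1 / s) * (\<integral>\<^sup>+X. tail_bound n F X \<partial>?P))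
      + (\<integral>\<^sup>+X. (\<Sum>i\<in>F. coordinate_distance n i (sqrt (real n) * (X i - \<theta> i))) \<partial>?P)
      + (ennreal s + ennreal (1 / s) * (\<integral>\<^sup>+i. ennreal (w i) \<partial>count_space (I - F)))"
    unfolding B_def by (simp add: nn_integral_add nn_integral_cmult PP)
  also have "(\<integral>\<^sup>+X. (\<Sum>i\<in>F. coordinate_distance n i (sqrt (real n) * (X i - \<theta> i))) \<partial>?P)
      = (\<Sum>i\<in>F. \<integral>\<^sup>+X. coordinate_distance n i (sqrt (real n) * (X i - \<theta> i)) \<partial>?P)"
    using F by (intro nn_integral_sum cm measurable_coordinate_distance) auto
  also have "\<dots> = (\<Sum>i\<in>F. \<integral>\<^sup>+e. ennreal (std_normal_density e) * coordinate_distance n i e \<partial>lborel)" (is "_ = ?D")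
    using F by (intro sum.cong refl nn_integral_obs_law_coordinate n measurable_coordinate_distance) auto
  also have "(ennreal s + ennreal (1 / s) * (\<integral>\<^sup>+X. tail_bound n F X \<partial>?P)) + ?D
      + (ennreal s + ennreal (1 / s) * (\<integral>\<^sup>+i. ennreal (w i) \<partial>count_space (I - F)))
    \<le> (ennreal s + ennreal (1 / s) * ennreal (K * \<zeta>)) + ?D + (ennreal s + ennreal (1 / s) * ennreal \<zeta>)"
    by (intro add_mono mult_left_mono order.refl tail F_small) auto
  also have "\<dots> = ((ennreal s + ennreal (1 / s) * ennreal (K * \<zeta>)) + (ennreal s + ennreal (1 / s) * ennreal \<zeta>)) + ?D"
    by (simp add: ac_simps)
  also have "(ennreal s + ennreal (1 / s) * ennreal (K * \<zeta>)) + (ennreal s + ennreal (1 / s) * ennreal \<zeta>)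
      = ennreal (2 * s + (K + 1) * \<zeta> / s)"
    using s K(1) zeta
    by (simp add: ennreal_mult'[symmetric] ennreal_plus[symmetric] algebra_simps add_divide_distrib del: ennreal_plus)
  finally show "(\<integral>\<^sup>+X. B X \<partial>?P) \<le> ennreal (2 * s + (K + 1) * \<zeta> / s) + ?D" .
qed

lemma BL_dist_posterior_tends_to_0:
  assumes K: "\<And>n i. 0 < n \<Longrightarrow> i \<in> I \<Longrightarrow>
      (\<integral>\<^sup>+e. ennreal (std_normal_density e) * coordinate_moment n i e \<partial>lborel) \<le> ennreal K"
    and lim: "\<And>i. i \<in> I \<Longrightarrow>
      (\<lambda>n. \<integral>\<^sup>+e. ennreal (std_normal_density e) * coordinate_distance n i e \<partial>lborel) \<longlonglongrightarrow> 0"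
  shows "tends_to_0_in_prob (\<lambda>n. obs_law I w n \<theta>)
    (\<lambda>n X. BL_dist (H_space I w) (H_dist I w)
      (distr (posterior I w p n X) (H_borel I w) (rescale I n X)) (white_noise I w))"
    (is "tends_to_0_in_prob ?P ?Y")
  unfolding tends_to_0_in_prob_def
proof (intro allI impI)
  fix e :: real assume e: "0 < e"
  \<comment> \<open>\<open>ennreal\<close> sends negative numbers to 0, so this replacement leaves
    the hypothesis unchanged and makes the constant nonnegative.\<close>
  define K' where "K' = max K 0"
  have K': "0 \<le> K'" and KK: "ennreal K = ennreal K'" by (auto simp: K'_def max_def ennreal_neg)
  have small: "\<forall>\<^sub>F n in sequentially.
      outer_measure_of (?P n) {x \<in> space (?P n). e < \<bar>?Y n x\<bar>} \<le> ennreal \<eta>" if eta: "0 < \<eta>" for \<eta>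
  proof -
    \<comment> \<open>First \<open>s\<close>, then \<open>\<zeta>\<close> and \<open>F\<close>, and
      only then \<open>n\<close>. The term \<open>(K' + 1) * \<zeta> / s\<close> equals
      \<open>s\<close>, and the coordinates in \<open>F\<close> contribute less than
      \<open>s\<close> for large \<open>n\<close>, so that the mean is at most
      \<open>4 * s = e * \<eta> / 2\<close>. Markov's inequality divides this by
      \<open>e\<close>.\<close>
    define s where "s = e * \<eta> / 8"
    define \<zeta> where "\<zeta> = s * s / (K' + 1)"
    have s: "0 < s" using e eta by (simp add: s_def)
    have zeta: "0 < \<zeta>" using s K' by (simp add: \<zeta>_def)
    obtain F where F: "finite F" "F \<subseteq> I" "(\<integral>\<^sup>+i. ennreal (w i) \<partial>count_space (I - F)) \<le> ennreal \<zeta>"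
      using summable_on_nn_integral_tail[OF w_sum _ zeta] w_pos by (auto simp: less_imp_le)
    let ?d = "\<lambda>n i. \<integral>\<^sup>+e. ennreal (std_normal_density e) * coordinate_distance n i e \<partial>lborel"
    have "(\<lambda>n. \<Sum>i\<in>F. ?d n i) \<longlonglongrightarrow> (\<Sum>i\<in>F. 0)"
      using F(2) by (intro tendsto_sum lim) auto
    then have "(\<lambda>n. \<Sum>i\<in>F. ?d n i) \<longlonglongrightarrow> 0" by simp
    from order_tendstoD(2)[OF this, of "ennreal s"] s
    have "\<forall>\<^sub>F n in sequentially. (\<Sum>i\<in>F. ?d n i) < ennreal s" by simp
    then show ?thesis
      using eventually_gt_at_top[of 0]
    proof eventually_elim
      case (elim n)
      let ?B = "\<lambda>X. (ennreal s + ennreal (1 / s) * tail_bound n F X)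
        + (\<Sum>i\<in>F. coordinate_distance n i (sqrt (real n) * (X i - \<theta> i)))
        + (ennreal s + ennreal (1 / s) * (\<integral>\<^sup>+i. ennreal (w i) \<partial>count_space (I - F)))"
      note B = nn_integral_bound_le[OF elim(2) F(1,2) s K' K[OF elim(2), unfolded KK] F(3) less_imp_le[OF zeta]]
      have "outer_measure_of (?P n) {x \<in> space (?P n). e < \<bar>?Y n x\<bar>} \<le> ennreal (1 / e) * (\<integral>\<^sup>+X. ?B X \<partial>?P n)"
      proof (rule outer_measure_le_nn_integral[OF B(1) e])
        fix X assume "X \<in> space (?P n)"
        moreover have "space (H_borel I w) = H_space I w" by (rule space_H_borel) (rule w_pos)
        ultimately have "X \<in> H_space I w" by (simp add: obs_law_def)
        then show "ennreal \<bar>?Y n X\<bar> \<le> ?B X" by (rule BL_dist_posterior_le[OF elim(2) _ F(1,2) s])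
      qed
      also have "(\<integral>\<^sup>+X. ?B X \<partial>?P n) \<le> ennreal (2 * s + (K' + 1) * \<zeta> / s) + (\<Sum>i\<in>F. ?d n i)"
        by (rule B(2))
      also have "(K' + 1) * \<zeta> = s * s" using K' by (simp add: \<zeta>_def)
      also have "2 * s + s * s / s = 3 * s" using s by simp
      also have "ennreal (3 * s) + (\<Sum>i\<in>F. ?d n i) \<le> ennreal (3 * s) + ennreal s"
        using elim(1) by (intro add_left_mono) simp
      also have "\<dots> = ennreal (e * \<eta> / 2)"
        using s by (subst ennreal_plus[symmetric]) (simp_all add: s_def mult.commute)
      also have "ennreal (1 / e) * \<dots> = ennreal (\<eta> / 2)"
        using e eta by (subst ennreal_mult'[symmetric]) auto
      also have "\<dots> \<le> ennreal \<eta>" using eta by (intro ennreal_leI) simp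
      finally show ?case by (simp add: mult_left_mono)
    qed
  qed
  show "(\<lambda>n. outer_measure_of (?P n) {x \<in> space (?P n). e < \<bar>?Y n x\<bar>}) \<longlonglongrightarrow> 0"
  proof (rule order_tendstoI)
    fix a :: ennreal assume "0 < a"
    \<comment> \<open>\<open>a\<close> may be infinite; a number strictly between 0 and
      \<open>a\<close> is finite and supplies the real \<open>\<eta>\<close>.\<close>
    then obtain b where b: "0 < b" "b < a" using dense by blast
    then obtain \<eta> where "b = ennreal \<eta>" "0 \<le> \<eta>" by (cases b) auto
    with b have eta: "0 < \<eta>" "ennreal \<eta> < a" by auto
    from small[OF eta(1)] show "\<forall>\<^sub>F n in sequentially. outer_measure_of (?P n) {x \<in> space (?P n). e < \<bar>?Y n x\<bar>} < a"
      by eventually_elim (rule order.strict_trans1[OF _ eta(2)])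
  qed simp
qed

end

theorem theorem9:
  fixes S :: nat
    and L :: "int set" and Z :: "int \<Rightarrow> int set" and a :: "int \<Rightarrow> real"
    and \<psi> :: "int \<times> int \<Rightarrow> real \<Rightarrow> complex"
    and f\<^sub>0 :: "real \<Rightarrow> complex"
    and \<phi> :: "real \<Rightarrow> real" and \<sigma> :: "int \<Rightarrow> real"
    and M \<tau> c C \<delta> :: real
  defines "I \<equiv> Sigma L Z"
    and "\<theta>\<^sub>0 \<equiv> basis_coeffs (Sigma L Z) \<psi> f\<^sub>0"
    and "w \<equiv> H_weight a \<delta>"
  assumes S: "1 \<le> S"
    and basis: "regular_basis S L Z a \<psi>"
    and f0: "f\<^sub>0 \<in> L2"
    and f0_real: "\<And>i. i \<in> I \<Longrightarrow> L2_inner f\<^sub>0 (\<psi> i) \<in> \<real>"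
    and phi_meas: "\<phi> \<in> borel_measurable borel"
    and phi_nonneg: "\<And>x. 0 \<le> \<phi> x"
    and phi_prob: "(\<integral>\<^sup>+x. ennreal (\<phi> x) \<partial>lborel) = 1"
    and sigma_pos: "\<And>l. l \<in> L \<Longrightarrow> 0 < \<sigma> l"
    and sigma_summable: "(\<lambda>(l, k). (\<sigma> l)\<^sup>2) summable_on I"
    and M: "0 < M"
    and P1: "\<And>l k. (l, k) \<in> I \<Longrightarrow> \<bar>\<theta>\<^sub>0 (l, k)\<bar> / \<sigma> l \<le> M"
    and tau: "M < \<tau>"
    and cC: "0 < c" "c \<le> C"
    and P2_upper: "\<And>x. \<phi> x \<le> C"
    and P2_lower: "\<And>x. x \<in> {-\<tau><..<\<tau>} \<Longrightarrow> c \<le> \<phi> x"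
    and P2_moment: "integrable lborel (\<lambda>x. x\<^sup>2 * \<phi> x)"
    and cont: "\<And>i. i \<in> I \<Longrightarrow> \<forall>\<^sub>F x in nhds (\<theta>\<^sub>0 i). isCont (prior_density \<phi> \<sigma> i) x"
    and delta: "1 / 2 < \<delta>"
  shows "tends_to_0_in_prob
    (\<lambda>n. obs_law I w n \<theta>\<^sub>0)
    (\<lambda>n X. BL_dist (H_space I w) (H_dist I w)
       (distr (posterior I w (prior_density \<phi> \<sigma>) n X) (H_borel I w) (rescale I n X))
       (white_noise I w))"
proof -
  let ?p = "prior_density \<phi> \<sigma>"
  let ?d = "\<lambda>n i. local_density (?p i) (\<theta>\<^sub>0 i) n"
  note [measurable] = phi_meas
  \<comment> \<open>In units of the prior scale the truth has absolute value at most
    \<open>M\<close>, so this margin keeps its neighbourhood inside the interval on which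
    \<open>\<phi> \<ge> c\<close>.\<close>
  define \<rho> where "\<rho> = \<tau> - M"
  have rho: "0 < \<rho>" using tau by (simp add: \<rho>_def)
  have I: "countable I" by simp
  have phi_lower: "c \<le> \<phi> x" if "\<bar>x\<bar> < \<tau>" for x using P2_lower[of x] that by (simp add: abs_less_iff)
  have w_pos: "0 < w i" if "i \<in> I" for i
    using H_weight_pos[OF basis] that by (simp add: w_def I_def)
  have w_sum: "w summable_on I"
    unfolding w_def I_def by (rule H_weight_summable[OF basis delta])
  have sigma: "0 < \<sigma> (fst i)" if "i \<in> I" for i using that sigma_pos by (auto simp: I_def)
  have p_eq: "?p i t = \<phi> (t / \<sigma> (fst i)) / \<sigma> (fst i)" for i t
    by (simp add: prior_density_def split_beta' divide_inverse mult.commute)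
  have ratio: "\<bar>\<theta>\<^sub>0 i\<bar> / \<sigma> (fst i) \<le> M" if "i \<in> I" for i using P1[of "fst i" "snd i"] that by simp
  have p_meas: "?p i \<in> borel_measurable borel" if "i \<in> I" for i
    unfolding p_eq[abs_def] by measurable
  have p_nonneg: "0 \<le> ?p i t" if "i \<in> I" for i t
    using phi_nonneg sigma[OF that] by (simp add: p_eq)
  have p_prob: "(\<integral>\<^sup>+t. ennreal (?p i t) \<partial>lborel) = 1" if "i \<in> I" for i
  proof -
    let ?s = "\<sigma> (fst i)"
    have "(\<integral>\<^sup>+t. ennreal (?p i t) \<partial>lborel) = ennreal ?s * (\<integral>\<^sup>+x. ennreal (?p i (?s * x)) \<partial>lborel)"
      using nn_integral_real_affine[of "\<lambda>t. ennreal (?p i t)" ?s 0] p_meas[OF that] sigma[OF that] by simp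
    also have "\<dots> = (\<integral>\<^sup>+x. ennreal (\<phi> x) \<partial>lborel)"
      using sigma[OF that] phi_nonneg
      by (subst nn_integral_cmult[symmetric]) (auto simp: p_eq ennreal_mult'[symmetric] intro!: nn_integral_cong)
    finally show ?thesis by (simp add: phi_prob)
  qed
  have p_upper: "?p i t \<le> C / \<sigma> (fst i)" if "i \<in> I" for i t
    unfolding p_eq using P2_upper sigma[OF that] by (intro divide_right_mono) auto
  have p_pos: "0 < ?p i (\<theta>\<^sub>0 i)" if "i \<in> I" for i
  proof -
    have "\<bar>\<theta>\<^sub>0 i / \<sigma> (fst i)\<bar> < \<tau>" using ratio[OF that] sigma[OF that] tau by (simp add: abs_divide)
    then have "c \<le> \<phi> (\<theta>\<^sub>0 i / \<sigma> (fst i))" by (rule phi_lower)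
    then show ?thesis using cC sigma[OF that] by (simp add: p_eq)
  qed
  have theta: "\<theta>\<^sub>0 \<in> H_space I w"
  proof -
    \<comment> \<open>Summable weights are bounded by their sum, and (P1) bounds the coefficients by
      \<open>M * \<sigma>\<close>, whose squares are summable.\<close>
    obtain W where W: "w i \<le> W" if "i \<in> I" for i
    proof (rule that[of "infsum w I"])
      fix i assume "i \<in> I"
      then show "w i \<le> infsum w I"
        using finite_sum_le_infsum[OF w_sum, of "{i}"] w_pos by (auto simp: less_imp_le)
    qed
    have "(\<lambda>i. W * M\<^sup>2 * (\<sigma> (fst i))\<^sup>2) summable_on I"
      using sigma_summable by (intro summable_on_cmult_right) (simp add: split_beta')
    then have "(\<lambda>i. w i * (\<theta>\<^sub>0 i)\<^sup>2) summable_on I"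
    proof (rule summable_on_comparison_test)
      fix i assume i: "i \<in> I"
      have "\<bar>\<theta>\<^sub>0 i\<bar> \<le> M * \<sigma> (fst i)" using ratio[OF i] sigma[OF i] by (simp add: field_simps)
      then have "(\<theta>\<^sub>0 i)\<^sup>2 \<le> (M * \<sigma> (fst i))\<^sup>2" by (metis abs_ge_zero power2_abs power_mono)
      then have "w i * (\<theta>\<^sub>0 i)\<^sup>2 \<le> W * (M * \<sigma> (fst i))\<^sup>2"
        using W[OF i] w_pos[OF i] by (intro mult_mono) auto
      then show "w i * (\<theta>\<^sub>0 i)\<^sup>2 \<le> W * M\<^sup>2 * (\<sigma> (fst i))\<^sup>2" by (simp add: power_mult_distrib)
      show "0 \<le> w i * (\<theta>\<^sub>0 i)\<^sup>2" using w_pos[OF i] by simp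
    qed
    then show ?thesis by (simp add: H_space_def \<theta>\<^sub>0_def basis_coeffs_def I_def)
  qed
  interpret product_posterior I w \<theta>\<^sub>0 ?p
    by unfold_locales (blast intro: I w_pos w_sum theta p_meas p_nonneg p_prob)+
  show ?thesis
  proof (rule BL_dist_posterior_tends_to_0)
    fix n :: nat and i assume n: "0 < n" and i: "i \<in> I"
    let ?s = "\<sigma> (fst i)" and ?x = "\<theta>\<^sub>0 i / \<sigma> (fst i)"
    \<comment> \<open>In units of \<open>1 / sqrt n\<close> the prior has scale
      \<open>?s * sqrt n\<close>: lengths are multiplied and densities divided by it. It cancels
      from \<open>?\<kappa> * ?R = c * \<rho>\<close> and \<open>?B / ?\<kappa> = C / c\<close>,
      which makes the moment bound uniform in \<open>n\<close> and in the coordinate.\<close>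
    let ?\<kappa> = "c / (?s * sqrt n)" and ?R = "\<rho> * ?s * sqrt n" and ?B = "C / (?s * sqrt n)"
    have s: "0 < ?s" by (rule sigma[OF i])
    have lower: "?\<kappa> \<le> ?d n i v" if v: "\<bar>v\<bar> < ?R" for v
    proof -
      have "\<bar>v / sqrt n / ?s\<bar> < \<rho>" using v s n by (simp add: abs_mult field_simps)
      moreover have "\<bar>?x\<bar> \<le> M" using ratio[OF i] s by (simp add: abs_divide)
      ultimately have "\<bar>?x + v / sqrt n / ?s\<bar> < \<tau>"
        unfolding \<rho>_def by linarith
      then have "c \<le> \<phi> (?x + v / sqrt n / ?s)" by (rule phi_lower)
      then have "c / ?s / sqrt n \<le> \<phi> (?x + v / sqrt n / ?s) / ?s / sqrt n"
        using s n by (intro divide_right_mono) auto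
      then show ?thesis by (simp add: local_density_def p_eq add_divide_distrib)
    qed
    have upper: "?d n i v \<le> ?B" for v
      using divide_right_mono[OF p_upper[OF i, of "\<theta>\<^sub>0 i + v / sqrt n"], of "sqrt n"]
      by (simp add: local_density_def)
    have "(\<integral>\<^sup>+e. ennreal (std_normal_density e) * (\<integral>\<^sup>+h. ennreal (h\<^sup>2 * tilt (?d n i) e h) \<partial>lborel) \<partial>lborel)
      \<le> ennreal (2 * exp (\<rho>\<^sup>2 / 2) * max (1 / (?\<kappa> * ?R)) (4 * ?B / (?\<kappa> * \<rho>\<^sup>2)))"
    proof (rule tilt_second_moment)
      show "(\<integral>\<^sup>+t. ennreal (?d n i t) \<partial>lborel) = 1"
        by (simp add: nn_integral_local_density p_meas[OF i] n p_prob[OF i])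
    qed (use p_meas[OF i] p_nonneg[OF i] rho s n cC lower upper in \<open>auto intro: measurable_local_density local_density_nonneg\<close>)
    also have "max (1 / (?\<kappa> * ?R)) (4 * ?B / (?\<kappa> * \<rho>\<^sup>2)) = max (1 / (c * \<rho>)) (4 * C / (c * \<rho>\<^sup>2))"
      using s n by simp
    finally show "(\<integral>\<^sup>+e. ennreal (std_normal_density e) * coordinate_moment n i e \<partial>lborel)
      \<le> ennreal (2 * exp (\<rho>\<^sup>2 / 2) * max (1 / (c * \<rho>)) (4 * C / (c * \<rho>\<^sup>2)))"
      by (simp add: coordinate_moment_def)
  next
    fix i assume i: "i \<in> I"
    have "isCont (?p i) (\<theta>\<^sub>0 i)" using cont[OF i] by (rule eventually_nhds_x_imp_x)
    then show "(\<lambda>n. \<integral>\<^sup>+e. ennreal (std_normal_density e) * coordinate_distance n i e \<partial>lborel) \<longlonglongrightarrow> 0"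
      unfolding coordinate_distance_def
      by (rule tilt_tendsto_std_normal[OF p_meas[OF i] p_nonneg[OF i] p_prob[OF i] p_upper[OF i] _ p_pos[OF i]])
  qed
qed

end
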